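(* Consider two single-server FIFO queues in tandem with i.i.d. interarrival times of mean $a$ and service times $\{\sigma_n^{(i)}\}$ of mean $b^{(i)}$ at station $i=1,2$, as specified in the context. Assume $a>b^{(1)}>b^{(2)}$ and $\mathbf{P}(\sigma^{(2)}>x)\sim d^{(2)}\overline{F}(x)$ as $x\to\infty$, where $d^{(2)}>0$ and the integrated tail distribution $F^s$ is subexponential. (No assumption is made on the tail of $\sigma^{(1)}$, nor is $F$ itself assumed subexponential.) Then the stationary waiting time $W^{(2)}$ at the second queue satisfies, as $x\to\infty$, $$\mathbf{P}(W^{(2)}>x)\sim\frac{d^{(2)}}{a-b^{(2)}}\overline{F}^s(x).$$
   Context: $f\sim g$ means $f(x)/g(x)\to1$ as $x\to\infty$. $F$ is a distribution function on $\mathbb{R}^+$ with finite mean, $\overline{F}=1-F$, and $F^s$ is the integrated tail distribution, with tail $\overline{F}^s(x)=\min\{1,\int_x^\infty\overline{F}(u)\,du\}$. Tandem queue: customer $n\in\mathbb{Z}$ arrives at station 1 at time $T_n$, $\tau_n=T_{n+1}-T_n\ge 0$. The sequences $\{\tau_n\}$, $\{\sigma_n^{(1)}\}$, $\{\sigma_n^{(2)}\}$ are mutually independent, and each consists of i.i.d. nonnegative random variables with means $a$, $b^{(1)}$, $b^{(2)}$. Customers are served in order of arrival at station 1, then at station 2, by a single server at each station. The stationary waiting time of customer $n$ at station 1 is $W_n^{(1)}=\sup_{k\ge0}\sum_{i=1}^k(\sigma_{n-i}^{(1)}-\tau_{n-i})$; the time between the arrivals of customers $n$ and $n+1$ at station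 2 is $\tau_n^{(2)}=-\min(0,W_n^{(1)}+\sigma_n^{(1)}-\tau_n)+\sigma_{n+1}^{(1)}$; and the stationary waiting time of customer $0$ at station 2 is $W^{(2)}=W_0^{(2)}=\sup_{k\ge0}\sum_{i=1}^k(\sigma_{-i}^{(2)}-\tau_{-i}^{(2)})$. *)

theory Defs
  imports "HOL-Probability.Probability" "HOL-Library.Landau_Symbols"
begin

unbundle asymp_equiv_syntax

definition nonneg_dist_fun :: "(real \<Rightarrow> real) \<Rightarrow> bool" where
  "nonneg_dist_fun F \<longleftrightarrow>
     mono F \<and> (\<forall>x. continuous (at_right x) F) \<and> (F \<longlongrightarrow> 1) at_top \<and> (\<forall>x<0. F x = 0)"

definition tail :: "(real \<Rightarrow> real) \<Rightarrow> real \<Rightarrow> real" where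
  "tail F x = 1 - F x"

text \<open>\<^term>\<open>interval_measure F\<close> is the probability law with distribution function \<^term>\<open>F\<close>.\<close>

definition finite_mean :: "(real \<Rightarrow> real) \<Rightarrow> bool" where
  "finite_mean F \<longleftrightarrow> integrable (interval_measure F) (\<lambda>x. x)"

text \<open>
  The integrated tail distribution lives on the nonnegative half-line: if the mean of \<^term>\<open>F\<close> is
  less than 1, the mass not accounted for by the integral is an atom at 0.
\<close>

definition integrated_tail :: "(real \<Rightarrow> real) \<Rightarrow> real \<Rightarrow> real" where
  "integrated_tail F x = (if x < 0 then 0 else 1 - min 1 (LBINT u:{x<..}. tail F u))"

definition conv_power2 :: "(real \<Rightarrow> real) \<Rightarrow> real \<Rightarrow> real" where
  "conv_power2 G = cdf (interval_measure G \<star> interval_measure G)"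

definition subexponential :: "(real \<Rightarrow> real) \<Rightarrow> bool" where
  "subexponential G \<longleftrightarrow>
     nonneg_dist_fun G \<and> (\<forall>x. tail G x > 0) \<and> tail (conv_power2 G) \<sim>[at_top] (\<lambda>x. 2 * tail G x)"

text \<open>
  The integral in \<^const>\<open>integrated_tail\<close> converges and \<^const>\<open>integrated_tail\<close> is again a distribution function.
\<close>

lemma nonneg_dist_fun_real_distribution:
  assumes "nonneg_dist_fun F"
  shows "real_distribution (interval_measure F)" "cdf (interval_measure F) = F"
proof -
  have m: "\<And>x y. x \<le> y \<Longrightarrow> F x \<le> F y" and c: "\<And>x. continuous (at_right x) F"
    and t: "(F \<longlongrightarrow> 1) at_top"
    using assms by (auto simp: nonneg_dist_fun_def mono_def)
  have b: "(F \<longlongrightarrow> 0) at_bot"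
    using assms by (intro tendsto_eventually)
      (auto simp: nonneg_dist_fun_def eventually_at_bot_dense)
  show "real_distribution (interval_measure F)" "cdf (interval_measure F) = F"
    by (auto intro!: real_distribution_interval_measure m c t b
             simp: fun_eq_iff cdf_def measure_interval_measure_Iic[OF m c b])
qed

lemma nonneg_dist_fun_bounds:
  assumes "nonneg_dist_fun F"
  shows "0 \<le> F x" "F x \<le> 1"
proof -
  interpret real_distribution "interval_measure F"
    by (rule nonneg_dist_fun_real_distribution[OF assms])
  show "0 \<le> F x" "F x \<le> 1"
    using cdf_nonneg[of x] cdf_bounded_prob[of x] by (simp_all add: nonneg_dist_fun_real_distribution[OF assms])
qed

lemma tail_measurable [measurable]:
  assumes "nonneg_dist_fun F"
  shows "tail F \<in> borel_measurable borel"
proof -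
  have [measurable]: "F \<in> borel_measurable borel"
    using assms by (intro borel_measurable_mono) (auto simp: nonneg_dist_fun_def)
  show ?thesis unfolding tail_def by measurable
qed

lemma set_integrable_tail:
  assumes "nonneg_dist_fun F" "finite_mean F"
  shows "set_integrable lborel {0<..} (tail F)"
proof -
  note [measurable] = tail_measurable[OF assms(1)]
  let ?N = "interval_measure F"
  interpret N: real_distribution ?N
    by (rule nonneg_dist_fun_real_distribution[OF assms(1)])
  interpret P: pair_sigma_finite lborel ?N ..
  have tl: "ennreal (tail F u) = emeasure ?N {u<..}" for u
  proof -
    have "measure ?N {u<..} = 1 - cdf ?N u"
      unfolding cdf_def using N.prob_compl[of "{..u}"] by (simp add: Compl_eq_Diff_UNIV[symmetric])
    then show ?thesis
      by (simp add: tail_def N.emeasure_eq_measure nonneg_dist_fun_real_distribution[OF assms(1)])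
  qed
  have "(\<integral>\<^sup>+u. ennreal (indicator {0<..} u * tail F u) \<partial>lborel)
      = (\<integral>\<^sup>+u. (\<integral>\<^sup>+y. indicator {p. 0 < fst p \<and> fst p < snd p} (u, y) \<partial>?N) \<partial>lborel)"
  proof (intro nn_integral_cong)
    fix u :: real
    have "(\<integral>\<^sup>+y. indicator {p. 0 < fst p \<and> fst p < snd p} (u, y) \<partial>?N)
        = (\<integral>\<^sup>+y. indicator {0<..} u * indicator {u<..} y \<partial>?N)"
      by (intro nn_integral_cong) (auto simp: indicator_def)
    also have "\<dots> = ennreal (indicator {0<..} u * tail F u)"
      by (cases "u > 0") (simp_all add: tl)
    finally show "ennreal (indicator {0<..} u * tail F u)
        = (\<integral>\<^sup>+y. indicator {p. 0 < fst p \<and> fst p < snd p} (u, y) \<partial>?N)" ..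
  qed
  also have "\<dots> = (\<integral>\<^sup>+y. (\<integral>\<^sup>+u. indicator {p. 0 < fst p \<and> fst p < snd p} (u, y) \<partial>lborel) \<partial>?N)"
    by (rule P.Fubini'[symmetric]) measurable
  also have "\<dots> \<le> (\<integral>\<^sup>+y. ennreal (norm y) \<partial>?N)"
  proof (intro nn_integral_mono)
    fix y :: real
    have "(\<integral>\<^sup>+u. indicator {p. 0 < fst p \<and> fst p < snd p} (u, y) \<partial>lborel)
        = (\<integral>\<^sup>+u. indicator {0<..<y} u \<partial>lborel)"
      by (intro nn_integral_cong) (auto simp: indicator_def)
    also have "\<dots> \<le> ennreal (norm y)"
      by (cases "0 \<le> y") auto
    finally show "(\<integral>\<^sup>+u. indicator {p. 0 < fst p \<and> fst p < snd p} (u, y) \<partial>lborel) \<le> ennreal (norm y)" .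
  qed
  also have "\<dots> < \<infinity>"
    using assms(2) by (auto simp: finite_mean_def integrable_iff_bounded)
  finally have *: "(\<integral>\<^sup>+u. ennreal (indicator {0<..} u * tail F u) \<partial>lborel) < \<infinity>" .
  have "0 \<le> tail F u" for u
    using nonneg_dist_fun_bounds[OF assms(1), of u] by (simp add: tail_def)
  then show ?thesis
    unfolding set_integrable_def
    by (intro integrableI_nonneg AE_I2) (use * in \<open>auto simp: indicator_def\<close>)
qed

lemma nonneg_dist_fun_integrated_tail:
  assumes "nonneg_dist_fun F" "finite_mean F"
  shows "nonneg_dist_fun (integrated_tail F)"
proof -
  note [measurable] = tail_measurable[OF assms(1)]
  define I where "I x = (LBINT u:{x<..}. tail F u)" for x
  have t: "0 \<le> tail F u" "tail F u \<le> 1" for u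
    using nonneg_dist_fun_bounds[OF assms(1), of u] by (auto simp: tail_def)
  have int: "set_integrable lborel A (tail F)" if "A \<in> sets borel" "A \<subseteq> {0<..}" for A
    by (rule set_integrable_subset[OF set_integrable_tail[OF assms]]) (use that in auto)
  have split: "I x = (LBINT u:{x<..y}. tail F u) + I y" if "0 \<le> x" "x \<le> y" for x y
  proof -
    have "I x = (LBINT u:({x<..y} \<union> {y<..}). tail F u)"
      using that by (simp add: I_def ivl_disj_un)
    also have "\<dots> = (LBINT u:{x<..y}. tail F u) + I y"
      unfolding I_def by (intro set_integral_Un int) (use that in auto)
    finally show ?thesis .
  qed
  have lo: "0 \<le> (LBINT u:{x<..y}. tail F u)" for x y
    unfolding set_lebesgue_integral_def by (intro Bochner_Integration.integral_nonneg) (simp add: t)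
  have hi: "(LBINT u:{x<..y}. tail F u) \<le> y - x" if "0 \<le> x" "x \<le> y" for x y
  proof -
    have "(LBINT u:{x<..y}. tail F u) \<le> (LBINT u:{x<..y}. 1)"
    proof (rule set_integral_mono)
      show "set_integrable lborel {x<..y} (tail F)"
        by (rule int) (use that in auto)
      show "set_integrable lborel {x<..y} (\<lambda>_. 1 :: real)"
        using that by (simp add: set_integrable_def)
    qed (use t in auto)
    also have "\<dots> = y - x"
      using that by (simp add: set_lebesgue_integral_def)
    finally show ?thesis .
  qed
  have I0: "0 \<le> I x" for x
    unfolding I_def set_lebesgue_integral_def by (intro Bochner_Integration.integral_nonneg) (simp add: t)
  have anti: "I y \<le> I x" if "0 \<le> x" "x \<le> y" for x y
    using split[OF that] lo[of x y] by simp
  have mono: "mono (integrated_tail F)"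
    by (rule monoI) (auto simp: integrated_tail_def I_def[symmetric] intro!: min.mono anti min.coboundedI2)
  have lip: "dist (I y) (I x) \<le> 1 * dist y x" if "x \<in> {0..}" "y \<in> {0..}" for x y
  proof (cases "x \<le> y")
    case True then show ?thesis using split[of x y] lo[of x y] hi[of x y] that
      by (auto simp: dist_real_def)
  next
    case False then show ?thesis using split[of y x] lo[of y x] hi[of y x] that
      by (auto simp: dist_real_def)
  qed
  have contI: "continuous_on {0..} I"
    by (rule lipschitz_on_continuous_on[of 1]) (use lip in \<open>auto simp: lipschitz_on_def dist_commute\<close>)
  have cont: "continuous (at_right x) (integrated_tail F)" for x
  proof (cases "x < 0")
    case True
    have "eventually (\<lambda>y. y \<in> {x<..<0}) (at_right x)"
      by (rule eventually_at_rightI[OF _ True])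
    then have "eventually (\<lambda>y. integrated_tail F y = 0) (at_right x)"
      by eventually_elim (auto simp: integrated_tail_def)
    then show ?thesis
      using True by (auto simp: continuous_within integrated_tail_def intro: tendsto_eventually)
  next
    case False
    have "(I \<longlongrightarrow> I x) (at x within {0..})"
      using contI False by (auto simp: continuous_on_def)
    then have "(I \<longlongrightarrow> I x) (at_right x)"
      by (rule tendsto_within_subset) (use False in auto)
    then have "((\<lambda>y. 1 - min 1 (I y)) \<longlongrightarrow> 1 - min 1 (I x)) (at_right x)"
      by (intro tendsto_intros)
    moreover have "eventually (\<lambda>y. integrated_tail F y = 1 - min 1 (I y)) (at_right x)"
      using False by (auto simp: eventually_at_filter integrated_tail_def I_def)
    ultimately show ?thesis using False
      by (simp add: continuous_within integrated_tail_def I_def[symmetric] tendsto_cong)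
  qed
  have "((\<lambda>y. \<integral>u. indicator {..y} u *\<^sub>R (indicator {0<..} u *\<^sub>R tail F u) \<partial>lborel) \<longlongrightarrow> I 0) at_top"
    unfolding I_def set_lebesgue_integral_def
    by (rule tendsto_integral_at_top)
       (use set_integrable_tail[OF assms] in \<open>auto simp: set_integrable_def\<close>)
  moreover have Iy: "(\<integral>u. indicator {..y} u *\<^sub>R (indicator {0<..} u *\<^sub>R tail F u) \<partial>lborel)
      = (LBINT u:{0<..y}. tail F u)" for y
    unfolding set_lebesgue_integral_def
    by (intro Bochner_Integration.integral_cong) (auto simp: indicator_def)
  ultimately have "((\<lambda>y. I 0 - (LBINT u:{0<..y}. tail F u)) \<longlongrightarrow> I 0 - I 0) at_top"
    by (intro tendsto_diff tendsto_const) simp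
  moreover have "eventually (\<lambda>y. I 0 - (LBINT u:{0<..y}. tail F u) = I y) at_top"
    using eventually_ge_at_top[of 0] by eventually_elim (use split in auto)
  ultimately have "(I \<longlongrightarrow> 0) at_top"
    by (simp add: tendsto_cong)
  then have "((\<lambda>y. 1 - min 1 (I y)) \<longlongrightarrow> 1 - min 1 0) at_top"
    by (intro tendsto_intros)
  moreover have "eventually (\<lambda>y. 1 - min 1 (I y) = integrated_tail F y) at_top"
    using eventually_ge_at_top[of 0] by eventually_elim (auto simp: integrated_tail_def I_def)
  ultimately have "(integrated_tail F \<longlongrightarrow> 1) at_top"
    by (simp add: tendsto_cong)
  then show ?thesis
    using mono cont by (auto simp: nonneg_dist_fun_def integrated_tail_def)
qed

definition (in prob_space) iid :: "(int \<Rightarrow> 'a \<Rightarrow> real) \<Rightarrow> bool" where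
  "iid X \<longleftrightarrow>
     indep_vars (\<lambda>_. borel) X UNIV \<and> (\<forall>n. distr M borel (X n) = distr M borel (X 0))"

definition (in prob_space) iid_nonneg_mean :: "(int \<Rightarrow> 'a \<Rightarrow> real) \<Rightarrow> real \<Rightarrow> bool" where
  "iid_nonneg_mean X m \<longleftrightarrow>
     iid X \<and> (\<forall>n. AE \<omega> in M. 0 \<le> X n \<omega>) \<and>
     (\<forall>n. integrable M (X n) \<and> expectation (X n) = m)"

definition interarrival :: "(int \<Rightarrow> 'a \<Rightarrow> real) \<Rightarrow> int \<Rightarrow> 'a \<Rightarrow> real" where
  "interarrival T n \<omega> = T (n + 1) \<omega> - T n \<omega>"

locale tandem_queue = prob_space M for M :: "'a measure" +
  fixes T \<sigma>1 \<sigma>2 :: "int \<Rightarrow> 'a \<Rightarrow> real" and a b1 b2 :: real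
  assumes interarrival_iid: "iid_nonneg_mean (interarrival T) a"
    and service1_iid: "iid_nonneg_mean \<sigma>1 b1"
    and service2_iid: "iid_nonneg_mean \<sigma>2 b2"
    and sequences_indep:
      "indep_vars (\<lambda>_. Pi\<^sub>M UNIV (\<lambda>_. borel)) (\<lambda>j \<omega> n. ([interarrival T, \<sigma>1, \<sigma>2] ! j) n \<omega>) {..<3}"

text \<open>
  The suprema are taken in the extended reals, where they always exist; that they are almost surely
  finite in the stable regime is not built into the definitions.
\<close>

definition stationary_wait :: "(int \<Rightarrow> ereal) \<Rightarrow> (int \<Rightarrow> ereal) \<Rightarrow> int \<Rightarrow> ereal" where
  "stationary_wait s t n = (SUP k::nat. \<Sum>i=1..k. s (n - int i) - t (n - int i))"

definition wait1 ::
    "(int \<Rightarrow> 'a \<Rightarrow> real) \<Rightarrow> (int \<Rightarrow> 'a \<Rightarrow> real) \<Rightarrow> int \<Rightarrow> 'a \<Rightarrow> ereal" where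
  "wait1 T \<sigma>1 n \<omega> = stationary_wait (\<lambda>i. \<sigma>1 i \<omega>) (\<lambda>i. interarrival T i \<omega>) n"

text \<open>The minimum is real even where \<^term>\<open>wait1 T \<sigma>1 n \<omega>\<close> is infinite, so \<open>interarrival2\<close> is finite.\<close>

definition interarrival2 ::
    "(int \<Rightarrow> 'a \<Rightarrow> real) \<Rightarrow> (int \<Rightarrow> 'a \<Rightarrow> real) \<Rightarrow> int \<Rightarrow> 'a \<Rightarrow> ereal" where
  "interarrival2 T \<sigma>1 n \<omega> =
     - min 0 (wait1 T \<sigma>1 n \<omega> + \<sigma>1 n \<omega> - interarrival T n \<omega>) + \<sigma>1 (n + 1) \<omega>"

definition wait2 ::
    "(int \<Rightarrow> 'a \<Rightarrow> real) \<Rightarrow> (int \<Rightarrow> 'a \<Rightarrow> real) \<Rightarrow> (int \<Rightarrow> 'a \<Rightarrow> real) \<Rightarrow> int \<Rightarrow> 'a \<Rightarrow> ereal" where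
  "wait2 T \<sigma>1 \<sigma>2 n \<omega> = stationary_wait (\<lambda>i. \<sigma>2 i \<omega>) (\<lambda>i. interarrival2 T \<sigma>1 i \<omega>) n"

end

theory Submission
  imports Defs
begin

text \<open>
  Write \<open>\<xi> l\<close>, \<open>t l\<close> for the service and interarrival times at the second station, counted backwards
  from customer \<open>0\<close>, so that \<open>W\<close> is the supremum of the sums of \<open>\<xi> - t\<close>. Since the server of the
  first station spends at least the service time \<open>s\<close> between two departures, \<open>t \<ge> s\<close>, and \<open>W\<close> is
  dominated by the maximum of the random walk with independent steps \<open>\<xi> - s\<close>. Cutting that walk at the
  first crossing of a slightly decreasing line (as in Zachary's proof of Veraverbeke's theorem) shows
  that it exceeds \<open>x\<close> with a probability of the order of the integrated tail, and, up to a negligible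
  probability, only through one service time \<open>\<xi> l > x - h + \<kappa> l\<close>. Given such a jump, everything else is
  independent of it and typical: the sums of \<open>t\<close> telescope to sums of interarrival times at the first
  station plus a difference of two stationary sojourn times, so \<open>t\<close> has rate \<open>a\<close>, and \<open>W > x\<close>
  requires essentially \<open>\<xi> l > x + (a - b2) l\<close>. Summing over \<open>l\<close> gives the constant \<open>d2 / (a - b2)\<close>,
  and the lower bound follows from the same events made disjoint.
\<close>

section \<open>Integrated tails\<close>

text \<open>The interarrival times \<open>t\<close> at the second station depend on the whole past
  of the first, so \<open>W\<close> is not the maximum of a random walk with independent steps. The
  dominating walk with steps \<open>\<xi> - s\<close> has drift \<open>b2 - b1\<close> and hence
  yields only the right order of the tail; it serves to discard whatever happens without a jump. The
  sharp constant comes from conditioning on a jump, which works because \<open>\<xi> l\<close> is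
  independent of all the rest, \<open>t\<close> included.

  Subexponentiality is available for \<open>F^s\<close> only. Tails of service times therefore enter
  through sums over \<open>l\<close> of the probabilities of
  \<open>\<xi> l > x + \<kappa> l\<close>, which are asymptotic to \<open>d2 / \<kappa>\<close>
  times the tail of \<open>F^s\<close>. Likewise, to rule out two big increments, the height at the
  first crossing and the later maximum are both replaced by auxiliary variables of law
  \<open>F^s\<close>, whose convolution is under control. This replacement needs a first bound on
  the maximum, obtained by a bootstrap on the ratio of its tail to that of
  \<open>F^s\<close>.\<close>

locale subexponential_law = real_distribution \<nu> for \<nu> :: "real measure" +
  assumes nonneg: "measure \<nu> {0..} = 1"
    and tail_pos: "\<And>x. 0 < measure \<nu> {x<..}"
    and conv_tail: "((\<lambda>x. measure (\<nu> \<Otimes>\<^sub>M \<nu>) {p. x < fst p + snd p} / measure \<nu> {x<..}) \<longlongrightarrow> 2) at_top"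
begin

abbreviation G :: "real \<Rightarrow> real" where "G x \<equiv> measure \<nu> {x<..}"

sublocale PP: pair_prob_space \<nu> \<nu> ..

lemma G_antimono: "x \<le> y \<Longrightarrow> G y \<le> G x"
  by (intro finite_measure_mono) auto

lemma G_tendsto_0: "(G \<longlongrightarrow> 0) at_top"
proof -
  have "G x = 1 - cdf \<nu> x" for x
    unfolding cdf_def using prob_compl[of "{..x}"] by (simp add: Compl_eq_Diff_UNIV[symmetric])
  moreover have "((\<lambda>x. 1 - cdf \<nu> x) \<longlongrightarrow> 1 - 1) at_top"
    by (intro tendsto_intros cdf_lim_at_top_prob)
  ultimately show ?thesis by simp
qed

lemma measure_0L: "0 \<le> L \<Longrightarrow> measure \<nu> {0..L} = 1 - G L"
proof -
  assume "0 \<le> L"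
  have "measure \<nu> {0..} = measure \<nu> ({0..L} \<union> {L<..})"
    using \<open>0 \<le> L\<close> by (intro arg_cong[where f = "measure \<nu>"]) auto
  also have "\<dots> = measure \<nu> {0..L} + G L"
    by (intro finite_measure_Union) auto
  finally show ?thesis using nonneg by simp
qed

lemma measure_prod: "A \<in> sets borel \<Longrightarrow> B \<in> sets borel \<Longrightarrow>
    measure (\<nu> \<Otimes>\<^sub>M \<nu>) (A \<times> B) = measure \<nu> A * measure \<nu> B"
  by (simp add: measure_def emeasure_pair_measure_Times enn2real_mult)

lemma sum_gt_sets: "{p :: real \<times> real. x < fst p + snd p} \<in> sets (borel \<Otimes>\<^sub>M borel)"
  unfolding borel_prod by (intro borel_open open_Collect_less continuous_intros)

lemma sets_PP [simp]: "sets (\<nu> \<Otimes>\<^sub>M \<nu>) = sets (borel \<Otimes>\<^sub>M borel)"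
  by (intro sets_pair_measure_cong) auto

text \<open>Three disjoint rectangles lie in the half-plane: first coordinate above
  \<open>x\<close>; first in \<open>[0, h]\<close> and second above \<open>x\<close>; first in
  \<open>(h, x]\<close> and second above \<open>x - h\<close>. The last one brings in the shifted
  tail.\<close>

lemma conv_lower:
  assumes "0 \<le> h" "h \<le> x"
  shows "G x + (1 - G h) * G x + (G h - G x) * G (x - h) \<le> measure (\<nu> \<Otimes>\<^sub>M \<nu>) {p. x < fst p + snd p}"
proof -
  have hx: "measure \<nu> {h<..x} = G h - G x"
  proof -
    have "G h = measure \<nu> ({h<..x} \<union> {x<..})"
      using assms by (intro arg_cong[where f = "measure \<nu>"]) auto
    also have "\<dots> = measure \<nu> {h<..x} + G x"
      by (intro finite_measure_Union) auto
    finally show ?thesis by simp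
  qed
  have "G x + (1 - G h) * G x + (G h - G x) * G (x - h)
      = measure (\<nu> \<Otimes>\<^sub>M \<nu>) ({x<..} \<times> {0..}) + measure (\<nu> \<Otimes>\<^sub>M \<nu>) ({0..h} \<times> {x<..})
        + measure (\<nu> \<Otimes>\<^sub>M \<nu>) ({h<..x} \<times> {x - h<..})"
    using assms by (simp add: measure_prod nonneg measure_0L hx)
  also have "\<dots> = measure (\<nu> \<Otimes>\<^sub>M \<nu>) ({x<..} \<times> {0..} \<union> {0..h} \<times> {x<..})
        + measure (\<nu> \<Otimes>\<^sub>M \<nu>) ({h<..x} \<times> {x - h<..})"
    using assms by (subst PP.P.finite_measure_Union) auto
  also have "\<dots> = measure (\<nu> \<Otimes>\<^sub>M \<nu>) ({x<..} \<times> {0..} \<union> {0..h} \<times> {x<..} \<union> {h<..x} \<times> {x - h<..})"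
    using assms by (subst PP.P.finite_measure_Union) auto
  also have "\<dots> \<le> measure (\<nu> \<Otimes>\<^sub>M \<nu>) {p. x < fst p + snd p}"
    using assms by (intro PP.P.finite_measure_mono) (auto simp: sum_gt_sets)
  finally show ?thesis .
qed

text \<open>Divided by \<open>G x\<close>, the left side of \<open>conv_lower\<close> reads
  \<open>2 - G h + (G h - G x) * (G (x - h) / G x)\<close>, and its majorant tends to
  \<open>2\<close>. As the coefficient tends to \<open>G h > 0\<close>, the ratio cannot stay above
  \<open>1\<close>.\<close>

lemma long_tailed_aux:
  assumes "0 \<le> h"
  shows "((\<lambda>x. G (x - h) / G x) \<longlongrightarrow> 1) at_top"
proof (rule tendsto_sandwich)
  let ?r = "\<lambda>x. measure (\<nu> \<Otimes>\<^sub>M \<nu>) {p. x < fst p + snd p} / G x"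
  show "eventually (\<lambda>x. 1 \<le> G (x - h) / G x) at_top"
    using assms tail_pos by (auto simp: field_simps intro!: always_eventually G_antimono)
  have "eventually (\<lambda>x. G x < G h) at_top"
    using order_tendstoD(2)[OF G_tendsto_0 tail_pos] .
  then show "eventually (\<lambda>x. G (x - h) / G x \<le> (?r x - 2 + G h) / (G h - G x)) at_top"
    using eventually_ge_at_top[of h]
  proof eventually_elim
    case (elim x)
    define c where "c = measure (\<nu> \<Otimes>\<^sub>M \<nu>) {p. x < fst p + snd p}"
    have "(G x + (1 - G h) * G x + (G h - G x) * G (x - h)) / G x \<le> c / G x"
      using conv_lower[OF assms elim(2)] tail_pos[of x] by (intro divide_right_mono) (auto simp: c_def)
    moreover have "(G x + (1 - G h) * G x + (G h - G x) * G (x - h)) / G x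
        = 2 - G h + (G (x - h) / G x) * (G h - G x)"
      using tail_pos[of x] by (simp add: add_divide_distrib)
    ultimately have "(G (x - h) / G x) * (G h - G x) \<le> ?r x - 2 + G h"
      by (simp add: c_def)
    then show ?case using elim by (simp add: pos_le_divide_eq)
  qed
  have "((\<lambda>x. (?r x - 2 + G h) / (G h - G x)) \<longlongrightarrow> (2 - 2 + G h) / (G h - 0)) at_top"
    using tail_pos[of h] by (intro tendsto_intros conv_tail G_tendsto_0) auto
  then show "((\<lambda>x. (?r x - 2 + G h) / (G h - G x)) \<longlongrightarrow> 1) at_top"
    using tail_pos[of h] by simp
qed simp

lemma long_tailed: "((\<lambda>x. G (x + h) / G x) \<longlongrightarrow> 1) at_top"
proof (cases "h \<le> 0")
  case True
  then show ?thesis using long_tailed_aux[of "-h"] by simp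
next
  case False
  have "((\<lambda>x. G ((x + h) - h) / G (x + h)) \<longlongrightarrow> 1) at_top"
    by (rule filterlim_compose[OF long_tailed_aux[of h], of "\<lambda>x. x + h" at_top])
       (use False in \<open>auto simp: add.commute[of _ h] intro!: filterlim_tendsto_add_at_top[OF tendsto_const] filterlim_ident\<close>)
  then have "((\<lambda>x. inverse (G x / G (x + h))) \<longlongrightarrow> inverse 1) at_top"
    by (intro tendsto_inverse) auto
  then show ?thesis by simp
qed

text \<open>The part of the convolution tail that is not due to a single large summand.\<close>

definition two_big :: "real \<Rightarrow> real \<Rightarrow> real" where
  "two_big L x = measure (\<nu> \<Otimes>\<^sub>M \<nu>) {p. L < fst p \<and> L < snd p \<and> x < fst p + snd p}"

text \<open>The strips with one coordinate in \<open>[0, L]\<close> and the other above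
  \<open>x\<close> avoid the region of \<open>two_big\<close>; by \<open>L \<le> x\<close> they also
  avoid each other.\<close>

lemma two_big_le:
  assumes "0 \<le> L" "L \<le> x"
  shows "two_big L x \<le> measure (\<nu> \<Otimes>\<^sub>M \<nu>) {p. x < fst p + snd p} - 2 * (1 - G L) * G x"
proof -
  let ?T = "{p :: real \<times> real. L < fst p \<and> L < snd p \<and> x < fst p + snd p}"
  have [measurable]: "?T \<in> sets (borel \<Otimes>\<^sub>M borel)"
    unfolding borel_prod by (intro borel_open open_Collect_conj open_Collect_less continuous_intros)
  have "two_big L x + 2 * (1 - G L) * G x = two_big L x +
     measure (\<nu> \<Otimes>\<^sub>M \<nu>) ({0..L} \<times> {x<..}) + measure (\<nu> \<Otimes>\<^sub>M \<nu>) ({x<..} \<times> {0..L})"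
    using assms by (simp add: measure_prod measure_0L)
  also have "\<dots> = measure (\<nu> \<Otimes>\<^sub>M \<nu>) (?T \<union> {0..L} \<times> {x<..}) + measure (\<nu> \<Otimes>\<^sub>M \<nu>) ({x<..} \<times> {0..L})"
    unfolding two_big_def using assms by (subst PP.P.finite_measure_Union) auto
  also have "\<dots> = measure (\<nu> \<Otimes>\<^sub>M \<nu>) (?T \<union> {0..L} \<times> {x<..} \<union> {x<..} \<times> {0..L})"
    using assms by (subst PP.P.finite_measure_Union) auto
  also have "\<dots> \<le> measure (\<nu> \<Otimes>\<^sub>M \<nu>) {p. x < fst p + snd p}"
    using assms by (intro PP.P.finite_measure_mono) (auto simp: sum_gt_sets)
  finally show ?thesis by simp
qed

text \<open>The strips carry \<open>2 * (1 - G L) * G x\<close> out of a total asymptotic to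
  \<open>2 * G x\<close>. About \<open>2 * G L * G x\<close> is left, and \<open>L\<close> is fixed
  before \<open>x\<close> with \<open>G L < \<eta> / 2\<close>.\<close>

lemma two_big_small:
  assumes "\<eta> > 0"
  shows "eventually (\<lambda>L. eventually (\<lambda>x. two_big L x \<le> \<eta> * G x) at_top) at_top"
proof -
  have "eventually (\<lambda>L. G L < \<eta> / 2) at_top"
    using order_tendstoD(2)[OF G_tendsto_0, of "\<eta> / 2"] assms by simp
  then show ?thesis using eventually_ge_at_top[of 0]
  proof eventually_elim
    case (elim L)
    have "eventually (\<lambda>x. measure (\<nu> \<Otimes>\<^sub>M \<nu>) {p. x < fst p + snd p} / G x < 2 + (\<eta> - 2 * G L)) at_top"
      using order_tendstoD(2)[OF conv_tail] elim by simp
    then show ?case using eventually_ge_at_top[of L]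
    proof eventually_elim
      case x: (elim x)
      have "measure (\<nu> \<Otimes>\<^sub>M \<nu>) {p. x < fst p + snd p} \<le> (2 + (\<eta> - 2 * G L)) * G x"
        using x tail_pos[of x] by (simp add: pos_divide_less_eq)
      then show ?case using two_big_le[of L x] x elim by (simp add: algebra_simps)
    qed
  qed
qed

end

section \<open>From distribution functions to laws, and sums of tails along arithmetic
  progressions\<close>

lemma subexponential_imp_law:
  assumes "subexponential H"
  shows "subexponential_law (interval_measure H)"
    and "measure (interval_measure H) {x<..} = tail H x"
proof -
  have nd: "nonneg_dist_fun H" and pos: "\<And>x. tail H x > 0"
    and eq: "tail (conv_power2 H) \<sim>[at_top] (\<lambda>x. 2 * tail H x)"
    using assms by (auto simp: subexponential_def)
  let ?N = "interval_measure H"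
  interpret N: real_distribution ?N by (rule nonneg_dist_fun_real_distribution[OF nd])
  interpret PP: pair_prob_space ?N ?N ..
  have cdfN: "cdf ?N = H" by (rule nonneg_dist_fun_real_distribution[OF nd])
  have tl: "measure ?N {x<..} = tail H x" for x
    using N.prob_compl[of "{..x}"] fun_cong[OF cdfN, of x]
    by (simp add: Compl_eq_Diff_UNIV[symmetric] tail_def cdf_def)
  then show "measure (interval_measure H) {x<..} = tail H x" .
  have sPP: "sets (?N \<Otimes>\<^sub>M ?N) = sets (borel \<Otimes>\<^sub>M borel)"
    by (intro sets_pair_measure_cong) auto
  show "subexponential_law ?N"
  proof
    have "measure ?N {..<0} = 0"
    proof -
      have "(\<lambda>n. measure ?N {..- 1 / real (Suc n)}) \<longlonglongrightarrow> measure ?N (\<Union>n. {..- 1 / real (Suc n)})"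
        by (intro N.finite_Lim_measure_incseq) (auto simp: incseq_def field_simps intro: order.trans)
      moreover have "measure ?N {..- 1 / real (Suc n)} = 0" for n
        using nd fun_cong[OF cdfN, of "- 1 / real (Suc n)"]
        by (simp add: cdf_def nonneg_dist_fun_def divide_neg_pos)
      moreover have "(\<Union>n. {..- 1 / real (Suc n)}) = {..<0}"
      proof (intro equalityI subsetI)
        fix x :: real assume "x \<in> {..<0}"
        then obtain n where "inverse (real (Suc n)) < - x" using reals_Archimedean[of "-x"] by auto
        then have "x \<le> - 1 / real (Suc n)" by (simp add: inverse_eq_divide)
        then show "x \<in> (\<Union>n. {..- 1 / real (Suc n)})" by blast
      next
        fix x :: real assume "x \<in> (\<Union>n. {..- 1 / real (Suc n)})"
        then obtain n where "x \<le> - 1 / real (Suc n)" by blast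
        also have "\<dots> < 0" by (simp add: divide_neg_pos)
        finally show "x \<in> {..<0}" by simp
      qed
      ultimately show ?thesis by (simp add: LIMSEQ_const_iff)
    qed
    then show "measure ?N {0..} = 1"
      using N.prob_compl[of "{..<0}"] by (simp add: Compl_eq_Diff_UNIV[symmetric])
    show "0 < measure ?N {x<..}" for x using pos tl by simp
    have conv: "tail (conv_power2 H) x = measure (?N \<Otimes>\<^sub>M ?N) {p. x < fst p + snd p}" for x
    proof -
      have "conv_power2 H x = measure (?N \<Otimes>\<^sub>M ?N) {p. fst p + snd p \<le> x}"
        unfolding conv_power2_def cdf_def convolution_def
        by (subst measure_distr)
           (auto simp: case_prod_beta space_pair_measure vimage_def measurable_cong_sets[OF sPP refl])
      moreover have "measure (?N \<Otimes>\<^sub>M ?N) {p. x < fst p + snd p} = 1 - measure (?N \<Otimes>\<^sub>M ?N) {p. fst p + snd p \<le> x}"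
      proof -
        have "{p :: real \<times> real. fst p + snd p \<le> x} \<in> sets (borel \<Otimes>\<^sub>M borel)"
          unfolding borel_prod by (intro borel_closed closed_Collect_le continuous_intros)
        then show ?thesis
          using PP.P.prob_compl[of "{p. fst p + snd p \<le> x}"]
          by (simp add: sPP space_pair_measure Compl_eq_Diff_UNIV[symmetric] Collect_neg_eq[symmetric] not_le)
      qed
      ultimately show ?thesis by (simp add: tail_def)
    qed
    have "((\<lambda>x. 2 * (tail (conv_power2 H) x / (2 * tail H x))) \<longlongrightarrow> 2 * 1) at_top"
      by (intro tendsto_intros asymp_equivD_strong[OF eq])
         (use pos in \<open>auto intro!: always_eventually simp: less_imp_neq[symmetric]\<close>)
    then show "((\<lambda>x. measure (?N \<Otimes>\<^sub>M ?N) {p. x < fst p + snd p} / measure ?N {x<..}) \<longlongrightarrow> 2) at_top"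
      by (simp add: conv tl)
  qed
qed


text \<open>On each block of length \<open>\<kappa>\<close> a decreasing function lies between its
  end values, and the integrals over blocks telescope. The upper bound compares each term with the
  block to its left, whence the integral from \<open>x - \<kappa>\<close> and the condition
  \<open>\<kappa> \<le> x\<close>, which keeps the blocks where \<open>f\<close> is
  integrable.\<close>

lemma antimono_sum_bounds:
  fixes f :: "real \<Rightarrow> real"
  assumes anti: "antimono f" and f0: "\<And>x. 0 \<le> f x"
    and int: "set_integrable lborel {0<..} f"
    and lim: "((\<lambda>x. LBINT u:{x<..}. f u) \<longlongrightarrow> 0) at_top"
    and k: "0 < \<kappa>" and x: "\<kappa> \<le> x"
  shows "summable (\<lambda>l. f (x + \<kappa> * real l))"
    and "\<kappa> * (\<Sum>l. f (x + \<kappa> * real l)) \<le> (LBINT u:{x - \<kappa><..}. f u)"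
    and "(LBINT u:{x<..}. f u) \<le> \<kappa> * (\<Sum>l. f (x + \<kappa> * real l))"
proof -
  define I where "I x = (LBINT u:{x<..}. f u)" for x
  have int': "set_integrable lborel A f" if "A \<in> sets borel" "A \<subseteq> {0<..}" for A
    by (rule set_integrable_subset[OF int]) (use that in auto)
  have const: "set_integrable lborel {y<..y + \<kappa>} (\<lambda>_. c :: real)" for y c
    using k by (simp add: set_integrable_def)
  have cint: "(LBINT u:{y<..y + \<kappa>}. c) = c * \<kappa>" for y c :: real
    using k by (simp add: set_lebesgue_integral_def)
  have step: "f (y + \<kappa>) * \<kappa> \<le> I y - I (y + \<kappa>)" "I y - I (y + \<kappa>) \<le> f y * \<kappa>" if "0 \<le> y" for y
  proof -
    have "I y = (LBINT u:({y<..y + \<kappa>} \<union> {y + \<kappa><..}). f u)"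
      using k by (simp add: I_def ivl_disj_un)
    also have "\<dots> = (LBINT u:{y<..y + \<kappa>}. f u) + I (y + \<kappa>)"
      unfolding I_def by (intro set_integral_Un int') (use that k in auto)
    finally have e: "I y - I (y + \<kappa>) = (LBINT u:{y<..y + \<kappa>}. f u)" by simp
    have i: "set_integrable lborel {y<..y + \<kappa>} f"
      by (rule int') (use that in auto)
    have "(LBINT u:{y<..y + \<kappa>}. f (y + \<kappa>)) \<le> (LBINT u:{y<..y + \<kappa>}. f u)"
      by (rule set_integral_mono[OF const i]) (auto intro: antimonoD[OF anti])
    then show "f (y + \<kappa>) * \<kappa> \<le> I y - I (y + \<kappa>)" by (simp add: cint e)
    have "(LBINT u:{y<..y + \<kappa>}. f u) \<le> (LBINT u:{y<..y + \<kappa>}. f y)"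
      by (rule set_integral_mono[OF i const]) (auto intro: antimonoD[OF anti])
    then show "I y - I (y + \<kappa>) \<le> f y * \<kappa>" by (simp add: cint e)
  qed
  have I0: "0 \<le> I y" for y
    unfolding I_def set_lebesgue_integral_def by (intro Bochner_Integration.integral_nonneg) (simp add: f0)
  have up: "(\<Sum>l<n. \<kappa> * f (x + \<kappa> * real l)) \<le> I (x - \<kappa>) - I (x - \<kappa> + \<kappa> * real n)" for n
  proof (induction n)
    case (Suc n)
    have "0 \<le> x - \<kappa> + \<kappa> * real n" using x k by simp
    from step(1)[OF this] Suc show ?case by (simp add: algebra_simps)
  qed simp
  have lo: "I x - I (x + \<kappa> * real n) \<le> (\<Sum>l<n. \<kappa> * f (x + \<kappa> * real l))" for n
  proof (induction n)
    case (Suc n)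
    have "0 \<le> x + \<kappa> * real n" using x k by simp
    from step(2)[OF this] Suc show ?case by (simp add: algebra_simps)
  qed simp
  have up': "(\<Sum>l<n. \<kappa> * f (x + \<kappa> * real l)) \<le> I (x - \<kappa>)" for n
    using up[of n] I0[of "x - \<kappa> + \<kappa> * real n"] by linarith
  have summ: "summable (\<lambda>l. \<kappa> * f (x + \<kappa> * real l))"
    by (rule summableI_nonneg_bounded[OF _ up']) (use f0 k in simp)
  then show s: "summable (\<lambda>l. f (x + \<kappa> * real l))" using k by simp
  have "(\<Sum>l. \<kappa> * f (x + \<kappa> * real l)) \<le> I (x - \<kappa>)"
    by (rule suminf_le_const[OF summ up'])
  then show "\<kappa> * (\<Sum>l. f (x + \<kappa> * real l)) \<le> (LBINT u:{x - \<kappa><..}. f u)"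
    using s by (simp add: suminf_mult I_def)
  have "filterlim (\<lambda>n. x + \<kappa> * real n) at_top sequentially"
    using k by (intro filterlim_tendsto_add_at_top[OF tendsto_const]
        filterlim_tendsto_pos_mult_at_top[OF tendsto_const] filterlim_real_sequentially) auto
  then have "(\<lambda>n. I x - I (x + \<kappa> * real n)) \<longlonglongrightarrow> I x - 0"
    using lim unfolding I_def[symmetric] by (intro tendsto_diff tendsto_const) (rule filterlim_compose)
  moreover have "I x - I (x + \<kappa> * real n) \<le> (\<Sum>l. \<kappa> * f (x + \<kappa> * real l))" for n
    using lo[of n] sum_le_suminf[OF summ, of "{..<n}"] f0 k by (simp add: order_trans)
  ultimately have "I x - 0 \<le> (\<Sum>l. \<kappa> * f (x + \<kappa> * real l))"
    by (intro tendsto_upperbound) auto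
  then show "(LBINT u:{x<..}. f u) \<le> \<kappa> * (\<Sum>l. f (x + \<kappa> * real l))"
    using s by (simp add: suminf_mult I_def)
qed

text \<open>Here \<open>F\<close> gives way to \<open>F^s\<close>: the sum of its tails is
  \<open>1 / \<kappa>\<close> times the integrated tail up to a shift of the argument by
  \<open>\<kappa>\<close>, and the shift is harmless because \<open>F^s\<close> is
  long-tailed.\<close>

lemma tail_sum_asymp:
  assumes F: "nonneg_dist_fun F" "finite_mean F"
    and sub: "subexponential (integrated_tail F)"
    and B: "B \<sim>[at_top] (\<lambda>x. d * tail F x)" and d: "0 < d" and k: "0 < \<kappa>"
  shows "eventually (\<lambda>x. summable (\<lambda>l. B (x + \<kappa> * real l))) at_top" (is ?S)
    and "((\<lambda>x. (\<Sum>l. B (x + \<kappa> * real l)) / tail (integrated_tail F) x) \<longlongrightarrow> d / \<kappa>) at_top" (is ?L)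
proof -
  define I where "I x = (LBINT u:{x<..}. tail F u)" for x
  let ?G = "tail (integrated_tail F)"
  interpret subexponential_law "interval_measure (integrated_tail F)"
    by (rule subexponential_imp_law[OF sub])
  have Geq: "measure (interval_measure (integrated_tail F)) {x<..} = ?G x" for x
    by (rule subexponential_imp_law[OF sub])
  have GI: "?G x = min 1 (I x)" if "0 \<le> x" for x
    using that by (simp add: tail_def[of "integrated_tail F"] integrated_tail_def I_def)
  \<comment> \<open>Once the tail of \<open>F^s\<close> is below \<open>1\<close>, the truncation in
    its definition is inactive.\<close>
  have "eventually (\<lambda>x. ?G x < 1) at_top"
    using order_tendstoD(2)[OF G_tendsto_0, of 1] by (simp add: Geq)
  then have ev_GI: "eventually (\<lambda>x. ?G x = I x) at_top"
    using eventually_ge_at_top[of 0] by eventually_elim (auto simp: GI min_def split: if_splits)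
  then have I0: "(I \<longlongrightarrow> 0) at_top"
    using G_tendsto_0 by (simp add: Geq tendsto_cong)
  have f0: "0 \<le> tail F x" for x
    using nonneg_dist_fun_bounds[OF F(1), of x] by (simp add: tail_def)
  have anti: "antimono (tail F)"
    using F(1) by (auto simp: nonneg_dist_fun_def tail_def mono_def antimono_def)
  note sb = antimono_sum_bounds[OF anti f0 set_integrable_tail[OF F], folded I_def, OF I0 k]
  let ?f = "\<lambda>x. \<Sum>l. tail F (x + \<kappa> * real l)"
  have Gpos: "0 < ?G x" for x using tail_pos[of x] by (simp add: Geq)
  \<comment> \<open>A zero of the tail of \<open>F\<close> would persist to the right and make
    \<open>I\<close> vanish, against the positivity of the tail of \<open>F^s\<close>.\<close>
  have fpos: "0 < tail F x" for x
  proof (rule ccontr)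
    assume "\<not> 0 < tail F x"
    then have z: "tail F u = 0" if "x \<le> u" for u
      using antimonoD[OF anti that] f0[of x] f0[of u] by simp
    have "I (max x 0) = (LBINT u:{max x 0<..}. 0)"
      unfolding I_def by (intro set_lebesgue_integral_cong) (auto simp: z)
    then have "I (max x 0) = 0" by (simp add: set_lebesgue_integral_def)
    then show False using Gpos[of "max x 0"] GI[of "max x 0"] by simp
  qed
  have fl: "((\<lambda>x. ?f x / ?G x) \<longlongrightarrow> 1 / \<kappa>) at_top"
  proof (rule tendsto_sandwich)
    have ev2: "eventually (\<lambda>x. ?G (x - \<kappa>) = I (x - \<kappa>)) at_top"
      using eventually_compose_filterlim[OF ev_GI
          filterlim_tendsto_add_at_top[OF tendsto_const[of "- \<kappa>"] filterlim_ident]] by simp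
    show "eventually (\<lambda>x. 1 / \<kappa> \<le> ?f x / ?G x) at_top"
      using ev_GI eventually_ge_at_top[of \<kappa>]
    proof eventually_elim
      case (elim x)
      then show ?case using sb(3)[of x] Gpos[of x] k by (simp add: field_simps)
    qed
    show "eventually (\<lambda>x. ?f x / ?G x \<le> (?G (x - \<kappa>) / ?G x) / \<kappa>) at_top"
      using ev2 eventually_ge_at_top[of \<kappa>]
    proof eventually_elim
      case (elim x)
      then show ?case using sb(2)[of x] Gpos[of x] k by (simp add: field_simps)
    qed
    show "((\<lambda>x. (?G (x - \<kappa>) / ?G x) / \<kappa>) \<longlongrightarrow> 1 / \<kappa>) at_top"
      using long_tailed[of "- \<kappa>"] k by (intro tendsto_intros) (auto simp: Geq)
  qed simp
  have ratio: "((\<lambda>x. B x / tail F x) \<longlongrightarrow> d) at_top"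
  proof -
    have "((\<lambda>x. d * (B x / (d * tail F x))) \<longlongrightarrow> d * 1) at_top"
      by (intro tendsto_intros asymp_equivD_strong[OF B])
         (use fpos d in \<open>auto intro!: always_eventually simp: less_imp_neq[symmetric]\<close>)
    then show ?thesis using d by simp
  qed
  have bnd: "eventually (\<lambda>x. \<forall>y\<ge>x. (1 - \<eta>) * d * tail F y \<le> B y \<and> B y \<le> (1 + \<eta>) * d * tail F y) at_top"
    if "0 < \<eta>" for \<eta>
  proof -
    have "eventually (\<lambda>y. (1 - \<eta>) * d < B y / tail F y) at_top"
      using order_tendstoD(1)[OF ratio, of "(1 - \<eta>) * d"] that d by simp
    moreover have "eventually (\<lambda>y. B y / tail F y < (1 + \<eta>) * d) at_top"
      using order_tendstoD(2)[OF ratio, of "(1 + \<eta>) * d"] that d by simp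
    ultimately have "eventually (\<lambda>y. (1 - \<eta>) * d * tail F y \<le> B y \<and> B y \<le> (1 + \<eta>) * d * tail F y) at_top"
      by eventually_elim (use fpos in \<open>auto simp: pos_less_divide_eq pos_divide_less_eq less_imp_le\<close>)
    then show ?thesis by (simp add: eventually_all_ge_at_top)
  qed
  have main: "eventually (\<lambda>x. summable (\<lambda>l. B (x + \<kappa> * real l)) \<and>
      (1 - \<eta>) * d * ?f x \<le> (\<Sum>l. B (x + \<kappa> * real l)) \<and>
      (\<Sum>l. B (x + \<kappa> * real l)) \<le> (1 + \<eta>) * d * ?f x) at_top" if "0 < \<eta>" "\<eta> < 1" for \<eta>
    using bnd[OF that(1)] eventually_ge_at_top[of \<kappa>]
  proof eventually_elim
    case (elim x)
    have b: "(1 - \<eta>) * d * tail F (x + \<kappa> * real l) \<le> B (x + \<kappa> * real l)"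
         "B (x + \<kappa> * real l) \<le> (1 + \<eta>) * d * tail F (x + \<kappa> * real l)" for l
      using elim(1) k by auto
    have sf: "summable (\<lambda>l. tail F (x + \<kappa> * real l))" by (rule sb(1)) (use elim in auto)
    have B0: "0 \<le> B (x + \<kappa> * real l)" for l
      using b(1)[of l] f0[of "x + \<kappa> * real l"] that d by (smt (verit) mult_nonneg_nonneg)
    have sB: "summable (\<lambda>l. B (x + \<kappa> * real l))"
      by (rule summable_comparison_test'[OF summable_mult[OF sf, of "(1 + \<eta>) * d"], of 0])
         (use b(2) B0 in \<open>auto simp: mult.assoc\<close>)
    have "(\<Sum>l. (1 - \<eta>) * d * tail F (x + \<kappa> * real l)) \<le> (\<Sum>l. B (x + \<kappa> * real l))"
      by (rule suminf_le[OF b(1) summable_mult[OF sf] sB])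
    moreover have "(\<Sum>l. B (x + \<kappa> * real l)) \<le> (\<Sum>l. (1 + \<eta>) * d * tail F (x + \<kappa> * real l))"
      by (rule suminf_le[OF b(2) sB summable_mult[OF sf]])
    ultimately show ?case using sB by (simp only: suminf_mult[OF sf] simp_thms)
  qed
  show ?S using main[of "1/2"] by (auto elim: eventually_mono)
  show ?L
  proof (rule tendstoI)
    fix e :: real assume "0 < e"
    \<comment> \<open>Keeps the error \<open>\<eta> * d / \<kappa>\<close> of the constant at most
      \<open>e / 4\<close>, and \<open>\<eta>\<close> below \<open>1\<close> as \<open>main\<close>
      demands.\<close>
    define \<eta> where "\<eta> = min (1/2) (e * \<kappa> / (4 * d))"
    have \<eta>: "0 < \<eta>" "\<eta> < 1" "\<eta> * d / \<kappa> \<le> e / 4"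
    proof -
      show "0 < \<eta>" "\<eta> < 1" using \<open>0 < e\<close> k d by (auto simp: \<eta>_def)
      have "\<eta> \<le> e * \<kappa> / (4 * d)" by (simp add: \<eta>_def)
      then show "\<eta> * d / \<kappa> \<le> e / 4" using k d by (simp add: field_simps)
    qed
    have e1: "(1 + \<eta>) * d * (1 / \<kappa>) = d / \<kappa> + \<eta> * d / \<kappa>"
      and e2: "(1 - \<eta>) * d * (1 / \<kappa>) = d / \<kappa> - \<eta> * d / \<kappa>"
      by (simp_all add: algebra_simps add_divide_distrib diff_divide_distrib)
    have "((\<lambda>x. (1 + \<eta>) * d * (?f x / ?G x)) \<longlongrightarrow> (1 + \<eta>) * d * (1 / \<kappa>)) at_top"
      by (intro tendsto_intros fl)
    then have u: "eventually (\<lambda>x. (1 + \<eta>) * d * (?f x / ?G x) < d / \<kappa> + e / 2) at_top"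
      by (rule order_tendstoD) (use \<eta>(3) \<open>0 < e\<close> in \<open>simp only: e1; linarith\<close>)
    have "((\<lambda>x. (1 - \<eta>) * d * (?f x / ?G x)) \<longlongrightarrow> (1 - \<eta>) * d * (1 / \<kappa>)) at_top"
      by (intro tendsto_intros fl)
    then have l: "eventually (\<lambda>x. d / \<kappa> - e / 2 < (1 - \<eta>) * d * (?f x / ?G x)) at_top"
      by (rule order_tendstoD) (use \<eta>(3) \<open>0 < e\<close> in \<open>simp only: e2; linarith\<close>)
    show "eventually (\<lambda>x. dist ((\<Sum>l. B (x + \<kappa> * real l)) / ?G x) (d / \<kappa>) < e) at_top"
      using main[OF \<eta>(1,2)] u l
    proof eventually_elim
      case (elim x)
      have "(1 - \<eta>) * d * ?f x / ?G x \<le> (\<Sum>l. B (x + \<kappa> * real l)) / ?G x"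
           "(\<Sum>l. B (x + \<kappa> * real l)) / ?G x \<le> (1 + \<eta>) * d * ?f x / ?G x"
        using elim(1) Gpos[of x] by (auto intro!: divide_right_mono)
      then show ?case using elim(2,3) \<open>0 < e\<close> by (simp add: dist_real_def abs_if)
    qed
  qed
qed

section \<open>Random walks with independent identically distributed steps\<close>

lemma (in prob_space) indep_vars_group:
  assumes "indep_vars M' X I" "\<And>j. j \<in> L \<Longrightarrow> K j \<subseteq> I" "disjoint_family_on K L"
    and g: "\<And>j. j \<in> L \<Longrightarrow> g j \<in> measurable (PiM (K j) M') (N j)"
    and Y: "\<And>j \<omega>. j \<in> L \<Longrightarrow> Y j \<omega> = g j (restrict (\<lambda>i. X i \<omega>) (K j))"
  shows "indep_vars N Y L"
proof -
  have "indep_vars N (\<lambda>j \<omega>. g j (restrict (\<lambda>i. X i \<omega>) (K j))) L"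
    by (rule indep_vars_compose2[OF indep_vars_restrict[OF assms(1-3)] g])
  then show ?thesis
    using Y by (subst indep_vars_cong) (auto simp: fun_eq_iff)
qed

lemma (in prob_space) indep_vars_reindex_inj:
  assumes "indep_vars (\<lambda>_. N) X I" "inj_on f L" "f ` L \<subseteq> I"
  shows "indep_vars (\<lambda>_. N) (\<lambda>j. X (f j)) L"
  by (rule indep_vars_group[OF assms(1), where K = "\<lambda>j. {f j}" and g = "\<lambda>j h. h (f j)"])
     (use assms in \<open>auto simp: disjoint_family_on_def inj_on_def\<close>)

text \<open>The largest partial sum of at most \<open>n\<close> terms, the empty sum included.
  Peeling off the first term rather than the last relates a walk to its shift, the comparison on
  which \<open>unbounded_null\<close> rests.\<close>

fun wmax :: "nat \<Rightarrow> (nat \<Rightarrow> real) \<Rightarrow> real" where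
  "wmax 0 f = 0"
| "wmax (Suc n) f = max 0 (f 0 + wmax n (\<lambda>i. f (Suc i)))"

lemma wmax_nonneg: "0 \<le> wmax n f"
  by (cases n) auto

lemma wmax_mono: "wmax n f \<le> wmax (Suc n) f"
proof (induction n arbitrary: f)
  case (Suc n)
  from Suc[of "\<lambda>i. f (Suc i)"] show ?case by (auto simp: max_def)
qed (auto simp: max_def)

lemma sum_le_wmax: "k \<le> n \<Longrightarrow> (\<Sum>i<k. f i) \<le> wmax n f"
proof (induction n arbitrary: k f)
  case (Suc n)
  show ?case
  proof (cases k)
    case (Suc k')
    then have "(\<Sum>i<k. f i) = f 0 + (\<Sum>i<k'. f (Suc i))" by (simp only: sum.lessThan_Suc_shift)
    also have "\<dots> \<le> f 0 + wmax n (\<lambda>i. f (Suc i))"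
      using Suc.IH[of k' "\<lambda>i. f (Suc i)"] Suc.prems Suc by simp
    finally show ?thesis by simp
  qed simp
qed simp

lemma wmax_le: "wmax n f \<le> (\<Sum>i<n. \<bar>f i\<bar>)"
proof (induction n arbitrary: f)
  case (Suc n)
  from Suc[of "\<lambda>i. f (Suc i)"] show ?case
    unfolding sum.lessThan_Suc_shift wmax.simps
    using sum_nonneg[of "{..<n}" "\<lambda>i. \<bar>f (Suc i)\<bar>"] by simp
qed simp

lemma measurable_wmax [measurable]:
  "(\<And>i. (\<lambda>\<omega>. f \<omega> i) \<in> borel_measurable N) \<Longrightarrow> (\<lambda>\<omega>. wmax n (f \<omega>)) \<in> borel_measurable N"
  by (induction n arbitrary: f) auto

locale iid_walk = prob_space M for M :: "'a measure" +
  fixes X :: "nat \<Rightarrow> 'a \<Rightarrow> real"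
  assumes indep: "indep_vars (\<lambda>_. borel) X UNIV"
    and ident: "\<And>n. distr M borel (X n) = distr M borel (X 0)"
    and int: "integrable M (X 0)"
begin

lemma X_measurable [measurable]: "X n \<in> borel_measurable M"
  using indep by (auto simp: indep_vars_def)

lemma integrable_X: "integrable M (X n)"
proof -
  have eq: "integrable M (X n) \<longleftrightarrow> integrable (distr M borel (X n)) (\<lambda>x. x)" for n
    by (subst integrable_distr_eq) simp_all
  show ?thesis using int unfolding eq[of n] eq[of 0] ident[of n] .
qed

definition S :: "nat \<Rightarrow> nat \<Rightarrow> 'a \<Rightarrow> real" where
  "S j k \<omega> = (\<Sum>i<k. X (j + i) \<omega>)"

lemma S_measurable [measurable]: "S j k \<in> borel_measurable M"
  unfolding S_def by measurable

lemma S_0 [simp]: "S j 0 \<omega> = 0"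
  by (simp add: S_def)

lemma S_add: "S j (k + l) \<omega> = S j k \<omega> + S (j + k) l \<omega>"
  by (induction l) (simp_all add: S_def add.assoc)

lemma S_Suc: "S j (Suc k) \<omega> = S j k \<omega> + X (j + k) \<omega>"
  by (simp add: S_def)

lemma S_Suc_shift: "S j (Suc k) \<omega> = X j \<omega> + S (Suc j) k \<omega>"
  using S_add[of j 1 k] by (simp add: S_def)

text \<open>Either side is the product of the common one-dimensional law. This makes the later
  estimates uniform in the starting index.\<close>

lemma shift_law:
  "distr M (PiM UNIV (\<lambda>_. borel)) (\<lambda>\<omega> i. X (j + i) \<omega>) = distr M (PiM UNIV (\<lambda>_. borel)) (\<lambda>\<omega> i. X i \<omega>)"
proof -
  have law: "distr M (PiM UNIV (\<lambda>_. borel)) (\<lambda>\<omega> i. X (j + i) \<omega>) = PiM UNIV (\<lambda>_. distr M borel (X 0))" for j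
  proof -
    have "indep_vars (\<lambda>_. borel) (\<lambda>i. X (j + i)) UNIV"
      by (rule indep_vars_reindex_inj[OF indep]) auto
    then show ?thesis
      by (subst (asm) indep_vars_iff_distr_eq_PiM) (simp_all add: ident[of "j + _"] restrict_UNIV)
  qed
  show ?thesis using law[of j] law[of 0] by simp
qed

lemma shift_prob:
  assumes "A \<in> sets (PiM UNIV (\<lambda>_. borel))"
  shows "prob {\<omega>\<in>space M. (\<lambda>i. X (j + i) \<omega>) \<in> A} = prob {\<omega>\<in>space M. (\<lambda>i. X i \<omega>) \<in> A}"
proof -
  have *: "measure (distr M (PiM UNIV (\<lambda>_. borel)) (\<lambda>\<omega> i. X (j + i) \<omega>)) A
      = prob {\<omega>\<in>space M. (\<lambda>i. X (j + i) \<omega>) \<in> A}" for j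
    by (subst measure_distr) (auto intro!: measurable_PiM_single' arg_cong[where f = prob] simp: assms)
  show ?thesis using *[of j] *[of 0] by (simp add: shift_law)
qed

lemma partial_sum_sets:
  "{v. \<exists>k. P k (\<Sum>i<k. v i)} \<in> sets (PiM UNIV (\<lambda>_::nat. borel :: real measure))"
  if "\<And>k. Measurable.pred borel (P k)"
proof -
  have [measurable]: "Measurable.pred borel (P k)" for k by (rule that)
  have "{v \<in> space (PiM UNIV (\<lambda>_::nat. borel :: real measure)). \<exists>k. P k (\<Sum>i<k. v i)}
      \<in> sets (PiM UNIV (\<lambda>_::nat. borel :: real measure))"
    by measurable
  then show ?thesis by (simp add: space_PiM)
qed

lemma exceed_shift:
  "prob {\<omega>\<in>space M. \<exists>k. a k < S j k \<omega>} = prob {\<omega>\<in>space M. \<exists>k. a k < S 0 k \<omega>}"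
proof -
  have "{v. \<exists>k. a k < (\<Sum>i<k. v i)} \<in> sets (PiM UNIV (\<lambda>_. borel))"
    by (rule partial_sum_sets) measurable
  from shift_prob[OF this, where j = j] show ?thesis
    unfolding S_def mem_Collect_eq add_0 .
qed

lemma below_shift:
  "prob {\<omega>\<in>space M. \<exists>k. S j k \<omega> < a k} = prob {\<omega>\<in>space M. \<exists>k. S 0 k \<omega> < a k}"
proof -
  have "{v. \<exists>k. (\<Sum>i<k. v i) < a k} \<in> sets (PiM UNIV (\<lambda>_. borel))"
    by (rule partial_sum_sets) measurable
  from shift_prob[OF this, where j = j] show ?thesis
    unfolding S_def mem_Collect_eq add_0 .
qed

lemma X_tail: "prob {\<omega>\<in>space M. y < X n \<omega>} = prob {\<omega>\<in>space M. y < X 0 \<omega>}"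
proof -
  have "measure (distr M borel (X n)) {y<..} = prob {\<omega>\<in>space M. y < X n \<omega>}" for n
    by (subst measure_distr) (auto intro!: arg_cong[where f = prob])
  from this[of n] this[of 0] show ?thesis by (simp only: ident[of n])
qed

text \<open>The function of the first block is stored as a constant sequence because
  \<open>indep_var\<close> asks both variables to have the same value type.\<close>

lemma indep_block:
  assumes u: "u \<in> borel_measurable (PiM {..<n} (\<lambda>_. borel))"
  shows "indep_var (PiM UNIV (\<lambda>_. borel)) (\<lambda>\<omega> _::nat. u (\<lambda>i\<in>{..<n}. X i \<omega>)) (PiM UNIV (\<lambda>_. borel)) (\<lambda>\<omega> i. X (n + i) \<omega>)"
proof -
  have "indep_var (PiM {..<n} (\<lambda>_. borel)) (\<lambda>\<omega>. restrict (\<lambda>i. X i \<omega>) {..<n})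
      (PiM {n..} (\<lambda>_. borel)) (\<lambda>\<omega>. restrict (\<lambda>i. X i \<omega>) {n..})"
    by (rule indep_var_restrict[OF indep]) auto
  from indep_var_compose[OF this, of "\<lambda>f _. u f" "PiM UNIV (\<lambda>_. borel)" "\<lambda>f i. f (n + i)" "PiM UNIV (\<lambda>_. borel)"]
  show ?thesis
    using u by (simp add: comp_def measurable_PiM_single')
qed

text \<open>The joint law of \<open>U\<close> and the future is a product, so Fubini permits
  integrating over the future first, with \<open>U\<close> frozen; the shift law then restarts the
  walk at index \<open>0\<close>.\<close>

lemma block_prob:
  assumes u: "u \<in> borel_measurable (PiM {..<n} (\<lambda>_. borel))"
    and U: "\<And>\<omega>. U \<omega> = u (\<lambda>i\<in>{..<n}. X i \<omega>)"
  shows "emeasure M {\<omega>\<in>space M. L < U \<omega> \<and> U \<omega> \<le> b \<and> (\<exists>k. x < U \<omega> + S n k \<omega>)}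
    = (\<integral>\<^sup>+\<omega>. indicator {L<..b} (U \<omega>) * ennreal (prob {\<omega>'\<in>space M. \<exists>k. x - U \<omega> < S 0 k \<omega>'}) \<partial>M)"
proof -
  let ?P = "PiM UNIV (\<lambda>_::nat. borel :: real measure)"
  let ?V = "\<lambda>\<omega> i. X (n + i) \<omega>"
  let ?U = "\<lambda>\<omega> _::nat. U \<omega>"
  have ind: "indep_var ?P ?U ?P ?V"
    using indep_block[OF u] U by simp
  have U_meas[measurable]: "?U \<in> measurable M ?P" and V[measurable]: "?V \<in> measurable M ?P"
    by (rule indep_var_rv1[OF ind], rule indep_var_rv2[OF ind])
  have [measurable]: "U \<in> borel_measurable M"
    using measurable_compose[OF U_meas measurable_component_singleton[of 0]] by simp
  interpret V: prob_space "distr M ?P ?V" by (rule prob_space_distr[OF V])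
  let ?A = "{p. L < fst p 0 \<and> fst p 0 \<le> b \<and> (\<exists>k. x < fst p 0 + (\<Sum>i<k. snd p i))}"
  have "{p \<in> space (?P \<Otimes>\<^sub>M ?P). L < fst p 0 \<and> fst p 0 \<le> b \<and> (\<exists>k. x < fst p 0 + (\<Sum>i<k. snd p i))}
      \<in> sets (?P \<Otimes>\<^sub>M ?P)"
    by measurable
  then have A[measurable]: "?A \<in> sets (?P \<Otimes>\<^sub>M ?P)"
    by (simp add: space_pair_measure space_PiM)
  have sect: "emeasure (distr M ?P ?V) (Pair y -` ?A)
      = indicator {L<..b} (y 0) * ennreal (prob {\<omega>'\<in>space M. \<exists>k. x - y 0 < S 0 k \<omega>'})" for y
  proof (cases "L < y 0 \<and> y 0 \<le> b")
    case True
    then have eq: "Pair y -` ?A = {v. \<exists>k. x - y 0 < (\<Sum>i<k. v i)}"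
      by (auto simp: algebra_simps)
    have "emeasure (distr M ?P ?V) (Pair y -` ?A) = emeasure M {\<omega>\<in>space M. \<exists>k. x - y 0 < S n k \<omega>}"
      unfolding eq
      by (subst emeasure_distr[OF V partial_sum_sets])
         (auto simp: S_def intro!: arg_cong[where f = "emeasure M"])
    then show ?thesis using True by (simp add: emeasure_eq_measure exceed_shift[of _ n])
  qed (auto simp: vimage_def)
  have "emeasure M {\<omega>\<in>space M. L < U \<omega> \<and> U \<omega> \<le> b \<and> (\<exists>k. x < U \<omega> + S n k \<omega>)}
      = emeasure (distr M (?P \<Otimes>\<^sub>M ?P) (\<lambda>\<omega>. (?U \<omega>, ?V \<omega>))) ?A"
    by (subst emeasure_distr) (auto simp: S_def intro!: arg_cong[where f = "emeasure M"])
  also have "\<dots> = emeasure (distr M ?P ?U \<Otimes>\<^sub>M distr M ?P ?V) ?A"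
    using ind by (simp add: indep_var_distribution_eq)
  also have "\<dots> = (\<integral>\<^sup>+y. emeasure (distr M ?P ?V) (Pair y -` ?A) \<partial>distr M ?P ?U)"
    by (rule V.emeasure_pair_measure_alt) (use A in \<open>simp cong: sets_pair_measure_cong\<close>)
  also have "\<dots> = (\<integral>\<^sup>+\<omega>. emeasure (distr M ?P ?V) (Pair (?U \<omega>) -` ?A) \<partial>M)"
  proof -
    have "?A \<in> sets (?P \<Otimes>\<^sub>M distr M ?P ?V)" using A by (simp cong: sets_pair_measure_cong)
    then have "(\<lambda>y. emeasure (distr M ?P ?V) (Pair y -` ?A)) \<in> borel_measurable (distr M ?P ?U)"
      by (simp only: measurable_distr_eq1) (rule V.measurable_emeasure_Pair)
    from nn_integral_distr[OF U_meas this] show ?thesis .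
  qed
  finally show ?thesis by (simp only: sect)
qed

lemma block_prob_indep:
  assumes u: "Measurable.pred (PiM {..<n} (\<lambda>_. borel)) u"
    and U: "\<And>\<omega>. U \<omega> = u (\<lambda>i\<in>{..<n}. X i \<omega>)"
  shows "prob {\<omega>\<in>space M. U \<omega> \<and> (\<exists>k. x < S n k \<omega>)}
    = prob {\<omega>\<in>space M. U \<omega>} * prob {\<omega>\<in>space M. \<exists>k. x < S 0 k \<omega>}"
proof -
  let ?P = "PiM UNIV (\<lambda>_::nat. borel :: real measure)"
  let ?U = "\<lambda>\<omega> _::nat. of_bool (u (\<lambda>i\<in>{..<n}. X i \<omega>)) :: real" and ?V = "\<lambda>\<omega> i. X (n + i) \<omega>"
  have ind: "indep_var ?P ?U ?P ?V"
    using u by (intro indep_block[of "\<lambda>f. of_bool (u f)"]) measurable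
  \<comment> \<open>That the stored constant is \<open>1\<close> is phrased through a partial sum of
    length one, so that \<open>partial_sum_sets\<close> gives the measurability of both
    sets.\<close>
  let ?A = "{v :: nat \<Rightarrow> real. \<exists>k. k = 1 \<and> (\<Sum>i<k. v i) = 1}" and ?B = "{v. \<exists>k. x < (\<Sum>i<k. v i)}"
  have "prob ((\<lambda>\<omega>. (?U \<omega>, ?V \<omega>)) -` (?A \<times> ?B) \<inter> space M)
     = prob (?U -` ?A \<inter> space M) * prob (?V -` ?B \<inter> space M)"
    by (rule indep_varD[OF ind]) (rule partial_sum_sets, measurable)+
  moreover have "(\<lambda>\<omega>. (?U \<omega>, ?V \<omega>)) -` (?A \<times> ?B) \<inter> space M = {\<omega>\<in>space M. U \<omega> \<and> (\<exists>k. x < S n k \<omega>)}"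
    by (auto simp: U S_def)
  moreover have "?U -` ?A \<inter> space M = {\<omega>\<in>space M. U \<omega>}"
    by (auto simp: U)
  moreover have "?V -` ?B \<inter> space M = {\<omega>\<in>space M. \<exists>k. x < S n k \<omega>}"
    by (auto simp: S_def)
  ultimately show ?thesis by (simp add: exceed_shift[of _ n])
qed

section \<open>Boundedness of walks with negative drift\<close>

text \<open>
  The increments of the expected running maximum, restricted to the shift-invariant event that the
  walk is unbounded above, are nonnegative and converge to the mean of \<^term>\<open>X 0\<close> times the
  probability of that event.
\<close>
lemma unbounded_null:
  assumes neg: "expectation (X 0) < 0"
  shows "prob {\<omega>\<in>space M. \<forall>n::nat. \<exists>k. real n < S 0 k \<omega>} = 0"
proof -
  let ?P = "PiM UNIV (\<lambda>_::nat. borel :: real measure)"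
  define U where "U v \<longleftrightarrow> (\<forall>n::nat. \<exists>k. real n < (\<Sum>i<k. v i))" for v :: "nat \<Rightarrow> real"
  have U_meas[measurable]: "Measurable.pred ?P U"
    unfolding U_def by measurable
  let ?X = "\<lambda>j \<omega> i. X (j + i) \<omega>"
  have V[measurable]: "?X j \<in> measurable M ?P" for j
    by (rule measurable_PiM_single') auto
  have inv: "U (?X 0 \<omega>) \<longleftrightarrow> U (?X 1 \<omega>)" for \<omega>
  proof -
    have *: "U (?X j \<omega>) \<longleftrightarrow> (\<forall>y. \<exists>k. y < S j k \<omega>)" for j
    proof
      assume "U (?X j \<omega>)"
      then have "\<exists>k. real n < S j k \<omega>" for n by (auto simp: U_def S_def)
      then show "\<forall>y. \<exists>k. y < S j k \<omega>" by (meson less_trans reals_Archimedean2)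
    qed (auto simp: U_def S_def)
    show ?thesis unfolding *
    proof safe
      fix y assume A: "\<forall>y. \<exists>k. y < S 0 k \<omega>"
      \<comment> \<open>The maximum with \<open>0\<close> forces \<open>k\<close> to be positive, so
        that there is a first step to remove.\<close>
      obtain k where k: "max 0 (y + X 0 \<omega>) < S 0 k \<omega>" using A by blast
      then obtain k' where "k = Suc k'" by (cases k) auto
      then show "\<exists>k. y < S 1 k \<omega>" using k by (auto simp: S_Suc_shift intro!: exI[of _ k'])
    next
      fix y assume A: "\<forall>y. \<exists>k. y < S 1 k \<omega>"
      obtain k where k: "y - X 0 \<omega> < S 1 k \<omega>" using A by blast
      then show "\<exists>k. y < S 0 k \<omega>" by (auto simp: S_Suc_shift intro!: exI[of _ "Suc k"])
    qed
  qed
  define I where "I j \<omega> = (if U (?X j \<omega>) then 1 else 0 :: real)" for j \<omega>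
  have I_meas[measurable]: "I j \<in> borel_measurable M" for j
    unfolding I_def by measurable
  have I01: "I 0 \<omega> = I 1 \<omega>" for \<omega> unfolding I_def by (simp only: inv)
  have intw: "integrable M (\<lambda>\<omega>. wmax n (?X j \<omega>) * I j \<omega>)" for n j
  proof (rule Bochner_Integration.integrable_bound)
    show "integrable M (\<lambda>\<omega>. \<Sum>i<n. \<bar>X (j + i) \<omega>\<bar>)"
      by (intro Bochner_Integration.integrable_sum integrable_abs integrable_X)
    show "AE \<omega> in M. norm (wmax n (?X j \<omega>) * I j \<omega>) \<le> norm (\<Sum>i<n. \<bar>X (j + i) \<omega>\<bar>)"
      using wmax_le[of n] wmax_nonneg[of n] by (auto simp: I_def sum_nonneg)
  qed measurable
  have same: "(\<integral>\<omega>. wmax n (?X 0 \<omega>) * I 0 \<omega> \<partial>M) = (\<integral>\<omega>. wmax n (?X 1 \<omega>) * I 1 \<omega> \<partial>M)" for n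
  proof -
    have "(\<integral>\<omega>. wmax n (?X j \<omega>) * I j \<omega> \<partial>M)
        = (\<integral>v. wmax n v * (if U v then 1 else 0) \<partial>distr M ?P (?X j))" for j
      unfolding I_def by (rule integral_distr[symmetric]) measurable
    from this[of 0] this[of 1] show ?thesis using shift_law[of 1] by simp
  qed
  let ?D = "\<lambda>n \<omega>. max (- wmax n (?X 1 \<omega>)) (X 0 \<omega>) * I 1 \<omega>"
  have rec: "wmax (Suc n) (?X 0 \<omega>) = wmax n (?X 1 \<omega>) + max (- wmax n (?X 1 \<omega>)) (X 0 \<omega>)" for n \<omega>
    by (simp add: max_def)
  \<comment> \<open>By \<open>same\<close> the running maxima of length \<open>n\<close> before and
    after the shift have equal means on the invariant event, and lengthening a maximum cannot lower
    it; \<open>rec\<close> identifies the difference as \<open>?D n\<close>.\<close>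
  have D_nonneg: "0 \<le> (\<integral>\<omega>. ?D n \<omega> \<partial>M)" for n
  proof -
    have "(\<integral>\<omega>. wmax n (?X 1 \<omega>) * I 1 \<omega> \<partial>M) = (\<integral>\<omega>. wmax n (?X 0 \<omega>) * I 0 \<omega> \<partial>M)"
      by (rule same[symmetric])
    also have "\<dots> \<le> (\<integral>\<omega>. wmax (Suc n) (?X 0 \<omega>) * I 0 \<omega> \<partial>M)"
      by (intro integral_mono intw mult_right_mono wmax_mono) (auto simp: I_def)
    finally have "0 \<le> (\<integral>\<omega>. wmax (Suc n) (?X 0 \<omega>) * I 0 \<omega> \<partial>M) - (\<integral>\<omega>. wmax n (?X 1 \<omega>) * I 1 \<omega> \<partial>M)"
      by simp
    also have "\<dots> = (\<integral>\<omega>. wmax (Suc n) (?X 0 \<omega>) * I 0 \<omega> - wmax n (?X 1 \<omega>) * I 1 \<omega> \<partial>M)"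
      by (rule Bochner_Integration.integral_diff[symmetric]) (rule intw)+
    also have "\<dots> = (\<integral>\<omega>. ?D n \<omega> \<partial>M)"
      by (intro Bochner_Integration.integral_cong refl) (simp only: rec I01, simp add: algebra_simps)
    finally show ?thesis .
  qed
  have "(\<lambda>n. \<integral>\<omega>. ?D n \<omega> \<partial>M) \<longlonglongrightarrow> (\<integral>\<omega>. X 0 \<omega> * I 1 \<omega> \<partial>M)"
  proof (rule integral_dominated_convergence[where w = "\<lambda>\<omega>. \<bar>X 0 \<omega>\<bar>"])
    show "integrable M (\<lambda>\<omega>. \<bar>X 0 \<omega>\<bar>)" by (intro integrable_abs int)
    show "AE \<omega> in M. norm (?D n \<omega>) \<le> \<bar>X 0 \<omega>\<bar>" for n
    proof (rule AE_I2)
      fix \<omega>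
      show "norm (?D n \<omega>) \<le> \<bar>X 0 \<omega>\<bar>"
        using wmax_nonneg[of n "?X 1 \<omega>"] by (auto simp: I_def max_def)
    qed
    show "AE \<omega> in M. (\<lambda>n. ?D n \<omega>) \<longlonglongrightarrow> X 0 \<omega> * I 1 \<omega>"
    proof (rule AE_I2, cases)
      fix \<omega> assume "U (?X 1 \<omega>)"
      obtain N :: nat where N: "- X 0 \<omega> < real N" using reals_Archimedean2 by blast
      from \<open>U (?X 1 \<omega>)\<close> obtain k where k: "real N < (\<Sum>i<k. ?X 1 \<omega> i)" by (auto simp: U_def)
      \<comment> \<open>Once the running maximum of the shifted walk exceeds
        \<open>- X 0 \<omega>\<close>, the truncation in \<open>?D\<close> is inactive.\<close>
      have "?D n \<omega> = X 0 \<omega> * I 1 \<omega>" if "k \<le> n" for n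
        using sum_le_wmax[OF that, of "?X 1 \<omega>"] k N by (simp add: max_def)
      then have "eventually (\<lambda>n. ?D n \<omega> = X 0 \<omega> * I 1 \<omega>) sequentially"
        unfolding eventually_sequentially by blast
      then show "(\<lambda>n. ?D n \<omega>) \<longlonglongrightarrow> X 0 \<omega> * I 1 \<omega>" by (rule tendsto_eventually)
    qed (simp add: I_def)
  qed measurable
  then have "0 \<le> (\<integral>\<omega>. X 0 \<omega> * I 1 \<omega> \<partial>M)"
    by (rule tendsto_lowerbound) (use D_nonneg in \<open>simp_all add: always_eventually\<close>)
  \<comment> \<open>The indicator taken at index \<open>1\<close> depends only on the walk after its
    first step, hence is independent of \<open>X 0\<close>.\<close>
  also have "\<dots> = expectation (X 0) * expectation (I 1)"
  proof (rule indep_var_lebesgue_integral)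
    have "indep_var ?P (\<lambda>\<omega> _. X 0 \<omega>) ?P (?X 1)"
      using indep_block[of "\<lambda>f. f 0" 1] by simp
    from indep_var_compose[OF this measurable_component_singleton[of 0], of "\<lambda>v. if U v then 1 else 0 :: real" borel]
    show "indep_var borel (X 0) borel (I 1)"
      by (simp add: comp_def I_def[abs_def])
    show "integrable M (I 1)"
      by (rule integrable_const_bound[of _ 1]) (auto simp: I_def)
  qed (rule int)
  finally have "0 \<le> expectation (X 0) * expectation (I 1)" .
  then have "expectation (I 1) \<le> 0"
    using neg by (simp add: zero_le_mult_iff)
  moreover have "expectation (I 1) = prob {\<omega>\<in>space M. \<forall>n::nat. \<exists>k. real n < S 0 k \<omega>}"
  proof -
    have "expectation (I 1) = expectation (indicator {\<omega>\<in>space M. \<forall>n::nat. \<exists>k. real n < S 0 k \<omega>})"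
    proof (intro Bochner_Integration.integral_cong refl)
      fix \<omega> assume "\<omega> \<in> space M"
      have "I 1 \<omega> = I 0 \<omega>" by (simp only: I01)
      also have "\<dots> = indicator {\<omega>\<in>space M. \<forall>n::nat. \<exists>k. real n < S 0 k \<omega>} \<omega>"
        using \<open>\<omega> \<in> space M\<close> by (simp add: I_def U_def S_def indicator_def)
      finally show "I 1 \<omega> = indicator {\<omega>\<in>space M. \<forall>n::nat. \<exists>k. real n < S 0 k \<omega>} \<omega>" .
    qed
    also have "\<dots> = prob {\<omega>\<in>space M. \<forall>n::nat. \<exists>k. real n < S 0 k \<omega>}"
      by simp
    finally show ?thesis .
  qed
  ultimately show ?thesis using measure_nonneg[of M] by (simp add: antisym)
qed

lemma sup_tail_small:
  assumes neg: "expectation (X 0) < 0" and "0 < \<delta>"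
  shows "\<exists>K\<ge>0. prob {\<omega>\<in>space M. \<exists>k. K < S 0 k \<omega>} < \<delta>"
proof -
  let ?A = "\<lambda>n::nat. {\<omega>\<in>space M. \<exists>k. real n < S 0 k \<omega>}"
  have "(\<lambda>n. prob (?A n)) \<longlonglongrightarrow> prob (\<Inter>n. ?A n)"
  proof (rule finite_Lim_measure_decseq)
    show "decseq ?A"
      unfolding decseq_def
    proof safe
      fix m n :: nat and \<omega> k assume "m \<le> n" "real n < S 0 k \<omega>"
      then show "\<exists>k. real m < S 0 k \<omega>" by (intro exI[of _ k]) simp
    qed
    show "range ?A \<subseteq> events"
      by (rule image_subsetI) measurable
  qed
  moreover have "(\<Inter>n. ?A n) = {\<omega>\<in>space M. \<forall>n::nat. \<exists>k. real n < S 0 k \<omega>}" by auto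
  ultimately have "(\<lambda>n. prob (?A n)) \<longlonglongrightarrow> 0" using unbounded_null[OF neg] by simp
  then have "eventually (\<lambda>n. prob (?A n) < \<delta>) sequentially"
    using \<open>0 < \<delta>\<close> by (rule order_tendstoD)
  then obtain n where n: "prob (?A n) < \<delta>" using eventually_happens'[OF sequentially_bot] by blast
  show ?thesis by (rule exI[of _ "real n"], rule conjI[OF of_nat_0_le_iff n])
qed

lemma iid_walk_affine: "iid_walk M (\<lambda>n \<omega>. c * X n \<omega> + e)"
proof -
  have 1: "indep_vars (\<lambda>_. borel) (\<lambda>n \<omega>. c * X n \<omega> + e) UNIV"
    using indep_vars_compose2[OF indep, of "\<lambda>_ x. c * x + e" "\<lambda>_. borel"] by measurable
  have 2: "distr M borel (\<lambda>\<omega>. c * X n \<omega> + e) = distr M borel (\<lambda>\<omega>. c * X 0 \<omega> + e)" for n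
  proof -
    have *: "distr M borel (\<lambda>\<omega>. c * X n \<omega> + e) = distr (distr M borel (X n)) borel (\<lambda>x. c * x + e)" for n
      by (subst distr_distr) (auto simp: comp_def)
    show ?thesis unfolding *[of n] *[of 0] ident[of n] ..
  qed
  have 3: "integrable M (\<lambda>\<omega>. c * X 0 \<omega> + e)" using int by simp
  show ?thesis
    by (rule iid_walk.intro[OF prob_space_axioms iid_walk_axioms.intro[OF 1 2 3]])
qed

text \<open>Subtracting \<open>\<mu>\<close> from every step leaves a negative drift, so
  \<open>sup_tail_small\<close> controls the whole trajectory. One \<open>K\<close> serves all
  lengths \<open>k\<close> and, by stationarity, all starting points \<open>j\<close>; this plays
  the part of a law of large numbers below.\<close>

lemma drift_above:
  assumes "expectation (X 0) < \<mu>" "0 < \<delta>"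
  shows "\<exists>K\<ge>0. \<forall>j. prob {\<omega>\<in>space M. \<exists>k. K + \<mu> * real k < S j k \<omega>} < \<delta>"
proof -
  interpret Y: iid_walk M "\<lambda>n \<omega>. 1 * X n \<omega> + (- \<mu>)" by (rule iid_walk_affine)
  have S: "Y.S 0 k \<omega> = S 0 k \<omega> - \<mu> * real k" for k \<omega>
    unfolding Y.S_def S_def by (simp add: sum_subtractf)
  have "expectation (\<lambda>\<omega>. 1 * X 0 \<omega> + (- \<mu>)) < 0"
    using assms int by (simp add: prob_space)
  from Y.sup_tail_small[OF this assms(2)] obtain K
    where K: "0 \<le> K" "prob {\<omega>\<in>space M. \<exists>k. K < Y.S 0 k \<omega>} < \<delta>" by blast
  show ?thesis
    using K by (intro exI[of _ K] conjI allI) (simp, subst exceed_shift, simp only: S less_diff_eq)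
qed

lemma drift_below:
  assumes "\<mu> < expectation (X 0)" "0 < \<delta>"
  shows "\<exists>K\<ge>0. \<forall>j. prob {\<omega>\<in>space M. \<exists>k. S j k \<omega> < \<mu> * real k - K} < \<delta>"
proof -
  interpret Y: iid_walk M "\<lambda>n \<omega>. (-1) * X n \<omega> + 0" by (rule iid_walk_affine)
  have S: "Y.S 0 k \<omega> = - S 0 k \<omega>" for k \<omega>
    unfolding Y.S_def S_def by (simp add: sum_negf)
  have "expectation (\<lambda>\<omega>. (-1) * X 0 \<omega> + 0) < - \<mu>"
    using assms int by simp
  from Y.drift_above[OF this assms(2)] obtain K
    where K: "0 \<le> K" "prob {\<omega>\<in>space M. \<exists>k. K + (- \<mu>) * real k < Y.S 0 k \<omega>} < \<delta>" by blast
  have "K + (- \<mu>) * real k < Y.S 0 k \<omega> \<longleftrightarrow> S 0 k \<omega> < \<mu> * real k - K" for k \<omega>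
    unfolding S by (simp add: algebra_simps)
  then have "prob {\<omega>\<in>space M. \<exists>k. S 0 k \<omega> < \<mu> * real k - K} < \<delta>"
    using K(2) by (simp only:)
  then show ?thesis
    using K(1) by (intro exI[of _ K] conjI allI) (simp, subst below_shift, simp)
qed

end

section \<open>A single big jump\<close>

lemma (in prob_space) prob_UN_le:
  fixes A :: "nat \<Rightarrow> 'a set"
  assumes "\<And>j. A j \<in> events" "\<And>j. prob (A j) \<le> f j" "summable f"
  shows "prob (\<Union>j. A j) \<le> (\<Sum>j. f j)"
proof -
  have s: "summable (\<lambda>j. prob (A j))"
    by (rule summable_comparison_test'[OF assms(3), of 0]) (use assms(2) in auto)
  have "prob (\<Union>j. A j) \<le> (\<Sum>j. prob (A j))"
    using finite_measure_subadditive_countably[OF _ s] assms(1) by blast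
  also have "\<dots> \<le> (\<Sum>j. f j)"
    by (rule suminf_le[OF assms(2) s assms(3)])
  finally show ?thesis .
qed

lemma (in subexponential_law) shifted_sum_limit:
  assumes "((\<lambda>x. (\<Sum>l. B (x + \<kappa> * real l)) / G x) \<longlongrightarrow> e) at_top"
  shows "((\<lambda>x. (\<Sum>l. B (x + h + \<kappa> * real l)) / G x) \<longlongrightarrow> e) at_top"
proof -
  have sh: "filterlim (\<lambda>x. x + h) at_top at_top"
    using filterlim_tendsto_add_at_top[OF tendsto_const[of h] filterlim_ident] by (simp add: add.commute)
  have "((\<lambda>x. (\<Sum>l. B (x + h + \<kappa> * real l)) / G (x + h) * (G (x + h) / G x)) \<longlongrightarrow> e * 1) at_top"
    by (intro tendsto_mult long_tailed filterlim_compose[OF assms sh])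
  then show ?thesis using tail_pos by (simp add: less_imp_neq[symmetric])
qed

text \<open>\<open>B\<close> merely dominates the tail of a step: in the intended walk a step is
  \<open>\<xi> - s\<close>, whose tail is bounded by that of \<open>\<xi>\<close> but need not be
  equivalent to it. Only upper bounds are drawn from this walk.\<close>

locale heavy_walk = N: subexponential_law \<nu> + iid_walk M X
  for \<nu> :: "real measure" and M :: "'a measure" and X :: "nat \<Rightarrow> 'a \<Rightarrow> real" +
  fixes B :: "real \<Rightarrow> real" and \<kappa> d :: real
  assumes k_pos: "0 < \<kappa>" and drift: "expectation (X 0) < - \<kappa>"
    and X_le_B: "\<And>y. prob {\<omega>\<in>space M. y < X 0 \<omega>} \<le> B y"
    and B_summable: "eventually (\<lambda>x. summable (\<lambda>l. B (x + \<kappa> * real l))) at_top"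
    and B_limit: "((\<lambda>x. (\<Sum>l. B (x + \<kappa> * real l)) / N.G x) \<longlongrightarrow> d / \<kappa>) at_top"
begin

section \<open>First crossing of a decreasing line\<close>

definition m :: "real \<Rightarrow> real" where "m x = prob {\<omega>\<in>space M. \<exists>k. x < S 0 k \<omega>}"

text \<open>\<open>Suc j\<close> is the first time the walk is above the line of height
  \<open>R\<close> and slope \<open>- \<kappa>\<close>. The mean step is below
  \<open>- \<kappa>\<close>, so for large \<open>R\<close> the line is rarely crossed at
  all.\<close>

definition cross :: "real \<Rightarrow> nat \<Rightarrow> 'a \<Rightarrow> bool" where
  "cross R j \<omega> \<longleftrightarrow> (\<forall>i\<in>{..j}. S 0 i \<omega> \<le> R - \<kappa> * real i) \<and> R - \<kappa> * real (Suc j) < S 0 (Suc j) \<omega>"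

text \<open>The height at the crossing. The estimates compare it only with nonnegative thresholds,
  so the default \<open>0\<close> never counts.\<close>

definition U :: "real \<Rightarrow> nat \<Rightarrow> 'a \<Rightarrow> real" where
  "U R j \<omega> = (if cross R j \<omega> then S 0 (Suc j) \<omega> else 0)"

lemma cross_measurable [measurable]: "Measurable.pred M (cross R j)"
  unfolding cross_def by measurable

lemma U_measurable [measurable]: "U R j \<in> borel_measurable M"
  unfolding U_def by measurable

text \<open>Crossing as a function of the first \<open>Suc j\<close> steps, the form that
  \<open>block_prob\<close> and \<open>block_prob_indep\<close> require.\<close>

definition crossf :: "real \<Rightarrow> nat \<Rightarrow> (nat \<Rightarrow> real) \<Rightarrow> bool" where
  "crossf R j f \<longleftrightarrow> (\<forall>i\<in>{..j}. (\<Sum>l<i. f l) \<le> R - \<kappa> * real i) \<and> R - \<kappa> * real (Suc j) < (\<Sum>l<Suc j. f l)"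

lemma crossf_measurable [measurable]:
  "Measurable.pred (PiM {..<Suc j} (\<lambda>_. borel)) (crossf R j)"
proof -
  have *: "(\<lambda>f. \<Sum>l<i. f l) \<in> borel_measurable (PiM {..<Suc j} (\<lambda>_. borel :: real measure))" if "i \<le> Suc j" for i
    using that by (intro borel_measurable_sum measurable_component_singleton) auto
  have [measurable]: "(\<lambda>f. \<Sum>l<Suc j. f l) \<in> borel_measurable (PiM {..<Suc j} (\<lambda>_. borel :: real measure))"
    by (rule *) simp
  have 1: "Measurable.pred (PiM {..<Suc j} (\<lambda>_. borel)) (\<lambda>f. \<forall>i\<in>{..j}. (\<Sum>l<i. f l) \<le> R - \<kappa> * real i)"
  proof (intro pred_intros_finite(3) finite_atMost)
    fix i assume "i \<in> {..j}"
    then have [measurable]: "(\<lambda>f. \<Sum>l<i. f l) \<in> borel_measurable (PiM {..<Suc j} (\<lambda>_. borel :: real measure))"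
      by (intro *) simp
    show "Measurable.pred (PiM {..<Suc j} (\<lambda>_. borel)) (\<lambda>f. (\<Sum>l<i. f l) \<le> R - \<kappa> * real i)"
      by measurable
  qed
  have 2: "Measurable.pred (PiM {..<Suc j} (\<lambda>_. borel)) (\<lambda>f. R - \<kappa> * real (Suc j) < (\<Sum>l<Suc j. f l))"
    by measurable
  show ?thesis
    unfolding crossf_def by (rule pred_intros_logic(3)[OF 1 2])
qed

lemma cross_crossf: "cross R j \<omega> \<longleftrightarrow> crossf R j (\<lambda>i\<in>{..<Suc j}. X i \<omega>)"
proof -
  have "(\<Sum>l<i. (\<lambda>i\<in>{..<Suc j}. X i \<omega>) l) = S 0 i \<omega>" if "i \<le> Suc j" for i
    unfolding S_def using that by (intro sum.cong) auto
  then show ?thesis unfolding cross_def crossf_def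
    by (metis (no_types, lifting) atMost_iff le_SucI order_refl)
qed

lemma U_fun: "U R j \<omega> = (\<lambda>f. if crossf R j f then \<Sum>l<Suc j. f l else 0) (\<lambda>i\<in>{..<Suc j}. X i \<omega>)"
proof -
  have "(\<Sum>l<Suc j. (\<lambda>i\<in>{..<Suc j}. X i \<omega>) l) = S 0 (Suc j) \<omega>"
    unfolding S_def by (intro sum.cong) auto
  then show ?thesis unfolding U_def cross_crossf by presburger
qed

lemma U_fun_measurable:
  "(\<lambda>f. if crossf R j f then \<Sum>l<Suc j. f l else 0) \<in> borel_measurable (PiM {..<Suc j} (\<lambda>_. borel))"
proof -
  have [measurable]: "(\<lambda>f. \<Sum>l<Suc j. f l) \<in> borel_measurable (PiM {..<Suc j} (\<lambda>_. borel :: real measure))"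
    by (intro borel_measurable_sum measurable_component_singleton) auto
  show ?thesis by measurable
qed

lemma cross_disjoint: "disjoint_family (\<lambda>j. {\<omega>\<in>space M. cross R j \<omega>})"
proof -
  have *: False if "i < j" "cross R i \<omega>" "cross R j \<omega>" for i j :: nat and \<omega>
  proof -
    have "S 0 (Suc i) \<omega> \<le> R - \<kappa> * real (Suc i)"
      using bspec[OF conjunct1[OF that(3)[unfolded cross_def]], of "Suc i"] that(1) by simp
    then show False using that(2) unfolding cross_def by linarith
  qed
  show ?thesis
    unfolding disjoint_family_on_def using * by (auto simp: nat_neq_iff)
qed

text \<open>The line starts at \<open>R \<le> x\<close> and falls, so a walk above \<open>x\<close>
  is above the line and has a first crossing, not at time \<open>0\<close> because
  \<open>0 \<le> R\<close>.\<close>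

lemma exceed_cross:
  assumes "0 \<le> R" "R \<le> x" "x < S 0 k \<omega>"
  shows "\<exists>j l. cross R j \<omega> \<and> x < S 0 (Suc j) \<omega> + S (Suc j) l \<omega>"
proof -
  define n where "n = (LEAST n. R - \<kappa> * real n < S 0 n \<omega>)"
  have ex: "R - \<kappa> * real k < S 0 k \<omega>"
    using assms k_pos by (smt (verit) mult_nonneg_nonneg of_nat_0_le_iff)
  have n: "R - \<kappa> * real n < S 0 n \<omega>" unfolding n_def by (rule LeastI[of "\<lambda>n. R - \<kappa> * real n < S 0 n \<omega>", OF ex])
  have least: "S 0 i \<omega> \<le> R - \<kappa> * real i" if "i < n" for i
    using not_less_Least[of i "\<lambda>n. R - \<kappa> * real n < S 0 n \<omega>"] that by (simp add: n_def)
  have "n \<le> k" unfolding n_def by (rule Least_le[of "\<lambda>n. R - \<kappa> * real n < S 0 n \<omega>", OF ex])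
  have "n \<noteq> 0" using n assms(1) by (intro notI) simp
  then obtain j where j: "n = Suc j" using not0_implies_Suc by blast
  have "cross R j \<omega>" unfolding cross_def using least n j by auto
  moreover have "S 0 k \<omega> = S 0 (Suc j) \<omega> + S (Suc j) (k - Suc j) \<omega>"
    using S_add[of 0 "Suc j" "k - Suc j" \<omega>] \<open>n \<le> k\<close> j by simp
  ultimately show ?thesis using assms(3) by auto
qed

text \<open>Just before the crossing the walk is still below the line, so the crossing step covers
  the whole distance to \<open>y\<close>. The slope of the line makes the resulting bounds summable
  in \<open>j\<close>.\<close>

lemma cross_jump:
  assumes "cross R j \<omega>" "y < S 0 (Suc j) \<omega>"
  shows "y - R + \<kappa> * real j < X j \<omega>"
proof -
  have "S 0 j \<omega> \<le> R - \<kappa> * real j" using assms(1) unfolding cross_def by auto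
  then show ?thesis using assms(2) by (simp add: S_Suc)
qed

lemma m_bounds: "0 \<le> m x" "m x \<le> 1"
  by (auto simp: m_def)

lemma B_nonneg: "0 \<le> B y"
  using X_le_B[of y] measure_nonneg by (rule order_trans[rotated])

text \<open>Two big increments: the height \<open>U R j\<close> exceeds \<open>L\<close>, and being
  at most \<open>x - L\<close> it leaves a climb of more than \<open>L\<close> to the
  future.\<close>

definition twice :: "real \<Rightarrow> real \<Rightarrow> real \<Rightarrow> nat \<Rightarrow> 'a set" where
  "twice R L x j = {\<omega>\<in>space M. L < U R j \<omega> \<and> U R j \<omega> \<le> x - L \<and> (\<exists>k. x < U R j \<omega> + S (Suc j) k \<omega>)}"

definition after :: "real \<Rightarrow> real \<Rightarrow> nat \<Rightarrow> 'a set" where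
  "after R y j = {\<omega>\<in>space M. cross R j \<omega> \<and> (\<exists>k. y < S (Suc j) k \<omega>)}"

lemma twice_sets [measurable]: "twice R L x j \<in> events"
  unfolding twice_def by measurable

lemma after_sets [measurable]: "after R y j \<in> events"
  unfolding after_def by measurable

text \<open>By the height at the first crossing: above \<open>x - L\<close>, the crossing step
  itself is large; at most \<open>L\<close>, the future has to climb more than \<open>x - L\<close>;
  in between, both increments exceed \<open>L\<close>.\<close>

lemma exceed_cases:
  assumes "0 \<le> R" "R \<le> x" "x < S 0 k \<omega>" "\<omega> \<in> space M"
  shows "(\<exists>j. x - L - R + \<kappa> * real j < X j \<omega>) \<or> \<omega> \<in> (\<Union>j. after R (x - L) j) \<union> (\<Union>j. twice R L x j)"
proof -
  obtain j l where j: "cross R j \<omega>" "x < S 0 (Suc j) \<omega> + S (Suc j) l \<omega>"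
    using exceed_cross[OF assms(1-3)] by blast
  consider "x - L < S 0 (Suc j) \<omega>" | "S 0 (Suc j) \<omega> \<le> L" | "L < S 0 (Suc j) \<omega>" "S 0 (Suc j) \<omega> \<le> x - L"
    by linarith
  then show ?thesis
  proof cases
    case 1
    from cross_jump[OF j(1) this] show ?thesis by blast
  next
    case 2
    then have "x - L < S (Suc j) l \<omega>" using j(2) by linarith
    then have "\<omega> \<in> after R (x - L) j" using j(1) assms(4) unfolding after_def by blast
    then show ?thesis by blast
  next
    case 3
    then have "\<omega> \<in> twice R L x j" using j assms(4) unfolding twice_def U_def by auto
    then show ?thesis by blast
  qed
qed

text \<open>The crossings for different \<open>j\<close> are disjoint and each is independent of
  what follows, so the sum over \<open>j\<close> is the total crossing probability times
  \<open>m y\<close>.\<close>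

lemma after_prob: "prob (\<Union>j. after R y j) \<le> prob {\<omega>\<in>space M. \<exists>k. R + (- \<kappa>) * real k < S 0 k \<omega>} * m y"
proof -
  let ?C = "\<lambda>j. {\<omega>\<in>space M. cross R j \<omega>}"
  have e: "prob (after R y j) = prob (?C j) * m y" for j
    unfolding after_def m_def
    by (rule block_prob_indep[OF crossf_measurable cross_crossf])
  have sC: "(\<lambda>j. prob (?C j)) sums prob (\<Union>j. ?C j)"
    by (rule finite_measure_UNION) (auto intro: cross_disjoint)
  have "prob (\<Union>j. after R y j) \<le> (\<Sum>j. prob (?C j) * m y)"
    by (rule prob_UN_le) (auto simp: e intro!: summable_mult2 sums_summable[OF sC])
  also have "\<dots> = prob (\<Union>j. ?C j) * m y"
    using sums_mult2[OF sC, of "m y"] by (rule sums_unique[symmetric])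
  also have "\<dots> \<le> prob {\<omega>\<in>space M. \<exists>k. R + (- \<kappa>) * real k < S 0 k \<omega>} * m y"
  proof (intro mult_right_mono finite_measure_mono m_bounds)
    show "(\<Union>j. ?C j) \<subseteq> {\<omega>\<in>space M. \<exists>k. R + (- \<kappa>) * real k < S 0 k \<omega>}"
    proof safe
      fix j \<omega> assume "cross R j \<omega>"
      then show "\<exists>k. R + (- \<kappa>) * real k < S 0 k \<omega>"
        unfolding cross_def by (intro exI[of _ "Suc j"]) simp
    qed
  qed measurable
  finally show ?thesis .
qed

lemma two_big_eq:
  "ennreal (N.two_big L x) = (\<integral>\<^sup>+z. indicator {L<..} z * ennreal (N.G (max L (x - z))) \<partial>\<nu>)"
proof -
  let ?T = "{p :: real \<times> real. L < fst p \<and> L < snd p \<and> x < fst p + snd p}"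
  have "?T \<in> sets (borel \<Otimes>\<^sub>M borel)"
    unfolding borel_prod by (intro borel_open open_Collect_conj open_Collect_less continuous_intros)
  then have T: "?T \<in> sets (\<nu> \<Otimes>\<^sub>M \<nu>)" by simp
  have "ennreal (N.two_big L x) = emeasure (\<nu> \<Otimes>\<^sub>M \<nu>) ?T"
    unfolding N.two_big_def by (rule N.PP.P.emeasure_eq_measure[symmetric])
  also have "\<dots> = (\<integral>\<^sup>+z. emeasure \<nu> (Pair z -` ?T) \<partial>\<nu>)"
    by (rule N.emeasure_pair_measure_alt[OF T])
  also have "\<dots> = (\<integral>\<^sup>+z. indicator {L<..} z * ennreal (N.G (max L (x - z))) \<partial>\<nu>)"
  proof (intro nn_integral_cong)
    fix z
    show "emeasure \<nu> (Pair z -` ?T) = indicator {L<..} z * ennreal (N.G (max L (x - z)))"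
    proof (cases "L < z")
      case True
      then have "Pair z -` ?T = {max L (x - z)<..}" by auto
      then show ?thesis using True by (simp add: N.emeasure_eq_measure)
    qed (auto simp: vimage_def)
  qed
  finally show ?thesis .
qed

text \<open>Two replacements by variables of law \<open>\<nu>\<close>. Given \<open>U R j\<close>,
  the future covers the remaining distance with probability at most \<open>c\<close> times that of a
  variable \<open>z\<close> of law \<open>\<nu>\<close>. After exchanging the integrals, the tails
  of the \<open>U R j\<close>, summed over \<open>j\<close>, are at most \<open>C\<close> times that
  of a second such variable. What remains is \<open>two_big\<close>.\<close>

lemma twice_prob:
  assumes L: "0 \<le> L" and c: "0 \<le> c" "\<And>y. L \<le> y \<Longrightarrow> y \<le> x \<Longrightarrow> m y \<le> c * N.G y"
    and C: "0 \<le> C" "\<And>y. L \<le> y \<Longrightarrow> (\<Sum>j. emeasure M {\<omega>\<in>space M. y < U R j \<omega>}) \<le> ennreal (C * N.G y)"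
  shows "prob (\<Union>j. twice R L x j) \<le> c * C * N.two_big L x"
proof -
  have [measurable]: "(\<lambda>z. N.G (z :: real)) \<in> borel_measurable borel"
  proof -
    have "(\<lambda>z. - N.G (z :: real)) \<in> borel_measurable borel"
      by (rule borel_measurable_mono) (auto simp: mono_def intro: N.G_antimono)
    then show ?thesis by simp
  qed
  have [measurable_cong]: "sets \<nu> = sets borel" by simp
  interpret Mnu: pair_sigma_finite M \<nu> ..
  have one: "emeasure M (twice R L x j)
      \<le> ennreal c * (\<integral>\<^sup>+z. indicator {L<..} z * emeasure M {\<omega>\<in>space M. max L (x - z) < U R j \<omega>} \<partial>\<nu>)" for j
  proof -
    have "emeasure M (twice R L x j) = (\<integral>\<^sup>+\<omega>. indicator {L<..x - L} (U R j \<omega>) * ennreal (m (x - U R j \<omega>)) \<partial>M)"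
      unfolding twice_def m_def by (rule block_prob[OF U_fun_measurable U_fun])
    also have "\<dots> \<le> (\<integral>\<^sup>+\<omega>. indicator {L<..x - L} (U R j \<omega>) * (ennreal c * ennreal (N.G (x - U R j \<omega>))) \<partial>M)"
    proof (intro nn_integral_mono)
      fix \<omega>
      show "indicator {L<..x - L} (U R j \<omega>) * ennreal (m (x - U R j \<omega>))
          \<le> indicator {L<..x - L} (U R j \<omega>) * (ennreal c * ennreal (N.G (x - U R j \<omega>)))"
        using c L by (auto simp: indicator_def ennreal_mult[symmetric] intro!: ennreal_leI)
    qed
    also have "\<dots> = ennreal c * (\<integral>\<^sup>+\<omega>. indicator {L<..x - L} (U R j \<omega>) * ennreal (N.G (x - U R j \<omega>)) \<partial>M)"
      by (subst nn_integral_cmult[symmetric]) (auto simp: mult_ac)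
    also have "(\<integral>\<^sup>+\<omega>. indicator {L<..x - L} (U R j \<omega>) * ennreal (N.G (x - U R j \<omega>)) \<partial>M)
        = (\<integral>\<^sup>+\<omega>. (\<integral>\<^sup>+z. indicator {L<..x - L} (U R j \<omega>) * indicator {p. x < fst p + snd p} (U R j \<omega>, z) \<partial>\<nu>) \<partial>M)"
    proof (intro nn_integral_cong)
      fix \<omega>
      have "(\<integral>\<^sup>+z. indicator {p. x < fst p + snd p} (U R j \<omega>, z) \<partial>\<nu>) = (\<integral>\<^sup>+z. indicator {x - U R j \<omega><..} z \<partial>\<nu>)"
        by (intro nn_integral_cong) (auto simp: indicator_def)
      also have "\<dots> = ennreal (N.G (x - U R j \<omega>))" by (simp add: N.emeasure_eq_measure)
      finally show "indicator {L<..x - L} (U R j \<omega>) * ennreal (N.G (x - U R j \<omega>))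
        = (\<integral>\<^sup>+z. indicator {L<..x - L} (U R j \<omega>) * indicator {p. x < fst p + snd p} (U R j \<omega>, z) \<partial>\<nu>)"
        by (cases "U R j \<omega> \<in> {L<..x - L}") simp_all
    qed
    \<comment> \<open>From \<open>U R j \<omega> \<le> x - L\<close> and
      \<open>x < U R j \<omega> + z\<close> follows \<open>L < z\<close>: the upper restriction on
      the height is traded for a lower one on \<open>z\<close>.\<close>
    also have "\<dots> \<le> (\<integral>\<^sup>+\<omega>. (\<integral>\<^sup>+z. indicator {L<..} z * indicator {p. max L (x - snd p) < fst p} (U R j \<omega>, z) \<partial>\<nu>) \<partial>M)"
      by (intro nn_integral_mono) (auto simp: indicator_def)
    also have "\<dots> = (\<integral>\<^sup>+z. (\<integral>\<^sup>+\<omega>. indicator {L<..} z * indicator {p. max L (x - snd p) < fst p} (U R j \<omega>, z) \<partial>M) \<partial>\<nu>)"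
      by (rule Mnu.Fubini'[symmetric]) measurable
    also have "\<dots> = (\<integral>\<^sup>+z. indicator {L<..} z * emeasure M {\<omega>\<in>space M. max L (x - z) < U R j \<omega>} \<partial>\<nu>)"
    proof (intro nn_integral_cong)
      fix z
      have "(\<integral>\<^sup>+\<omega>. indicator {p. max L (x - snd p) < fst p} (U R j \<omega>, z) \<partial>M)
         = (\<integral>\<^sup>+\<omega>. indicator {\<omega>\<in>space M. max L (x - z) < U R j \<omega>} \<omega> \<partial>M)"
        by (intro nn_integral_cong) (auto simp: indicator_def)
      also have "\<dots> = emeasure M {\<omega>\<in>space M. max L (x - z) < U R j \<omega>}"
        by (rule nn_integral_indicator) measurable
      finally show "(\<integral>\<^sup>+\<omega>. indicator {L<..} z * indicator {p. max L (x - snd p) < fst p} (U R j \<omega>, z) \<partial>M)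
         = indicator {L<..} z * emeasure M {\<omega>\<in>space M. max L (x - z) < U R j \<omega>}"
        by (cases "L < z") simp_all
    qed
    finally show ?thesis by (simp add: mult_left_mono)
  qed
  have [measurable]: "(\<lambda>z. emeasure M {\<omega>\<in>space M. max L (x - z) < U R j \<omega>}) \<in> borel_measurable \<nu>" for j
  proof -
    have "(\<lambda>z. emeasure M {\<omega>\<in>space M. max L (x - z) < U R j \<omega>})
       = (\<lambda>z. \<integral>\<^sup>+\<omega>. indicator {p. max L (x - snd p) < fst p} (U R j \<omega>, z) \<partial>M)"
    proof
      fix z
      have "(\<integral>\<^sup>+\<omega>. indicator {p. max L (x - snd p) < fst p} (U R j \<omega>, z) \<partial>M)
         = (\<integral>\<^sup>+\<omega>. indicator {\<omega>\<in>space M. max L (x - z) < U R j \<omega>} \<omega> \<partial>M)"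
        by (intro nn_integral_cong) (auto simp: indicator_def)
      also have "\<dots> = emeasure M {\<omega>\<in>space M. max L (x - z) < U R j \<omega>}"
        by (rule nn_integral_indicator) measurable
      finally show "emeasure M {\<omega>\<in>space M. max L (x - z) < U R j \<omega>}
        = (\<integral>\<^sup>+\<omega>. indicator {p. max L (x - snd p) < fst p} (U R j \<omega>, z) \<partial>M)" ..
    qed
    then show ?thesis by simp
  qed
  have "emeasure M (\<Union>j. twice R L x j) \<le> (\<Sum>j. emeasure M (twice R L x j))"
    by (rule emeasure_subadditive_countably) auto
  also have "\<dots> \<le> (\<Sum>j. ennreal c * (\<integral>\<^sup>+z. indicator {L<..} z * emeasure M {\<omega>\<in>space M. max L (x - z) < U R j \<omega>} \<partial>\<nu>))"
    by (intro suminf_le one) auto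
  also have "\<dots> = ennreal c * (\<integral>\<^sup>+z. indicator {L<..} z * (\<Sum>j. emeasure M {\<omega>\<in>space M. max L (x - z) < U R j \<omega>}) \<partial>\<nu>)"
    by (simp add: nn_integral_suminf[symmetric])
  also have "\<dots> \<le> ennreal c * (\<integral>\<^sup>+z. ennreal C * (indicator {L<..} z * ennreal (N.G (max L (x - z)))) \<partial>\<nu>)"
  proof (intro mult_left_mono nn_integral_mono)
    fix z
    have "(\<Sum>j. emeasure M {\<omega>\<in>space M. max L (x - z) < U R j \<omega>}) \<le> ennreal (C * N.G (max L (x - z)))"
      by (rule C) simp
    then show "indicator {L<..} z * (\<Sum>j. emeasure M {\<omega>\<in>space M. max L (x - z) < U R j \<omega>})
        \<le> ennreal C * (indicator {L<..} z * ennreal (N.G (max L (x - z))))"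
      using C(1) by (auto simp: indicator_def ennreal_mult)
  qed auto
  also have "\<dots> = ennreal c * (ennreal C * ennreal (N.two_big L x))"
    by (subst nn_integral_cmult) (auto simp: two_big_eq)
  also have "\<dots> = ennreal (c * C * N.two_big L x)"
    using c C by (simp add: ennreal_mult N.two_big_def mult.assoc)
  finally show ?thesis
    using c C by (simp add: emeasure_eq_measure N.two_big_def ennreal_le_iff)
qed

section \<open>Tail of the maximum of the dominating walk\<close>

lemma jump_sum_bound:
  "\<exists>C>0. \<forall>h. eventually (\<lambda>x. summable (\<lambda>j. B (x - h + \<kappa> * real j)) \<and> (\<Sum>j. B (x - h + \<kappa> * real j)) \<le> C * N.G x) at_top"
proof (intro exI conjI allI)
  show "0 < \<bar>d / \<kappa>\<bar> + 1" by linarith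
  fix h
  have "((\<lambda>x. (\<Sum>j. B (x + (- h) + \<kappa> * real j)) / N.G x) \<longlongrightarrow> d / \<kappa>) at_top"
    by (rule N.shifted_sum_limit[OF B_limit])
  then have "eventually (\<lambda>x. (\<Sum>j. B (x + (- h) + \<kappa> * real j)) / N.G x < \<bar>d / \<kappa>\<bar> + 1) at_top"
    by (rule order_tendstoD) linarith
  moreover have "eventually (\<lambda>x. summable (\<lambda>j. B (x + (- h) + \<kappa> * real j))) at_top"
    using eventually_compose_filterlim[OF B_summable
        filterlim_tendsto_add_at_top[OF tendsto_const[of "- h"] filterlim_ident]]
    by (simp add: add.commute)
  ultimately show "eventually (\<lambda>x. summable (\<lambda>j. B (x - h + \<kappa> * real j)) \<and>
      (\<Sum>j. B (x - h + \<kappa> * real j)) \<le> (\<bar>d / \<kappa>\<bar> + 1) * N.G x) at_top"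
    by eventually_elim (use N.tail_pos in \<open>simp add: pos_divide_less_eq less_imp_le\<close>)
qed

text \<open>By \<open>cross_jump\<close> each term needs a step above
  \<open>y - R + \<kappa> * real j\<close>, and the shift by \<open>R\<close> does not change the
  order of the sum.\<close>

lemma U_sum_bound:
  assumes R: "0 \<le> R"
  shows "\<exists>C\<ge>0. eventually (\<lambda>L. \<forall>y\<ge>L. (\<Sum>j. emeasure M {\<omega>\<in>space M. y < U R j \<omega>}) \<le> ennreal (C * N.G y)) at_top"
proof -
  obtain C where C: "0 < C" "\<And>h. eventually (\<lambda>x. summable (\<lambda>j. B (x - h + \<kappa> * real j)) \<and>
      (\<Sum>j. B (x - h + \<kappa> * real j)) \<le> C * N.G x) at_top"
    using jump_sum_bound by blast
  have "eventually (\<lambda>y. (\<Sum>j. emeasure M {\<omega>\<in>space M. y < U R j \<omega>}) \<le> ennreal (C * N.G y)) at_top"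
    using C(2)[of R] eventually_ge_at_top[of 0]
  proof eventually_elim
    case (elim y)
    have "emeasure M {\<omega>\<in>space M. y < U R j \<omega>} \<le> ennreal (B (y - R + \<kappa> * real j))" for j
    proof -
      have "prob {\<omega>\<in>space M. y < U R j \<omega>} \<le> prob {\<omega>\<in>space M. y - R + \<kappa> * real j < X j \<omega>}"
      proof (rule finite_measure_mono)
        show "{\<omega>\<in>space M. y < U R j \<omega>} \<subseteq> {\<omega>\<in>space M. y - R + \<kappa> * real j < X j \<omega>}"
          using elim(2) cross_jump by (auto simp: U_def split: if_splits)
      qed measurable
      also have "\<dots> \<le> B (y - R + \<kappa> * real j)" by (subst X_tail) (rule X_le_B)
      finally show ?thesis by (simp add: emeasure_eq_measure ennreal_leI)
    qed
    then have "(\<Sum>j. emeasure M {\<omega>\<in>space M. y < U R j \<omega>}) \<le> (\<Sum>j. ennreal (B (y - R + \<kappa> * real j)))"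
      by (intro suminf_le) auto
    also have "\<dots> = ennreal (\<Sum>j. B (y - R + \<kappa> * real j))"
      using elim(1) by (intro suminf_ennreal2 B_nonneg) auto
    also have "\<dots> \<le> ennreal (C * N.G y)" using elim(1) by (intro ennreal_leI) auto
    finally show ?case .
  qed
  then show ?thesis using C(1) by (intro exI[of _ C]) (simp add: eventually_all_ge_at_top)
qed

text \<open>A bootstrap: if \<open>m \<le> c * N.G\<close> on \<open>[L, x]\<close>, then
  \<open>exceed_cases\<close> gives \<open>m x \<le> (C1 + 3/4 * c) * N.G x\<close>. Of the
  \<open>3/4\<close>, one half is the crossing probability \<open>1/4\<close> times the factor
  \<open>2\<close> from \<open>N.G (x - L) \<le> 2 * N.G x\<close>, and one quarter is the choice of
  \<open>L\<close> for \<open>two_big\<close>; a single large step costs \<open>C1\<close> whatever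
  \<open>c\<close> is. As \<open>3/4 < 1\<close>, the ratio of \<open>m\<close> to
  \<open>N.G\<close> stays bounded.\<close>

lemma m_le_tail: "\<exists>c\<ge>0. eventually (\<lambda>L. \<forall>y\<ge>L. m y \<le> c * N.G y) at_top"
proof -
  have "\<exists>R\<ge>0. \<forall>j. prob {\<omega>\<in>space M. \<exists>k. R + (- \<kappa>) * real k < S j k \<omega>} < 1/4"
    by (rule drift_above[OF drift]) simp
  then obtain R where R: "0 \<le> R" "prob {\<omega>\<in>space M. \<exists>k. R + (- \<kappa>) * real k < S 0 k \<omega>} < 1/4" by blast
  obtain C where C: "0 \<le> C"
    "eventually (\<lambda>L. \<forall>y\<ge>L. (\<Sum>j. emeasure M {\<omega>\<in>space M. y < U R j \<omega>}) \<le> ennreal (C * N.G y)) at_top"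
    using U_sum_bound[OF R(1)] by blast
  obtain C1 where C1: "0 < C1" "\<And>h. eventually (\<lambda>x. summable (\<lambda>j. B (x - h + \<kappa> * real j)) \<and>
      (\<Sum>j. B (x - h + \<kappa> * real j)) \<le> C1 * N.G x) at_top"
    using jump_sum_bound by blast
  have "eventually (\<lambda>L. eventually (\<lambda>x. N.two_big L x \<le> 1 / (4 * (C + 1)) * N.G x) at_top) at_top"
    by (rule N.two_big_small) (use C in simp)
  from eventually_happens'[OF _ eventually_conj[OF this eventually_conj[OF C(2) eventually_ge_at_top[of 0]]]]
  obtain L where L: "eventually (\<lambda>x. N.two_big L x \<le> 1 / (4 * (C + 1)) * N.G x) at_top"
      "\<And>y. L \<le> y \<Longrightarrow> (\<Sum>j. emeasure M {\<omega>\<in>space M. y < U R j \<omega>}) \<le> ennreal (C * N.G y)" "0 \<le> L"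
    by auto
  have "eventually (\<lambda>x. N.G (x + (- L)) / N.G x < 2) at_top"
    by (rule order_tendstoD(2)[OF N.long_tailed]) simp
  \<comment> \<open>The threshold for \<open>x\<close> is fixed before \<open>c\<close>, so it also
    serves the still unknown supremum of the ratio.\<close>
  then have "eventually (\<lambda>x. \<forall>c\<ge>0. (\<forall>y. L \<le> y \<longrightarrow> y \<le> x \<longrightarrow> m y \<le> c * N.G y) \<longrightarrow> m x \<le> (C1 + 3/4 * c) * N.G x) at_top"
    using L(1) C1(2)[of "L + R"] eventually_ge_at_top[of "max R (2 * L)"]
  proof eventually_elim
    case (elim x)
    show ?case
    proof (intro allI impI)
      fix c :: real assume c: "0 \<le> c" and mc: "\<forall>y. L \<le> y \<longrightarrow> y \<le> x \<longrightarrow> m y \<le> c * N.G y"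
      let ?J = "\<Union>j. {\<omega>\<in>space M. x - L - R + \<kappa> * real j < X j \<omega>}"
      have GL: "N.G (x - L) \<le> 2 * N.G x" using elim(1) N.tail_pos[of x] by (simp add: pos_divide_less_eq)
      have "m x \<le> prob (?J \<union> ((\<Union>j. after R (x - L) j) \<union> (\<Union>j. twice R L x j)))"
        unfolding m_def
      proof (rule finite_measure_mono)
        show "{\<omega>\<in>space M. \<exists>k. x < S 0 k \<omega>} \<subseteq> ?J \<union> ((\<Union>j. after R (x - L) j) \<union> (\<Union>j. twice R L x j))"
        proof
          fix \<omega> assume "\<omega> \<in> {\<omega>\<in>space M. \<exists>k. x < S 0 k \<omega>}"
          then obtain k where k: "x < S 0 k \<omega>" and w: "\<omega> \<in> space M" by blast
          have "R \<le> x" using elim(4) by simp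
          from exceed_cases[OF R(1) this k w, of L] w
          show "\<omega> \<in> ?J \<union> ((\<Union>j. after R (x - L) j) \<union> (\<Union>j. twice R L x j))" by blast
        qed
      qed measurable
      also have "\<dots> \<le> prob ?J + prob ((\<Union>j. after R (x - L) j) \<union> (\<Union>j. twice R L x j))"
        by (rule measure_Un_le) measurable
      also have "prob ((\<Union>j. after R (x - L) j) \<union> (\<Union>j. twice R L x j))
          \<le> prob (\<Union>j. after R (x - L) j) + prob (\<Union>j. twice R L x j)"
        by (rule measure_Un_le) measurable
      also have "prob ?J \<le> (\<Sum>j. B (x - (L + R) + \<kappa> * real j))"
      proof (rule prob_UN_le)
        show "prob {\<omega>\<in>space M. x - L - R + \<kappa> * real j < X j \<omega>} \<le> B (x - (L + R) + \<kappa> * real j)" for j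
          using X_le_B[of "x - L - R + \<kappa> * real j"] by (subst X_tail) (simp add: algebra_simps)
      qed (use elim(3) in auto)
      also have "\<dots> \<le> C1 * N.G x" using elim(3) by simp
      also have "prob (\<Union>j. after R (x - L) j) \<le> 1/4 * (c * (2 * N.G x))"
      proof -
        have "prob (\<Union>j. after R (x - L) j) \<le> 1/4 * m (x - L)"
          by (rule order_trans[OF after_prob mult_right_mono]) (use R m_bounds in auto)
        also have "m (x - L) \<le> c * N.G (x - L)"
          using mc elim(4) L(3) by auto
        also have "\<dots> \<le> c * (2 * N.G x)" by (rule mult_left_mono[OF GL c])
        finally show ?thesis by simp
      qed
      also have "prob (\<Union>j. twice R L x j) \<le> c * C * N.two_big L x"
        by (rule twice_prob[OF L(3) c _ C(1) L(2)]) (use mc in auto)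
      also have "\<dots> \<le> c * C * (1 / (4 * (C + 1)) * N.G x)"
        using c C elim(2) by (intro mult_left_mono) auto
      also have "\<dots> = c * ((C / (C + 1)) * (1/4 * N.G x))"
          by (simp add: distrib_left mult_ac)
      also have "\<dots> \<le> c * (1 * (1/4 * N.G x))"
        using c C by (intro mult_left_mono mult_right_mono) auto
      finally show "m x \<le> (C1 + 3/4 * c) * N.G x" by (simp add: algebra_simps)
    qed
  qed
  then obtain x2 where x2: "\<And>x c. x2 \<le> x \<Longrightarrow> 0 \<le> c \<Longrightarrow> (\<And>y. L \<le> y \<Longrightarrow> y \<le> x \<Longrightarrow> m y \<le> c * N.G y)
      \<Longrightarrow> m x \<le> (C1 + 3/4 * c) * N.G x"
    unfolding eventually_at_top_linorder by blast
  \<comment> \<open>From \<open>s \<le> C1 + 3/4 * s\<close> follows \<open>s \<le> 4 * C1\<close>;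
    the other entry covers the arguments below \<open>x2\<close>, where \<open>m \<le> 1\<close> is
    used.\<close>
  define c where "c = max (1 / N.G x2) (4 * C1)"
  have "m z \<le> c * N.G z" if "L \<le> z" for z
  proof -
    \<comment> \<open>Cutting at \<open>z\<close> makes the supremum finite, by
      \<open>m \<le> 1\<close> and \<open>N.G z > 0\<close>; the bound obtained for it does not
      depend on \<open>z\<close>.\<close>
    define s where "s = (SUP y\<in>{L..z}. m y / N.G y)"
    have bdd: "bdd_above ((\<lambda>y. m y / N.G y) ` {L..z})"
    proof (rule bdd_aboveI2)
      fix y assume "y \<in> {L..z}"
      then have "N.G z \<le> N.G y" by (intro N.G_antimono) simp
      then show "m y / N.G y \<le> 1 / N.G z"
        using m_bounds[of y] N.tail_pos[of z] N.tail_pos[of y] by (intro frac_le) auto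
    qed
    have up: "m y / N.G y \<le> s" if "L \<le> y" "y \<le> z" for y
      unfolding s_def by (rule cSUP_upper[OF _ bdd]) (use that in auto)
    have s0: "0 \<le> s"
      using up[of z] \<open>L \<le> z\<close> m_bounds[of z] N.tail_pos[of z] by (smt (verit) divide_nonneg_pos)
    have "s \<le> max (1 / N.G x2) (C1 + 3/4 * s)"
      unfolding s_def
    proof (rule cSUP_least)
      fix y assume y: "y \<in> {L..z}"
      show "m y / N.G y \<le> max (1 / N.G x2) (C1 + 3/4 * (SUP y\<in>{L..z}. m y / N.G y))"
      proof (cases "x2 \<le> y")
        case True
        have "m y \<le> (C1 + 3/4 * s) * N.G y"
        proof (rule x2[OF True s0])
          fix u assume "L \<le> u" "u \<le> y"
          then have "m u / N.G u \<le> s" using y by (intro up) auto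
          then show "m u \<le> s * N.G u" using N.tail_pos[of u] by (simp add: pos_divide_le_eq)
        qed
        then have "m y / N.G y \<le> C1 + 3/4 * s" using N.tail_pos[of y] by (simp add: pos_divide_le_eq)
        then show ?thesis unfolding s_def by simp
      next
        case False
        then have "N.G x2 \<le> N.G y" by (intro N.G_antimono) simp
        then have "m y / N.G y \<le> 1 / N.G x2"
          using m_bounds[of y] N.tail_pos[of x2] N.tail_pos[of y] by (intro frac_le) auto
        then show ?thesis by simp
      qed
    qed (use that in auto)
    then have "s \<le> c" unfolding c_def by linarith
    then have "m z / N.G z \<le> c" using up[of z] \<open>L \<le> z\<close> by linarith
    then show ?thesis using N.tail_pos[of z] by (simp add: pos_divide_le_eq)
  qed
  moreover have "0 \<le> c" using C1(1) by (simp add: c_def)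
  ultimately show ?thesis
    unfolding eventually_at_top_linorder by (intro exI[of _ c] conjI exI[of _ L]) auto
qed

text \<open>The decomposition of \<open>m_le_tail\<close> without its jump term. Given the bound on
  \<open>m\<close>, the other two terms can be made small: \<open>R\<close> makes crossings rare,
  then \<open>L\<close>, chosen after \<open>R\<close>, makes \<open>two_big\<close> small, and
  \<open>h = L + R\<close>.\<close>

lemma no_jump_negligible:
  assumes "0 < \<eta>"
  shows "\<exists>h. eventually (\<lambda>x. prob {\<omega>\<in>space M. (\<exists>k. x < S 0 k \<omega>) \<and> \<not> (\<exists>j. x - h + \<kappa> * real j < X j \<omega>)}
    \<le> \<eta> * N.G x) at_top"
proof -
  obtain c where c: "0 \<le> c" "eventually (\<lambda>L. \<forall>y\<ge>L. m y \<le> c * N.G y) at_top"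
    using m_le_tail by blast
  \<comment> \<open>The term \<open>after\<close> then costs at most
    \<open>2 * \<delta> * c \<le> \<eta> / 2\<close>; the \<open>\<epsilon>\<close> chosen below
    spends the other half on \<open>twice\<close>.\<close>
  define \<delta> where "\<delta> = \<eta> / (4 * (c + 1))"
  have d: "0 < \<delta>" "\<delta> * c \<le> \<eta> / 4" using assms c by (auto simp: \<delta>_def field_simps)
  have "\<exists>R\<ge>0. \<forall>j. prob {\<omega>\<in>space M. \<exists>k. R + (- \<kappa>) * real k < S j k \<omega>} < \<delta>"
    by (rule drift_above[OF drift d(1)])
  then obtain R where R: "0 \<le> R" "prob {\<omega>\<in>space M. \<exists>k. R + (- \<kappa>) * real k < S 0 k \<omega>} < \<delta>" by blast
  obtain C where C: "0 \<le> C"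
    "eventually (\<lambda>L. \<forall>y\<ge>L. (\<Sum>j. emeasure M {\<omega>\<in>space M. y < U R j \<omega>}) \<le> ennreal (C * N.G y)) at_top"
    using U_sum_bound[OF R(1)] by blast
  define \<epsilon> where "\<epsilon> = \<eta> / (2 * (c * C + 1))"
  have cC: "0 \<le> c * C" using c C by simp
  have e: "0 < \<epsilon>" "c * C * \<epsilon> \<le> \<eta> / 2" using assms cC by (auto simp: \<epsilon>_def field_simps)
  have "eventually (\<lambda>L. eventually (\<lambda>x. N.two_big L x \<le> \<epsilon> * N.G x) at_top) at_top"
    by (rule N.two_big_small[OF e(1)])
  from eventually_happens'[OF _ eventually_conj[OF eventually_conj[OF this c(2)] eventually_conj[OF C(2) eventually_ge_at_top[of 0]]]]
  obtain L where L: "eventually (\<lambda>x. N.two_big L x \<le> \<epsilon> * N.G x) at_top"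
      "\<And>y. L \<le> y \<Longrightarrow> (\<Sum>j. emeasure M {\<omega>\<in>space M. y < U R j \<omega>}) \<le> ennreal (C * N.G y)" "0 \<le> L"
      "\<And>y. L \<le> y \<Longrightarrow> m y \<le> c * N.G y"
    by auto
  have "eventually (\<lambda>x. N.G (x + (- L)) / N.G x < 2) at_top"
    by (rule order_tendstoD(2)[OF N.long_tailed]) simp
  then have "eventually (\<lambda>x. prob {\<omega>\<in>space M. (\<exists>k. x < S 0 k \<omega>) \<and> \<not> (\<exists>j. x - (L + R) + \<kappa> * real j < X j \<omega>)}
    \<le> \<eta> * N.G x) at_top"
    using L(1) eventually_ge_at_top[of "max R (2 * L)"]
  proof eventually_elim
    case (elim x)
    have GL: "N.G (x - L) \<le> 2 * N.G x" using elim(1) N.tail_pos[of x] by (simp add: pos_divide_less_eq)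
    have "prob {\<omega>\<in>space M. (\<exists>k. x < S 0 k \<omega>) \<and> \<not> (\<exists>j. x - (L + R) + \<kappa> * real j < X j \<omega>)}
        \<le> prob ((\<Union>j. after R (x - L) j) \<union> (\<Union>j. twice R L x j))"
    proof (rule finite_measure_mono)
      show "{\<omega>\<in>space M. (\<exists>k. x < S 0 k \<omega>) \<and> \<not> (\<exists>j. x - (L + R) + \<kappa> * real j < X j \<omega>)}
          \<subseteq> (\<Union>j. after R (x - L) j) \<union> (\<Union>j. twice R L x j)"
      proof
        fix \<omega> assume "\<omega> \<in> {\<omega>\<in>space M. (\<exists>k. x < S 0 k \<omega>) \<and> \<not> (\<exists>j. x - (L + R) + \<kappa> * real j < X j \<omega>)}"
        then obtain k where k: "x < S 0 k \<omega>" and w: "\<omega> \<in> space M"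
          and nj: "\<not> (\<exists>j. x - L - R + \<kappa> * real j < X j \<omega>)" by (auto simp: diff_diff_eq)
        have "R \<le> x" using elim(3) by simp
        from exceed_cases[OF R(1) this k w, of L] nj
        show "\<omega> \<in> (\<Union>j. after R (x - L) j) \<union> (\<Union>j. twice R L x j)" by blast
      qed
    qed measurable
    also have "\<dots> \<le> prob (\<Union>j. after R (x - L) j) + prob (\<Union>j. twice R L x j)"
      by (rule measure_Un_le) measurable
    also have "prob (\<Union>j. after R (x - L) j) \<le> \<eta> / 2 * N.G x"
    proof -
      have "prob (\<Union>j. after R (x - L) j) \<le> \<delta> * m (x - L)"
        by (rule order_trans[OF after_prob mult_right_mono]) (use R m_bounds in auto)
      also have "\<dots> \<le> \<delta> * (c * N.G (x - L))"
        using L(4)[of "x - L"] elim(3) L(3) d(1) by (intro mult_left_mono) auto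
      also have "\<dots> \<le> \<delta> * (c * (2 * N.G x))"
        using c(1) d(1) GL by (intro mult_left_mono) auto
      also have "\<dots> = \<delta> * c * (2 * N.G x)" by simp
      also have "\<dots> \<le> \<eta> / 4 * (2 * N.G x)" by (rule mult_right_mono[OF d(2)]) simp
      finally show ?thesis by simp
    qed
    also have "prob (\<Union>j. twice R L x j) \<le> c * C * N.two_big L x"
      by (rule twice_prob[OF L(3) c(1) _ C(1) L(2)]) (use L(4) in auto)
    also have "\<dots> \<le> c * C * (\<epsilon> * N.G x)"
      using cC elim(2) by (intro mult_left_mono) auto
    also have "\<dots> \<le> \<eta> / 2 * N.G x"
      using mult_right_mono[OF e(2), of "N.G x"] by (simp add: mult.assoc)
    finally show ?case by simp
  qed
  then show ?thesis by blast
qed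

end

section \<open>Exceedance at the second station\<close>

text \<open>\<open>\<G> l\<close> stands for the information in all variables except
  \<open>\<xi> l\<close>; that \<open>s\<close> and \<open>t\<close> are measurable for it means
  that a jump of \<open>\<xi> l\<close> leaves the rest of the system typical. The deviation bound
  for the sums of \<open>t\<close> concerns one \<open>l\<close> at a time, with a common
  \<open>K\<close>, which is what stationary sojourn times provide.\<close>

locale second_station = N: subexponential_law \<nu> + iid_walk M \<xi>
  for \<nu> :: "real measure" and M :: "'a measure" and \<xi> :: "nat \<Rightarrow> 'a \<Rightarrow> real" +
  fixes s t :: "nat \<Rightarrow> 'a \<Rightarrow> real" and \<G> :: "nat \<Rightarrow> 'a measure" and a b b1 d :: real
  assumes b: "expectation (\<xi> 0) = b" and b1: "b < b1" and a: "b < a" and d: "0 < d"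
    and diff_walk: "iid_walk M (\<lambda>n \<omega>. \<xi> n \<omega> - s n \<omega>)"
    and diff_mean: "expectation (\<lambda>\<omega>. \<xi> 0 \<omega> - s 0 \<omega>) = b - b1"
    and s_nonneg: "\<And>n. AE \<omega> in M. 0 \<le> s n \<omega>"
    and s_le_t: "\<And>n \<omega>. s n \<omega> \<le> t n \<omega>"
    and t_law: "\<And>\<epsilon> \<delta>. 0 < \<epsilon> \<Longrightarrow> 0 < \<delta> \<Longrightarrow>
      \<exists>K\<ge>0. \<forall>l. prob {\<omega>\<in>space M. \<epsilon> * real l + K < \<bar>(\<Sum>i<l. t i \<omega>) - a * real l\<bar>} \<le> \<delta>"
    and space_\<G>: "\<And>l. space (\<G> l) = space M" and sets_\<G>: "\<And>l. sets (\<G> l) \<subseteq> events"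
    and \<xi>_\<G>: "\<And>i l. i \<noteq> l \<Longrightarrow> \<xi> i \<in> borel_measurable (\<G> l)"
    and s_\<G>: "\<And>i l. s i \<in> borel_measurable (\<G> l)"
    and t_\<G>: "\<And>i l. t i \<in> borel_measurable (\<G> l)"
    and indep_\<G>: "\<And>l y A. A \<in> sets (\<G> l) \<Longrightarrow>
      prob ({\<omega>\<in>space M. y < \<xi> l \<omega>} \<inter> A) = prob {\<omega>\<in>space M. y < \<xi> l \<omega>} * prob A"
    and B_summable: "\<And>\<kappa>. 0 < \<kappa> \<Longrightarrow>
      eventually (\<lambda>x. summable (\<lambda>l. prob {\<omega>\<in>space M. x + \<kappa> * real l < \<xi> 0 \<omega>})) at_top"
    and B_limit: "\<And>\<kappa>. 0 < \<kappa> \<Longrightarrow>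
      ((\<lambda>x. (\<Sum>l. prob {\<omega>\<in>space M. x + \<kappa> * real l < \<xi> 0 \<omega>}) / N.G x) \<longlongrightarrow> d / \<kappa>) at_top"
begin

definition B :: "real \<Rightarrow> real" where "B y = prob {\<omega>\<in>space M. y < \<xi> 0 \<omega>}"

lemma B_xi: "prob {\<omega>\<in>space M. y < \<xi> l \<omega>} = B y"
  unfolding B_def by (rule X_tail)

lemma B_nonneg: "0 \<le> B y"
  by (simp add: B_def)

text \<open>Half the rate at which the dominating walk falls, so that its mean step
  \<open>- 2 * \<kappa>\<close> is below \<open>- \<kappa>\<close>.\<close>

definition \<kappa> :: real where "\<kappa> = (b1 - b) / 2"

lemma k_pos: "0 < \<kappa>"
  using b1 by (simp add: \<kappa>_def)

sublocale D: iid_walk M "\<lambda>n \<omega>. \<xi> n \<omega> - s n \<omega>"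
  by (rule diff_walk)

lemma s_measurable [measurable]: "s i \<in> borel_measurable M"
  and t_measurable [measurable]: "t i \<in> borel_measurable M"
  using s_\<G>[of i 0] t_\<G>[of i 0] sets_\<G>[of 0] space_\<G>[of 0]
  by (auto simp: measurable_def)

lemma diff_le: "AE \<omega> in M. \<forall>j. \<xi> j \<omega> - s j \<omega> \<le> \<xi> j \<omega>"
  unfolding AE_all_countable using s_nonneg by simp

sublocale H: heavy_walk \<nu> M "\<lambda>n \<omega>. \<xi> n \<omega> - s n \<omega>" B \<kappa> d
proof (intro heavy_walk.intro heavy_walk_axioms.intro N.subexponential_law_axioms diff_walk k_pos)
  show "expectation (\<lambda>\<omega>. \<xi> 0 \<omega> - s 0 \<omega>) < - \<kappa>"
    using b1 by (simp add: diff_mean \<kappa>_def field_simps)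
  show "prob {\<omega>\<in>space M. y < \<xi> 0 \<omega> - s 0 \<omega>} \<le> B y" for y
    unfolding B_def
  proof (rule finite_measure_mono_AE)
    show "AE \<omega> in M. \<omega> \<in> {\<omega>\<in>space M. y < \<xi> 0 \<omega> - s 0 \<omega>} \<longrightarrow> \<omega> \<in> {\<omega>\<in>space M. y < \<xi> 0 \<omega>}"
      using s_nonneg[of 0] by eventually_elim auto
  qed measurable
  show "eventually (\<lambda>x. summable (\<lambda>l. B (x + \<kappa> * real l))) at_top"
    unfolding B_def by (rule B_summable[OF k_pos])
  show "((\<lambda>x. (\<Sum>l. B (x + \<kappa> * real l)) / N.G x) \<longlongrightarrow> d / \<kappa>) at_top"
    unfolding B_def by (rule B_limit[OF k_pos])
qed

definition Z :: "nat \<Rightarrow> 'a \<Rightarrow> real" where "Z k \<omega> = (\<Sum>i<k. \<xi> i \<omega> - t i \<omega>)"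

lemma Z_measurable [measurable]: "Z k \<in> borel_measurable M"
  unfolding Z_def by measurable

lemma Z_add: "Z (k + l) \<omega> = Z k \<omega> + (\<Sum>i<l. \<xi> (k + i) \<omega> - t (k + i) \<omega>)"
  unfolding Z_def by (induction l) simp_all

lemma Z_split: "Z k \<omega> = S 0 k \<omega> - (\<Sum>i<k. t i \<omega>)"
  unfolding Z_def S_def by (simp add: sum_subtractf)

lemma Z_inc_le: "(\<Sum>i<l. \<xi> (k + i) \<omega> - t (k + i) \<omega>) \<le> D.S k l \<omega>"
  unfolding D.S_def by (intro sum_mono diff_left_mono s_le_t)

lemma Z_le: "Z k \<omega> \<le> D.S 0 k \<omega>"
  using Z_inc_le[where k = 0 and l = k] by (simp add: Z_def)

definition exceed :: "real \<Rightarrow> 'a set" where "exceed x = {\<omega>\<in>space M. \<exists>k. x < Z k \<omega>}"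

lemma exceed_sets [measurable]: "exceed x \<in> events"
  unfolding exceed_def by measurable

lemma shifted_B:
  assumes "0 < \<theta>"
  shows "((\<lambda>x. (\<Sum>l. B (x + h + \<theta> * real l)) / N.G x) \<longlongrightarrow> d / \<theta>) at_top"
    and "eventually (\<lambda>x. summable (\<lambda>l. B (x + h + \<theta> * real l))) at_top"
proof -
  show "((\<lambda>x. (\<Sum>l. B (x + h + \<theta> * real l)) / N.G x) \<longlongrightarrow> d / \<theta>) at_top"
    by (rule N.shifted_sum_limit) (unfold B_def, rule B_limit[OF assms])
  have "filterlim (\<lambda>x. x + h) at_top at_top"
    using filterlim_tendsto_add_at_top[OF tendsto_const[of h] filterlim_ident] by (simp add: add.commute)
  from eventually_compose_filterlim[OF B_summable[OF assms] this]
  show "eventually (\<lambda>x. summable (\<lambda>l. B (x + h + \<theta> * real l))) at_top"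
    by (simp add: B_def)
qed

section \<open>The upper bound\<close>

lemma xi_sum_\<G>: "k \<le> l \<Longrightarrow> S 0 k \<in> borel_measurable (\<G> l)"
  unfolding S_def by (intro borel_measurable_sum \<xi>_\<G>) auto

lemma diff_sum_\<G>: "k \<le> l \<Longrightarrow> D.S 0 k \<in> borel_measurable (\<G> l)"
  unfolding D.S_def by (intro borel_measurable_sum borel_measurable_diff \<xi>_\<G> s_\<G>) auto

lemma diff_sum_\<G>_after: "D.S (Suc l) k \<in> borel_measurable (\<G> l)"
  unfolding D.S_def by (intro borel_measurable_sum borel_measurable_diff \<xi>_\<G> s_\<G>) auto

lemma t_sum_\<G>: "(\<lambda>\<omega>. \<Sum>i<k. t i \<omega>) \<in> borel_measurable (\<G> l)"
  by (intro borel_measurable_sum t_\<G>)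

text \<open>Atypical behaviour of everything around index \<open>j\<close>. None of the four events
  involves \<open>\<xi> j\<close>: the sums of \<open>\<xi>\<close> stop before \<open>j\<close> or
  start after it, and \<open>t\<close> is measurable for \<open>\<G> j\<close>. Hence
  \<open>bad\<close> is independent of a jump at \<open>j\<close>.\<close>

definition bad :: "real \<Rightarrow> real \<Rightarrow> real \<Rightarrow> nat \<Rightarrow> 'a set" where
  "bad \<epsilon> K x j =
     {\<omega>\<in>space M. \<exists>k\<in>{..j}. x < D.S 0 k \<omega>} \<union> {\<omega>\<in>space M. K + (b + \<epsilon>) * real j < S 0 j \<omega>} \<union>
     {\<omega>\<in>space M. \<epsilon> * real (Suc j) + K < \<bar>(\<Sum>i<Suc j. t i \<omega>) - a * real (Suc j)\<bar>} \<union>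
     {\<omega>\<in>space M. \<exists>k. K < D.S (Suc j) k \<omega>}"

lemma bad_\<G>: "bad \<epsilon> K x j \<in> sets (\<G> j)"
proof -
  note [measurable] = diff_sum_\<G>_after t_sum_\<G> xi_sum_\<G>[OF order_refl]
  have 1: "{\<omega>\<in>space (\<G> j). \<exists>k\<in>{..j}. x < D.S 0 k \<omega>} \<in> sets (\<G> j)"
  proof (intro sets.sets_Collect_finite_Ex)
    fix k assume "k \<in> {..j}"
    then have [measurable]: "D.S 0 k \<in> borel_measurable (\<G> j)" by (intro diff_sum_\<G>) simp
    show "{\<omega>\<in>space (\<G> j). x < D.S 0 k \<omega>} \<in> sets (\<G> j)" by measurable
  qed simp
  have 2: "{\<omega>\<in>space (\<G> j). K + (b + \<epsilon>) * real j < S 0 j \<omega>} \<in> sets (\<G> j)"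
    by measurable
  have 3: "{\<omega>\<in>space (\<G> j). \<epsilon> * real (Suc j) + K < \<bar>(\<Sum>i<Suc j. t i \<omega>) - a * real (Suc j)\<bar>} \<in> sets (\<G> j)"
    by measurable
  have 4: "{\<omega>\<in>space (\<G> j). \<exists>k. K < D.S (Suc j) k \<omega>} \<in> sets (\<G> j)"
    by measurable
  show ?thesis
    unfolding bad_def using 1 2 3 4 unfolding space_\<G> by (intro sets.Un)
qed

lemma bad_sets [measurable]: "bad \<epsilon> K x j \<in> events"
  using bad_\<G>[of \<epsilon> K x j] sets_\<G>[of j] by blast

lemma bad_prob:
  assumes "0 < \<epsilon>" "0 < \<delta>"
  shows "\<exists>K\<ge>0. eventually (\<lambda>x. \<forall>j. prob (bad \<epsilon> K x j) \<le> 4 * \<delta>) at_top"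
proof -
  have neg: "expectation (\<lambda>\<omega>. \<xi> 0 \<omega> - s 0 \<omega>) < 0" using diff_mean b1 by simp
  have "expectation (\<xi> 0) < b + \<epsilon>" using b assms by simp
  then obtain K1 where K1: "0 \<le> K1" "\<And>j. prob {\<omega>\<in>space M. \<exists>k. K1 + (b + \<epsilon>) * real k < S j k \<omega>} < \<delta>"
    using drift_above[OF _ assms(2)] by blast
  obtain K2 where K2: "0 \<le> K2"
    "\<And>l. prob {\<omega>\<in>space M. \<epsilon> * real l + K2 < \<bar>(\<Sum>i<l. t i \<omega>) - a * real l\<bar>} \<le> \<delta>"
    using t_law[OF assms] by blast
  obtain K3 where K3: "0 \<le> K3" "\<And>j. prob {\<omega>\<in>space M. \<exists>k. K3 + 0 * real k < D.S j k \<omega>} < \<delta>"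
    using D.drift_above[OF neg assms(2)] by blast
  define K where "K = K1 + K2 + K3"
  \<comment> \<open>The dominating walk rarely exceeds \<open>K3\<close>, so
    \<open>x \<ge> K3\<close> settles the first event; the other three do not involve
    \<open>x\<close>.\<close>
  have "eventually (\<lambda>x. \<forall>j. prob (bad \<epsilon> K x j) \<le> 4 * \<delta>) at_top"
    using eventually_ge_at_top[of K3]
  proof eventually_elim
    case (elim x)
    show ?case
    proof
      fix j
      let ?E1 = "{\<omega>\<in>space M. \<exists>k\<in>{..j}. x < D.S 0 k \<omega>}"
      let ?E2 = "{\<omega>\<in>space M. K + (b + \<epsilon>) * real j < S 0 j \<omega>}"
      let ?E3 = "{\<omega>\<in>space M. \<epsilon> * real (Suc j) + K < \<bar>(\<Sum>i<Suc j. t i \<omega>) - a * real (Suc j)\<bar>}"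
      let ?E4 = "{\<omega>\<in>space M. \<exists>k. K < D.S (Suc j) k \<omega>}"
      have "prob ?E1 \<le> prob {\<omega>\<in>space M. \<exists>k. K3 + 0 * real k < D.S 0 k \<omega>}"
        by (rule finite_measure_mono) (use elim in \<open>auto intro: le_less_trans\<close>)
      then have 1: "prob ?E1 \<le> \<delta>" using K3(2)[of 0] by linarith
      have "prob ?E2 \<le> prob {\<omega>\<in>space M. \<exists>k. K1 + (b + \<epsilon>) * real k < S 0 k \<omega>}"
        by (rule finite_measure_mono) (use K2 K3 in \<open>auto simp: K_def intro!: exI[of _ j]\<close>)
      then have 2: "prob ?E2 \<le> \<delta>" using K1(2)[of 0] by linarith
      have "prob ?E3 \<le> prob {\<omega>\<in>space M. \<epsilon> * real (Suc j) + K2 < \<bar>(\<Sum>i<Suc j. t i \<omega>) - a * real (Suc j)\<bar>}"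
      proof (rule finite_measure_mono)
        show "?E3 \<subseteq> {\<omega>\<in>space M. \<epsilon> * real (Suc j) + K2 < \<bar>(\<Sum>i<Suc j. t i \<omega>) - a * real (Suc j)\<bar>}"
          using K1 K3 unfolding K_def by (intro Collect_mono) linarith
      qed measurable
      then have 3: "prob ?E3 \<le> \<delta>" using K2(2)[of "Suc j"] by linarith
      have "prob ?E4 \<le> prob {\<omega>\<in>space M. \<exists>k. K3 + 0 * real k < D.S (Suc j) k \<omega>}"
      proof (rule finite_measure_mono)
        show "?E4 \<subseteq> {\<omega>\<in>space M. \<exists>k. K3 + 0 * real k < D.S (Suc j) k \<omega>}"
        proof safe
          fix \<omega> k assume "K < D.S (Suc j) k \<omega>"
          then have "K3 + 0 * real k < D.S (Suc j) k \<omega>" using K1(1) K2(1) unfolding K_def by linarith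
          then show "\<exists>k. K3 + 0 * real k < D.S (Suc j) k \<omega>" ..
        qed
      qed measurable
      then have 4: "prob ?E4 \<le> \<delta>" using K3(2)[of "Suc j"] by linarith
      have [measurable]: "?E1 \<in> events" "?E2 \<in> events" "?E3 \<in> events" "?E4 \<in> events"
        by measurable
      have "prob (bad \<epsilon> K x j) \<le> prob ?E1 + prob ?E2 + prob ?E3 + prob ?E4"
        unfolding bad_def
        by (rule order_trans[OF measure_Un_le add_right_mono],
            measurable, rule order_trans[OF measure_Un_le add_right_mono],
            measurable, rule measure_Un_le, measurable)
      then show "prob (bad \<epsilon> K x j) \<le> 4 * \<delta>" using 1 2 3 4 by linarith
    qed
  qed
  then show ?thesis using K1 K2 K3 by (intro exI[of _ K]) (simp add: K_def)
qed

text \<open>Off \<open>bad\<close>, level \<open>x\<close> is not passed up to time \<open>j\<close>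
  and at most \<open>K\<close> is gained after \<open>Suc j\<close>, so \<open>Z (Suc j)\<close> is
  already above \<open>x - K\<close>. Hence \<open>\<xi> j\<close> has made up for the drift: the
  slope is \<open>(a - \<epsilon>) - (b + \<epsilon>)\<close>, and \<open>3 * K\<close> collects
  three errors.\<close>

lemma exceed_not_bad:
  assumes w: "\<omega> \<in> exceed x" "\<omega> \<notin> bad \<epsilon> K x j"
  shows "x + (a - \<epsilon> - 3 * K) + (a - b - 2 * \<epsilon>) * real j < \<xi> j \<omega>"
proof -
  obtain k where k: "x < Z k \<omega>" and sp: "\<omega> \<in> space M" using w(1) by (auto simp: exceed_def)
  have g1: "D.S 0 i \<omega> \<le> x" if "i \<le> j" for i
    using w(2) sp that unfolding bad_def by (auto simp: not_less)
  have g2: "S 0 j \<omega> \<le> K + (b + \<epsilon>) * real j"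
    using w(2) sp unfolding bad_def by (auto simp: not_less)
  have g3: "\<bar>(\<Sum>i<Suc j. t i \<omega>) - a * real (Suc j)\<bar> \<le> \<epsilon> * real (Suc j) + K"
    using w(2) sp unfolding bad_def by (auto simp: not_less simp del: sum.lessThan_Suc of_nat_Suc)
  have g4: "D.S (Suc j) l \<omega> \<le> K" for l
    using w(2) sp unfolding bad_def by (auto simp: not_less)
  have "\<not> k \<le> j" using g1[of k] Z_le[of k \<omega>] k by auto
  then obtain l where l: "k = Suc j + l" by (metis less_imp_Suc_add add_Suc not_le)
  have "Z k \<omega> \<le> Z (Suc j) \<omega> + K"
    unfolding l using Z_add[of "Suc j" l \<omega>] Z_inc_le[where l = l and k = "Suc j" and \<omega> = \<omega>] g4[of l] by linarith
  also have "Z (Suc j) \<omega> = S 0 j \<omega> + \<xi> j \<omega> - (\<Sum>i<Suc j. t i \<omega>)"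
    unfolding Z_split by (simp add: S_Suc)
  finally have "x < S 0 j \<omega> + \<xi> j \<omega> - (\<Sum>i<Suc j. t i \<omega>) + K" using k by linarith
  moreover have "(a - \<epsilon>) * real (Suc j) - K \<le> (\<Sum>i<Suc j. t i \<omega>)"
    using g3 by (simp add: left_diff_distrib abs_le_iff del: sum.lessThan_Suc of_nat_Suc)
  ultimately have "x < K + (b + \<epsilon>) * real j + \<xi> j \<omega> - ((a - \<epsilon>) * real (Suc j) - K) + K"
    using g2 by linarith
  then show ?thesis by (simp add: algebra_simps)
qed

text \<open>An exceedance happens without a jump of the dominating walk, or with a jump above the
  line of slope \<open>\<kappa>\<close> together with \<open>bad\<close>, or, by
  \<open>exceed_not_bad\<close>, with a jump above the line of slope \<open>\<theta>\<close>.
  Relative to \<open>N.G x\<close> these contribute in the limit at most \<open>\<eta>\<close>,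
  \<open>4 * \<delta> * (d / \<kappa>)\<close> and \<open>d / \<theta>\<close>.\<close>

lemma upper_bound:
  assumes "d / (a - b) < c"
  shows "eventually (\<lambda>x. prob (exceed x) / N.G x < c) at_top"
proof -
  define \<eta> where "\<eta> = (c - d / (a - b)) / 4"
  have \<eta>: "0 < \<eta>" using assms by (simp add: \<eta>_def)
  have "((\<lambda>\<epsilon>. d / (a - b - 2 * \<epsilon>)) \<longlongrightarrow> d / (a - b - 2 * 0)) (at_right 0)"
    using a by (intro tendsto_intros) auto
  then have "eventually (\<lambda>\<epsilon>. d / (a - b - 2 * \<epsilon>) < d / (a - b) + \<eta>) (at_right 0)"
    by (rule order_tendstoD) (use \<eta> in simp)
  moreover have "eventually (\<lambda>\<epsilon>. \<epsilon> \<in> {0<..<(a - b) / 2}) (at_right (0::real))"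
    using a by (intro eventually_at_right_real) simp
  ultimately have "\<exists>\<epsilon>. d / (a - b - 2 * \<epsilon>) < d / (a - b) + \<eta> \<and> \<epsilon> \<in> {0<..<(a - b) / 2}"
    by (intro eventually_happens'[OF trivial_limit_at_right_real] eventually_conj)
  then obtain \<epsilon> where e: "0 < \<epsilon>" "\<epsilon> < (a - b) / 2" "d / (a - b - 2 * \<epsilon>) < d / (a - b) + \<eta>" by auto
  define \<theta> where "\<theta> = a - b - 2 * \<epsilon>"
  have \<theta>: "0 < \<theta>" using e by (simp add: \<theta>_def)
  \<comment> \<open>Makes \<open>4 * \<delta> * (d / \<kappa>)\<close> equal to
    \<open>\<eta>\<close>. Together with the missing jump and the slope error this spends three
    quarters of the gap to \<open>c\<close>.\<close>
  define \<delta> where "\<delta> = \<eta> * \<kappa> / (4 * d)"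
  have \<delta>: "0 < \<delta>" using \<eta> k_pos d by (simp add: \<delta>_def)
  obtain K where K: "eventually (\<lambda>x. \<forall>j. prob (bad \<epsilon> K x j) \<le> 4 * \<delta>) at_top"
    using bad_prob[OF e(1) \<delta>] by blast
  obtain h where h: "eventually (\<lambda>x. prob {\<omega>\<in>space M. (\<exists>k. x < D.S 0 k \<omega>) \<and>
      \<not> (\<exists>j. x - h + \<kappa> * real j < \<xi> j \<omega> - s j \<omega>)} \<le> \<eta> * N.G x) at_top"
    using H.no_jump_negligible[OF \<eta>] by blast
  define h' where "h' = a - \<epsilon> - 3 * K"
  let ?s1 = "\<lambda>x. \<Sum>l. B (x + (- h) + \<kappa> * real l)" and ?s2 = "\<lambda>x. \<Sum>l. B (x + h' + \<theta> * real l)"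
  have "((\<lambda>x. \<eta> + 4 * \<delta> * (?s1 x / N.G x) + ?s2 x / N.G x) \<longlongrightarrow> \<eta> + 4 * \<delta> * (d / \<kappa>) + d / \<theta>) at_top"
    by (intro tendsto_intros shifted_B k_pos \<theta>)
  moreover have "\<eta> + 4 * \<delta> * (d / \<kappa>) + d / \<theta> < c"
  proof -
    have "4 * \<delta> * (d / \<kappa>) = \<eta>" using d k_pos by (simp add: \<delta>_def)
    moreover have "4 * \<eta> = c - d / (a - b)" by (simp add: \<eta>_def)
    ultimately show ?thesis using e(3) \<eta> unfolding \<theta>_def by (simp only:; linarith)
  qed
  ultimately have "eventually (\<lambda>x. \<eta> + 4 * \<delta> * (?s1 x / N.G x) + ?s2 x / N.G x < c) at_top"
    by (rule order_tendstoD)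
  then show ?thesis
    using K h shifted_B(2)[OF k_pos, of "- h"] shifted_B(2)[OF \<theta>, of h']
  proof eventually_elim
    case (elim x)
    let ?NJ = "{\<omega>\<in>space M. (\<exists>k. x < D.S 0 k \<omega>) \<and> \<not> (\<exists>j. x - h + \<kappa> * real j < \<xi> j \<omega> - s j \<omega>)}"
    let ?J = "\<lambda>j. {\<omega>\<in>space M. x + (- h) + \<kappa> * real j < \<xi> j \<omega>} \<inter> bad \<epsilon> K x j
        \<union> {\<omega>\<in>space M. x + h' + \<theta> * real j < \<xi> j \<omega>}"
    have J: "?J j \<in> events" for j by measurable
    have NJ[measurable]: "?NJ \<in> events" by measurable
    have "prob (exceed x) \<le> prob (?NJ \<union> (\<Union>j. ?J j))"
    proof (rule finite_measure_mono_AE)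
      show "AE \<omega> in M. \<omega> \<in> exceed x \<longrightarrow> \<omega> \<in> ?NJ \<union> (\<Union>j. ?J j)"
        using diff_le
      proof eventually_elim
        case le: (elim \<omega>)
        show ?case
        proof
          assume w: "\<omega> \<in> exceed x"
          then have sp: "\<omega> \<in> space M" and ex: "\<exists>k. x < D.S 0 k \<omega>"
            using Z_le by (auto simp: exceed_def intro: less_le_trans)
          show "\<omega> \<in> ?NJ \<union> (\<Union>j. ?J j)"
          proof (cases "\<exists>j. x - h + \<kappa> * real j < \<xi> j \<omega> - s j \<omega>")
            case True
            then obtain j where "x - h + \<kappa> * real j < \<xi> j \<omega> - s j \<omega>" by blast
            also have "\<dots> \<le> \<xi> j \<omega>" using le by simp
            finally have "\<omega> \<in> {\<omega>\<in>space M. x + (- h) + \<kappa> * real j < \<xi> j \<omega>}" using sp by simp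
            moreover have "\<omega> \<in> bad \<epsilon> K x j \<or> \<omega> \<in> {\<omega>\<in>space M. x + h' + \<theta> * real j < \<xi> j \<omega>}"
              using exceed_not_bad[OF w, of \<epsilon> K j] sp by (auto simp: h'_def \<theta>_def)
            ultimately show ?thesis by blast
          qed (use sp ex in auto)
        qed
      qed
    qed (use J NJ in auto)
    also have "\<dots> \<le> prob ?NJ + prob (\<Union>j. ?J j)"
      by (rule measure_Un_le) (use J NJ in auto)
    also have "prob (\<Union>j. ?J j) \<le> (\<Sum>j. 4 * \<delta> * B (x + (- h) + \<kappa> * real j) + B (x + h' + \<theta> * real j))"
    proof (rule prob_UN_le[OF J])
      fix j
      have "prob (?J j) \<le> prob ({\<omega>\<in>space M. x + (- h) + \<kappa> * real j < \<xi> j \<omega>} \<inter> bad \<epsilon> K x j)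
          + prob {\<omega>\<in>space M. x + h' + \<theta> * real j < \<xi> j \<omega>}"
        by (rule measure_Un_le) measurable
      also have "\<dots> = B (x + (- h) + \<kappa> * real j) * prob (bad \<epsilon> K x j) + B (x + h' + \<theta> * real j)"
        by (simp only: indep_\<G>[OF bad_\<G>] B_xi)
      also have "\<dots> \<le> B (x + (- h) + \<kappa> * real j) * (4 * \<delta>) + B (x + h' + \<theta> * real j)"
        using elim(2) by (intro add_right_mono mult_left_mono B_nonneg) auto
      finally show "prob (?J j) \<le> 4 * \<delta> * B (x + (- h) + \<kappa> * real j) + B (x + h' + \<theta> * real j)"
        by (simp only: mult.commute)
    next
      show "summable (\<lambda>j. 4 * \<delta> * B (x + (- h) + \<kappa> * real j) + B (x + h' + \<theta> * real j))"
        by (intro summable_add summable_mult elim(4,5))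
    qed
    also have "\<dots> = 4 * \<delta> * ?s1 x + ?s2 x"
      by (subst suminf_add[symmetric, OF summable_mult[OF elim(4)] elim(5)]) (simp only: suminf_mult[OF elim(4)])
    finally have "prob (exceed x) \<le> \<eta> * N.G x + (4 * \<delta> * ?s1 x + ?s2 x)" using elim(3) by linarith
    then have "prob (exceed x) / N.G x \<le> (\<eta> * N.G x + (4 * \<delta> * ?s1 x + ?s2 x)) / N.G x"
      by (intro divide_right_mono) auto
    also have "\<dots> = \<eta> + 4 * \<delta> * (?s1 x / N.G x) + ?s2 x / N.G x"
      using N.tail_pos[of x] by (simp add: add_divide_distrib)
    finally show ?case using elim(1) by linarith
  qed
qed

section \<open>The lower bound\<close>

text \<open>The last part of the event forces the events used in the lower bound to be disjoint.\<close>
definition poor :: "real \<Rightarrow> real \<Rightarrow> real \<Rightarrow> real \<Rightarrow> nat \<Rightarrow> 'a set" where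
  "poor \<epsilon> K \<theta> x j =
     {\<omega>\<in>space M. S 0 j \<omega> < (b - \<epsilon>) * real j - K} \<union>
     {\<omega>\<in>space M. \<epsilon> * real (Suc j) + K < \<bar>(\<Sum>i<Suc j. t i \<omega>) - a * real (Suc j)\<bar>} \<union>
     {\<omega>\<in>space M. \<exists>i\<in>{..<j}. x + \<theta> * real i < \<xi> i \<omega>}"

lemma poor_\<G>: "poor \<epsilon> K \<theta> x j \<in> sets (\<G> j)"
proof -
  note [measurable] = t_sum_\<G> xi_sum_\<G>[OF order_refl]
  have 1: "{\<omega>\<in>space (\<G> j). \<exists>i\<in>{..<j}. x + \<theta> * real i < \<xi> i \<omega>} \<in> sets (\<G> j)"
  proof (intro sets.sets_Collect_finite_Ex)
    fix i assume "i \<in> {..<j}"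
    then have [measurable]: "\<xi> i \<in> borel_measurable (\<G> j)" by (intro \<xi>_\<G>) simp
    show "{\<omega>\<in>space (\<G> j). x + \<theta> * real i < \<xi> i \<omega>} \<in> sets (\<G> j)" by measurable
  qed simp
  have 2: "{\<omega>\<in>space (\<G> j). S 0 j \<omega> < (b - \<epsilon>) * real j - K} \<in> sets (\<G> j)"
    by measurable
  have 3: "{\<omega>\<in>space (\<G> j). \<epsilon> * real (Suc j) + K < \<bar>(\<Sum>i<Suc j. t i \<omega>) - a * real (Suc j)\<bar>} \<in> sets (\<G> j)"
    by measurable
  show ?thesis
    unfolding poor_def using 1 2 3 unfolding space_\<G> by (intro sets.Un)
qed

lemma poor_sets [measurable]: "poor \<epsilon> K \<theta> x j \<in> events"
  using poor_\<G>[of \<epsilon> K \<theta> x j] sets_\<G>[of j] by blast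

lemma poor_prob:
  assumes "0 < \<epsilon>" "0 < \<delta>" "0 < \<theta>"
  shows "\<exists>K\<ge>0. eventually (\<lambda>x. \<forall>j. prob (poor \<epsilon> K \<theta> x j) \<le> 3 * \<delta>) at_top"
proof -
  have "b - \<epsilon> < expectation (\<xi> 0)" using b assms by simp
  then obtain K1 where K1: "0 \<le> K1" "\<And>j. prob {\<omega>\<in>space M. \<exists>k. S j k \<omega> < (b - \<epsilon>) * real k - K1} < \<delta>"
    using drift_below[OF _ assms(2)] by blast
  obtain K2 where K2: "0 \<le> K2"
    "\<And>l. prob {\<omega>\<in>space M. \<epsilon> * real l + K2 < \<bar>(\<Sum>i<l. t i \<omega>) - a * real l\<bar>} \<le> \<delta>"
    using t_law[OF assms(1,2)] by blast
  define K where "K = K1 + K2"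
  \<comment> \<open>The expected number of jumps above the line is about
    \<open>d / \<theta> * N.G x\<close> and vanishes, so the last clause of \<open>poor\<close>
    becomes improbable.\<close>
  have "((\<lambda>x. (\<Sum>l. B (x + 0 + \<theta> * real l)) / N.G x * N.G x) \<longlongrightarrow> d / \<theta> * 0) at_top"
    by (intro tendsto_mult shifted_B(1) assms N.G_tendsto_0)
  then have "((\<lambda>x. \<Sum>l. B (x + 0 + \<theta> * real l)) \<longlongrightarrow> 0) at_top"
    using N.tail_pos by (simp add: less_imp_neq[symmetric])
  then have "eventually (\<lambda>x. (\<Sum>l. B (x + 0 + \<theta> * real l)) < \<delta>) at_top"
    using assms(2) by (rule order_tendstoD)
  then have "eventually (\<lambda>x. \<forall>j. prob (poor \<epsilon> K \<theta> x j) \<le> 3 * \<delta>) at_top"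
    using shifted_B(2)[OF assms(3), of 0]
  proof eventually_elim
    case (elim x)
    show ?case
    proof
      fix j
      let ?E1 = "{\<omega>\<in>space M. S 0 j \<omega> < (b - \<epsilon>) * real j - K}"
      let ?E2 = "{\<omega>\<in>space M. \<epsilon> * real (Suc j) + K < \<bar>(\<Sum>i<Suc j. t i \<omega>) - a * real (Suc j)\<bar>}"
      let ?E3 = "{\<omega>\<in>space M. \<exists>i\<in>{..<j}. x + \<theta> * real i < \<xi> i \<omega>}"
      have "prob ?E1 \<le> prob {\<omega>\<in>space M. \<exists>k. S 0 k \<omega> < (b - \<epsilon>) * real k - K1}"
        by (rule finite_measure_mono) (use K2 in \<open>auto simp: K_def intro!: exI[of _ j]\<close>)
      then have 1: "prob ?E1 \<le> \<delta>" using K1(2)[of 0] by linarith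
      have "prob ?E2 \<le> prob {\<omega>\<in>space M. \<epsilon> * real (Suc j) + K2 < \<bar>(\<Sum>i<Suc j. t i \<omega>) - a * real (Suc j)\<bar>}"
      proof (rule finite_measure_mono)
        show "?E2 \<subseteq> {\<omega>\<in>space M. \<epsilon> * real (Suc j) + K2 < \<bar>(\<Sum>i<Suc j. t i \<omega>) - a * real (Suc j)\<bar>}"
          using K1 unfolding K_def by (intro Collect_mono) linarith
      qed measurable
      then have 2: "prob ?E2 \<le> \<delta>" using K2(2)[of "Suc j"] by linarith
      have "prob ?E3 \<le> prob (\<Union>i. {\<omega>\<in>space M. x + 0 + \<theta> * real i < \<xi> i \<omega>})"
        by (rule finite_measure_mono) auto
      also have "\<dots> \<le> (\<Sum>l. B (x + 0 + \<theta> * real l))"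
        by (rule prob_UN_le) (auto simp: B_xi intro: elim(2)[simplified])
      finally have 3: "prob ?E3 \<le> \<delta>" using elim(1) by linarith
      have [measurable]: "?E1 \<in> events" "?E2 \<in> events" "?E3 \<in> events"
        by measurable
      have "prob (poor \<epsilon> K \<theta> x j) \<le> prob ?E1 + prob ?E2 + prob ?E3"
        unfolding poor_def
        by (rule order_trans[OF measure_Un_le add_right_mono], measurable, rule measure_Un_le, measurable)
      then show "prob (poor \<epsilon> K \<theta> x j) \<le> 3 * \<delta>" using 1 2 3 by linarith
    qed
  qed
  then show ?thesis using K1 K2 by (intro exI[of _ K]) (simp add: K_def)
qed

text \<open>A jump above \<open>x + h + \<theta> * real j\<close>, with the rest not
  \<open>poor\<close>, lifts \<open>Z (Suc j)\<close> above \<open>x\<close>. These events are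
  disjoint, so their probabilities add, and by independence each is at least
  \<open>1 - 3 * \<epsilon>\<close> times that of its jump once \<open>x\<close> is large.\<close>

lemma lower_bound:
  assumes "c < d / (a - b)"
  shows "eventually (\<lambda>x. c < prob (exceed x) / N.G x) at_top"
proof -
  have "((\<lambda>\<epsilon>. (1 - 3 * \<epsilon>) * (d / (a - b + 2 * \<epsilon>))) \<longlongrightarrow> (1 - 3 * 0) * (d / (a - b + 2 * 0))) (at_right 0)"
    using a by (intro tendsto_intros) auto
  then have "eventually (\<lambda>\<epsilon>. c < (1 - 3 * \<epsilon>) * (d / (a - b + 2 * \<epsilon>))) (at_right 0)"
    by (rule order_tendstoD) (use assms in simp)
  moreover have "eventually (\<lambda>\<epsilon>. \<epsilon> \<in> {0<..<1}) (at_right (0::real))"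
    by (intro eventually_at_right_real) simp
  ultimately have "\<exists>\<epsilon>. c < (1 - 3 * \<epsilon>) * (d / (a - b + 2 * \<epsilon>)) \<and> \<epsilon> \<in> {0<..<1}"
    by (intro eventually_happens'[OF trivial_limit_at_right_real] eventually_conj)
  then obtain \<epsilon> where e: "0 < \<epsilon>" "c < (1 - 3 * \<epsilon>) * (d / (a - b + 2 * \<epsilon>))" by auto
  define \<theta> where "\<theta> = a - b + 2 * \<epsilon>"
  have \<theta>: "0 < \<theta>" using e a by (simp add: \<theta>_def)
  obtain K where K: "eventually (\<lambda>x. \<forall>j. prob (poor \<epsilon> K \<theta> x j) \<le> 3 * \<epsilon>) at_top"
    using poor_prob[OF e(1) e(1) \<theta>] by blast
  \<comment> \<open>With slope \<open>\<theta>\<close> the terms in \<open>j\<close> cancel, and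
    \<open>h\<close> absorbs two errors \<open>K\<close> and the one additional interarrival time
    \<open>a + \<epsilon>\<close>: the lower estimate for \<open>Z (Suc j)\<close> becomes exactly
    \<open>x\<close>.\<close>
  define h where "h = 2 * K + a + \<epsilon>"
  have "filterlim (\<lambda>x. x + h) at_top at_top"
    using filterlim_tendsto_add_at_top[OF tendsto_const[of h] filterlim_ident] by (simp add: add.commute)
  from eventually_compose_filterlim[OF K this]
  have K': "eventually (\<lambda>x. \<forall>j. prob (poor \<epsilon> K \<theta> (x + h) j) \<le> 3 * \<epsilon>) at_top" .
  let ?s = "\<lambda>x. \<Sum>l. B (x + h + \<theta> * real l)"
  have "((\<lambda>x. (1 - 3 * \<epsilon>) * (?s x / N.G x)) \<longlongrightarrow> (1 - 3 * \<epsilon>) * (d / \<theta>)) at_top"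
    by (intro tendsto_intros shifted_B \<theta>)
  then have "eventually (\<lambda>x. c < (1 - 3 * \<epsilon>) * (?s x / N.G x)) at_top"
    by (rule order_tendstoD) (use e(2) in \<open>simp add: \<theta>_def\<close>)
  then show ?thesis
    using K' shifted_B(2)[OF \<theta>, of h]
  proof eventually_elim
    case (elim x)
    \<comment> \<open>\<open>poor\<close> is taken at \<open>x + h\<close>, the level of the jumps,
      so that its last clause excludes exactly the jumps with smaller index.\<close>
    let ?E = "\<lambda>j. {\<omega>\<in>space M. x + h + \<theta> * real j < \<xi> j \<omega>} \<inter> (space M - poor \<epsilon> K \<theta> (x + h) j)"
    have E: "?E j \<in> events" for j by measurable
    have sub: "?E j \<subseteq> exceed x" for j
    proof
      fix \<omega> assume w: "\<omega> \<in> ?E j"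
      then have big: "x + h + \<theta> * real j < \<xi> j \<omega>" and sp: "\<omega> \<in> space M"
        and np: "\<omega> \<notin> poor \<epsilon> K \<theta> (x + h) j" by auto
      have g1: "(b - \<epsilon>) * real j - K \<le> S 0 j \<omega>"
        using np sp unfolding poor_def by (auto simp: not_less)
      have g2: "\<bar>(\<Sum>i<Suc j. t i \<omega>) - a * real (Suc j)\<bar> \<le> \<epsilon> * real (Suc j) + K"
        using np sp unfolding poor_def by (auto simp: not_less simp del: sum.lessThan_Suc of_nat_Suc)
      have g3: "(\<Sum>i<Suc j. t i \<omega>) \<le> (a + \<epsilon>) * real (Suc j) + K"
        using g2 by (simp add: distrib_right abs_le_iff del: sum.lessThan_Suc of_nat_Suc)
      have "Z (Suc j) \<omega> = S 0 j \<omega> + \<xi> j \<omega> - (\<Sum>i<Suc j. t i \<omega>)"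
        unfolding Z_split by (simp add: S_Suc)
      then have "(b - \<epsilon>) * real j - K + (x + h + \<theta> * real j) - ((a + \<epsilon>) * real (Suc j) + K) < Z (Suc j) \<omega>"
        using g1 g3 big by linarith
      moreover have "(b - \<epsilon>) * real j - K + (x + h + \<theta> * real j) - ((a + \<epsilon>) * real (Suc j) + K) = x"
        by (simp add: h_def \<theta>_def algebra_simps)
      ultimately have "x < Z (Suc j) \<omega>" by linarith
      then show "\<omega> \<in> exceed x" using sp by (auto simp: exceed_def)
    qed
    have disj: "disjoint_family ?E"
    proof -
      have False if "i < j" "\<omega> \<in> ?E i" "\<omega> \<in> ?E j" for i j :: nat and \<omega>
        using that unfolding poor_def by auto
      then show ?thesis
        unfolding disjoint_family_on_def by (metis (no_types, lifting) disjoint_iff nat_neq_iff)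
    qed
    have pE: "prob (?E j) = B (x + h + \<theta> * real j) * prob (space M - poor \<epsilon> K \<theta> (x + h) j)" for j
    proof -
      have "space (\<G> j) - poor \<epsilon> K \<theta> (x + h) j \<in> sets (\<G> j)" by (intro sets.compl_sets poor_\<G>)
      then show ?thesis by (simp only: indep_\<G> B_xi space_\<G>)
    qed
    have sE: "(\<lambda>j. prob (?E j)) sums prob (\<Union>j. ?E j)"
      by (rule finite_measure_UNION) (use E disj in auto)
    have "(1 - 3 * \<epsilon>) * ?s x = (\<Sum>j. (1 - 3 * \<epsilon>) * B (x + h + \<theta> * real j))"
      by (rule suminf_mult[OF elim(3), symmetric])
    also have "\<dots> \<le> (\<Sum>j. prob (?E j))"
    proof (rule suminf_le[OF _ summable_mult[OF elim(3)] sums_summable[OF sE]])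
      fix j
      have "1 - 3 * \<epsilon> \<le> prob (space M - poor \<epsilon> K \<theta> (x + h) j)"
        using elim(2) by (subst prob_compl) auto
      then show "(1 - 3 * \<epsilon>) * B (x + h + \<theta> * real j) \<le> prob (?E j)"
        unfolding pE by (subst mult.commute) (intro mult_left_mono B_nonneg)
    qed
    also have "\<dots> = prob (\<Union>j. ?E j)" by (rule sums_unique[OF sE, symmetric])
    also have "\<dots> \<le> prob (exceed x)"
      by (rule finite_measure_mono) (use sub in \<open>auto\<close>)
    finally have "(1 - 3 * \<epsilon>) * ?s x / N.G x \<le> prob (exceed x) / N.G x"
      by (intro divide_right_mono) auto
    then show ?case using elim(1) by simp
  qed
qed

theorem exceed_asymp: "((\<lambda>x. prob (exceed x) / N.G x) \<longlongrightarrow> d / (a - b)) at_top"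
  by (rule order_tendstoI) (auto intro: upper_bound lower_bound)

end

section \<open>The tandem queue\<close>

text \<open>A finite set of index pairs is enlarged to a rectangle by trivial conditions at the new
  pairs. On a rectangle the probability factors, along the first index by independence of the
  sequences and along the second by independence within each.\<close>

lemma (in prob_space) indep_vars_nested:
  fixes X :: "'j \<Rightarrow> 'i \<Rightarrow> 'a \<Rightarrow> real"
  assumes outer: "indep_vars (\<lambda>_. PiM UNIV (\<lambda>_. borel)) (\<lambda>j \<omega> n. X j n \<omega>) J"
    and inner: "\<And>j. j \<in> J \<Longrightarrow> indep_vars (\<lambda>_. borel) (X j) UNIV"
  shows "indep_vars (\<lambda>_. borel) (\<lambda>p. X (fst p) (snd p)) (J \<times> UNIV)"
  unfolding indep_vars_def2
proof (intro conjI ballI indep_setsI)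
  have rv: "random_variable borel (X j n)" if "j \<in> J" for j n
    using inner[OF that] by (auto simp: indep_vars_def)
  show "random_variable borel (X (fst p) (snd p))" if "p \<in> J \<times> UNIV" for p
    using that by (auto intro: rv)
  show "{X (fst p) (snd p) -` A \<inter> space M |A. A \<in> sets borel} \<subseteq> events" if "p \<in> J \<times> UNIV" for p
    using that by (auto intro!: measurable_sets[OF rv])
  fix A K assume K: "K \<noteq> {}" "K \<subseteq> J \<times> UNIV" "finite K"
    and A: "\<forall>p\<in>K. A p \<in> {X (fst p) (snd p) -` A \<inter> space M |A. A \<in> sets borel}"
  have "\<forall>p\<in>K. \<exists>B. A p = X (fst p) (snd p) -` B \<inter> space M \<and> B \<in> sets borel"
    using A by blast
  from bchoice[OF this] obtain B0 where B0':
    "\<forall>p\<in>K. A p = X (fst p) (snd p) -` B0 p \<inter> space M \<and> B0 p \<in> sets borel" ..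
  have B0: "A p = X (fst p) (snd p) -` B0 p \<inter> space M" "B0 p \<in> sets borel" if "p \<in> K" for p
    using B0' that by auto
  define B where "B p = (if p \<in> K then B0 p else UNIV)" for p
  have B[measurable]: "B p \<in> sets borel" for p using B0 by (auto simp: B_def)
  define K1 where "K1 = fst ` K"
  define K2 where "K2 = snd ` K"
  have fin: "finite K1" "finite K2" "K1 \<noteq> {}" "K2 \<noteq> {}" "K1 \<subseteq> J" "K \<subseteq> K1 \<times> K2"
    using K by (auto simp: K1_def K2_def image_iff intro: rev_image_eqI)
  let ?P = "PiM UNIV (\<lambda>_::'i. borel :: real measure)"
  define C where "C j = {f \<in> space ?P. \<forall>n\<in>K2. f n \<in> B (j, n)}" for j
  have C: "C j \<in> sets ?P" for j
    unfolding C_def by (intro sets.sets_Collect_finite_All' fin) measurable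
  have inter: "(\<Inter>p\<in>K. A p) = (\<Inter>j\<in>K1. (\<lambda>\<omega> n. X j n \<omega>) -` C j \<inter> space M)"
  proof (intro equalityI subsetI)
    fix \<omega> assume w: "\<omega> \<in> (\<Inter>p\<in>K. A p)"
    obtain p where "p \<in> K" using K(1) by blast
    then have sp: "\<omega> \<in> space M" using w B0(1) by blast
    have "X j n \<omega> \<in> B (j, n)" for j n
      using w B0[of "(j, n)"] by (auto simp: B_def)
    then show "\<omega> \<in> (\<Inter>j\<in>K1. (\<lambda>\<omega> n. X j n \<omega>) -` C j \<inter> space M)"
      using sp by (auto simp: C_def space_PiM)
  next
    fix \<omega> assume w: "\<omega> \<in> (\<Inter>j\<in>K1. (\<lambda>\<omega> n. X j n \<omega>) -` C j \<inter> space M)"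
    show "\<omega> \<in> (\<Inter>p\<in>K. A p)"
    proof
      fix p assume p: "p \<in> K"
      then have "fst p \<in> K1" "snd p \<in> K2" by (auto simp: K1_def K2_def)
      then have "\<omega> \<in> (\<lambda>\<omega> n. X (fst p) n \<omega>) -` C (fst p) \<inter> space M" using w by blast
      then have "X (fst p) (snd p) \<omega> \<in> B p" "\<omega> \<in> space M"
        using \<open>snd p \<in> K2\<close> by (auto simp: C_def)
      then show "\<omega> \<in> A p" using B0[OF p] p by (simp add: B_def)
    qed
  qed
  let ?q = "\<lambda>p. prob (X (fst p) (snd p) -` B p \<inter> space M)"
  have "prob (\<Inter>p\<in>K. A p) = (\<Prod>j\<in>K1. prob ((\<lambda>\<omega> n. X j n \<omega>) -` C j \<inter> space M))"
    unfolding inter by (rule indep_varsD[OF outer]) (use fin C in auto)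
  also have "\<dots> = (\<Prod>j\<in>K1. \<Prod>n\<in>K2. ?q (j, n))"
  proof (intro prod.cong refl)
    fix j assume "j \<in> K1"
    then have "j \<in> J" using fin by blast
    have "(\<lambda>\<omega> n. X j n \<omega>) -` C j \<inter> space M = (\<Inter>n\<in>K2. X j n -` B (j, n) \<inter> space M)"
      using fin by (auto simp: C_def space_PiM)
    also have "prob \<dots> = (\<Prod>n\<in>K2. prob (X j n -` B (j, n) \<inter> space M))"
      by (rule indep_varsD[OF inner[OF \<open>j \<in> J\<close>]]) (use fin B in auto)
    finally show "prob ((\<lambda>\<omega> n. X j n \<omega>) -` C j \<inter> space M) = (\<Prod>n\<in>K2. ?q (j, n))" by simp
  qed
  also have "\<dots> = (\<Prod>p\<in>K1 \<times> K2. ?q p)"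
    by (simp add: prod.cartesian_product case_prod_beta)
  also have "\<dots> = (\<Prod>p\<in>K. ?q p)"
    using fin by (intro prod.mono_neutral_right) (auto simp: B_def prob_space)
  also have "\<dots> = (\<Prod>p\<in>K. prob (A p))"
    by (intro prod.cong refl) (simp add: B0 B_def)
  finally show "prob (\<Inter>p\<in>K. A p) = (\<Prod>p\<in>K. prob (A p))" .
qed

lemma (in prob_space) distr_diff_indep:
  fixes U V :: "'a \<Rightarrow> real"
  assumes "indep_var borel U borel V"
  shows "distr M borel (\<lambda>\<omega>. U \<omega> - V \<omega>) = distr (distr M borel U \<Otimes>\<^sub>M distr M borel V) borel (\<lambda>p. fst p - snd p)"
proof -
  have [measurable]: "random_variable borel U" "random_variable borel V"
    by (rule indep_var_rv1[OF assms], rule indep_var_rv2[OF assms])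
  have "distr M borel (\<lambda>\<omega>. U \<omega> - V \<omega>) = distr (distr M (borel \<Otimes>\<^sub>M borel) (\<lambda>\<omega>. (U \<omega>, V \<omega>))) borel (\<lambda>p. fst p - snd p)"
    by (subst distr_distr) (auto simp: comp_def)
  then show ?thesis
    using assms unfolding indep_var_distribution_eq by simp
qed

text \<open>The steps use disjoint pairs \<open>{P n, Q n}\<close> of an independent family, and
  their laws are images of one and the same product law.\<close>

lemma (in prob_space) iid_walk_diff:
  fixes Y :: "'i \<Rightarrow> 'a \<Rightarrow> real"
  assumes Y: "indep_vars (\<lambda>_. borel) Y I"
    and PQ: "inj P" "inj Q" "range P \<subseteq> I" "range Q \<subseteq> I" "range P \<inter> range Q = {}"
    and P: "\<And>n. distr M borel (Y (P n)) = distr M borel (Y (P 0))" "integrable M (Y (P 0))"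
    and Q: "\<And>n. distr M borel (Y (Q n)) = distr M borel (Y (Q 0))" "integrable M (Y (Q 0))"
  shows "iid_walk M (\<lambda>n \<omega>. Y (P n) \<omega> - Y (Q n) \<omega>)"
proof -
  have ne: "P m \<noteq> Q n" "Q n \<noteq> P m" for m n using PQ(5) by blast+
  have 1: "indep_vars (\<lambda>_. borel) (\<lambda>n \<omega>. Y (P n) \<omega> - Y (Q n) \<omega>) UNIV"
  proof (rule indep_vars_group[OF Y, where K = "\<lambda>n. {P n, Q n}" and g = "\<lambda>n h. h (P n) - h (Q n)"])
    show "{P n, Q n} \<subseteq> I" for n using PQ by auto
    show "disjoint_family_on (\<lambda>n. {P n, Q n}) UNIV"
      using PQ(1,2) ne by (auto simp: disjoint_family_on_def inj_def)
    show "(\<lambda>h. h (P n) - h (Q n)) \<in> borel_measurable (PiM {P n, Q n} (\<lambda>_. borel :: real measure))" for n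
      by (intro borel_measurable_diff measurable_component_singleton) auto
  qed simp
  have ind: "indep_var borel (Y (P n)) borel (Y (Q n))" for n
  proof -
    have "indep_var (PiM {P n} (\<lambda>_. borel)) (\<lambda>\<omega>. restrict (\<lambda>i. Y i \<omega>) {P n})
        (PiM {Q n} (\<lambda>_. borel)) (\<lambda>\<omega>. restrict (\<lambda>i. Y i \<omega>) {Q n})"
      by (rule indep_var_restrict[OF Y]) (use PQ ne in auto)
    from indep_var_compose[OF this, of "\<lambda>h. h (P n)" borel "\<lambda>h. h (Q n)" borel]
    show ?thesis by (simp add: comp_def)
  qed
  have 2: "distr M borel (\<lambda>\<omega>. Y (P n) \<omega> - Y (Q n) \<omega>) = distr M borel (\<lambda>\<omega>. Y (P 0) \<omega> - Y (Q 0) \<omega>)" for n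
    unfolding distr_diff_indep[OF ind] P(1)[of n] Q(1)[of n] ..
  have 3: "integrable M (\<lambda>\<omega>. Y (P 0) \<omega> - Y (Q 0) \<omega>)"
    using P(2) Q(2) by (rule Bochner_Integration.integrable_diff)
  show ?thesis
    by (rule iid_walk.intro[OF prob_space_axioms iid_walk_axioms.intro[OF 1 2 3]])
qed

lemma (in prob_space) iid_nonneg_mean_walk:
  assumes X: "iid_nonneg_mean X \<mu>" and f: "inj f"
  shows "iid_walk M (\<lambda>n. X (f n))"
proof -
  have id: "distr M borel (X n) = distr M borel (X 0)" for n
    using X unfolding iid_nonneg_mean_def iid_def by blast
  have "indep_vars (\<lambda>_. borel) (\<lambda>n. X (f n)) UNIV"
    by (rule indep_vars_reindex_inj[of borel X UNIV]) (use X f in \<open>auto simp: iid_nonneg_mean_def iid_def\<close>)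
  moreover have "distr M borel (X (f n)) = distr M borel (X (f 0))" for n
    unfolding id[of "f n"] id[of "f 0"] ..
  moreover have "integrable M (X (f 0))"
    using X by (auto simp: iid_nonneg_mean_def)
  ultimately show ?thesis
    by (rule iid_walk.intro[OF prob_space_axioms iid_walk_axioms.intro])
qed

section \<open>Lindley recursion for stationary waiting times\<close>

lemma sum_shift_down: "(\<Sum>i=1..k. f (n - int i)) = (\<Sum>i<k. f (n - 1 - int i))"
  by (induction k) (simp_all add: algebra_simps)

lemma stationary_wait_real:
  "stationary_wait (\<lambda>i. ereal (s i)) (\<lambda>i. ereal (t i)) n = (SUP k. ereal (\<Sum>i<k. s (n - 1 - int i) - t (n - 1 - int i)))"
  unfolding stationary_wait_def sum_shift_down[of "\<lambda>i. ereal (s i) - ereal (t i)"] by simp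

lemma stationary_wait_nonneg: "0 \<le> stationary_wait s t n"
  unfolding stationary_wait_def by (rule SUP_upper2[of 0]) auto

text \<open>The partial sums for \<open>n + 1\<close> are the empty one and those for
  \<open>n\<close> with the newest term in front. Adding a real number commutes with a nonempty
  supremum in the extended reals too, so the waiting time may be infinite here.\<close>

lemma lindley:
  "stationary_wait (\<lambda>i. ereal (s i)) (\<lambda>i. ereal (t i)) (n + 1)
    = max 0 (ereal (s n - t n) + stationary_wait (\<lambda>i. ereal (s i)) (\<lambda>i. ereal (t i)) n)"
proof -
  let ?f = "\<lambda>n k. ereal (\<Sum>i<k. s (n - 1 - int i) - t (n - 1 - int i))"
  have Suc: "?f (n + 1) (Suc k) = ereal (s n - t n) + ?f n k" for k
    unfolding sum.lessThan_Suc_shift by (simp add: algebra_simps)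
  have U: "(UNIV :: nat set) = insert 0 (range Suc)" by (auto simp: image_iff) (metis not0_implies_Suc)
  have "(SUP k. ?f (n + 1) k) = sup (?f (n + 1) 0) (SUP k. ?f (n + 1) (Suc k))"
    by (subst U) (simp add: image_image)
  also have "(SUP k. ?f (n + 1) (Suc k)) = ereal (s n - t n) + (SUP k. ?f n k)"
    unfolding Suc by (rule SUP_ereal_add_right) auto
  finally show ?thesis unfolding stationary_wait_real by (simp add: sup_max zero_ereal_def)
qed

section \<open>The queue as an instance of the abstract second station\<close>

context tandem_queue
begin

definition field :: "nat \<times> int \<Rightarrow> 'a \<Rightarrow> real" where
  "field p = ([interarrival T, \<sigma>1, \<sigma>2] ! fst p) (snd p)"

abbreviation "I \<equiv> {..<3::nat} \<times> (UNIV :: int set)"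

lemma field_apply [simp]:
  "field (0, n) = interarrival T n" "field (Suc 0, n) = \<sigma>1 n" "field (2, n) = \<sigma>2 n"
  by (simp_all add: field_def)

lemma field_indep: "indep_vars (\<lambda>_. borel) field I"
  unfolding field_def
proof (rule indep_vars_nested[OF sequences_indep])
  fix j :: nat assume "j \<in> {..<3}"
  then have "j = 0 \<or> j = 1 \<or> j = 2" by auto
  then show "indep_vars (\<lambda>_. borel) ([interarrival T, \<sigma>1, \<sigma>2] ! j) UNIV"
    using interarrival_iid service1_iid service2_iid by (auto simp: iid_nonneg_mean_def iid_def)
qed

lemma iidD:
  assumes "iid_nonneg_mean X \<mu>"
  shows "distr M borel (X n) = distr M borel (X 0)" "AE \<omega> in M. 0 \<le> X n \<omega>"
    "integrable M (X n)" "expectation (X n) = \<mu>" "random_variable borel (X n)"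
  using assms unfolding iid_nonneg_mean_def iid_def by auto

text \<open>Customers are counted backwards. The gap \<open>t l\<close> between customers
  \<open>- 1 - l\<close> and \<open>- l\<close> at the second station contains the first service of
  the later one, so \<open>s l\<close> has index \<open>- l\<close>; \<open>r l\<close> and
  \<open>u l\<close> belong to customer \<open>- 1 - l\<close> and form the walk of the first
  station.\<close>

abbreviation "\<xi> l \<equiv> \<sigma>2 (- 1 - int l)"
abbreviation "s l \<equiv> \<sigma>1 (- int l)"
abbreviation "u l \<equiv> interarrival T (- 1 - int l)"
abbreviation "r l \<equiv> \<sigma>1 (- 1 - int l)"

definition t :: "nat \<Rightarrow> 'a \<Rightarrow> real" where
  "t l \<omega> = real_of_ereal (interarrival2 T \<sigma>1 (- 1 - int l) \<omega>)"

lemma xi_walk: "iid_walk M (\<lambda>l. \<xi> l)"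
  by (rule iid_nonneg_mean_walk[OF service2_iid]) (auto simp: inj_def)

lemma s_walk: "iid_walk M (\<lambda>l. s l)"
  by (rule iid_nonneg_mean_walk[OF service1_iid]) (auto simp: inj_def)

lemma u_walk: "iid_walk M (\<lambda>l. u l)"
  by (rule iid_nonneg_mean_walk[OF interarrival_iid]) (auto simp: inj_def)

lemma diff_walk: "iid_walk M (\<lambda>l \<omega>. \<xi> l \<omega> - s l \<omega>)"
proof -
  have "iid_walk M (\<lambda>l \<omega>. field (2, - 1 - int l) \<omega> - field (Suc 0, - int l) \<omega>)"
    by (rule iid_walk_diff[OF field_indep])
       (auto simp: inj_def intro: iidD(3)[OF service2_iid] iidD(3)[OF service1_iid]
          trans[OF iidD(1)[OF service2_iid] iidD(1)[OF service2_iid, symmetric]]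
          trans[OF iidD(1)[OF service1_iid] iidD(1)[OF service1_iid, symmetric]])
  then show ?thesis by simp
qed

lemma station1_walk: "iid_walk M (\<lambda>l \<omega>. r l \<omega> - u l \<omega>)"
proof -
  have "iid_walk M (\<lambda>l \<omega>. field (Suc 0, - 1 - int l) \<omega> - field (0, - 1 - int l) \<omega>)"
    by (rule iid_walk_diff[OF field_indep])
       (auto simp: inj_def intro: iidD(3)[OF interarrival_iid] iidD(3)[OF service1_iid]
          trans[OF iidD(1)[OF interarrival_iid] iidD(1)[OF interarrival_iid, symmetric]]
          trans[OF iidD(1)[OF service1_iid] iidD(1)[OF service1_iid, symmetric]])
  then show ?thesis by simp
qed

lemma wait1_nonneg: "0 \<le> wait1 T \<sigma>1 n \<omega>"
  unfolding wait1_def by (rule stationary_wait_nonneg)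

lemma interarrival2_real:
  "\<exists>y\<le>0. interarrival2 T \<sigma>1 n \<omega> = ereal (- y + \<sigma>1 (n + 1) \<omega>) \<and>
     ereal y = min 0 (wait1 T \<sigma>1 n \<omega> + \<sigma>1 n \<omega> - interarrival T n \<omega>)"
proof (cases "wait1 T \<sigma>1 n \<omega>")
  case (real w)
  show ?thesis
    by (rule exI[of _ "min 0 (w + \<sigma>1 n \<omega> - interarrival T n \<omega>)"])
       (simp add: interarrival2_def real zero_ereal_def del: ereal_min add: ereal_min[symmetric])
next
  case PInf
  then show ?thesis by (intro exI[of _ 0]) (simp add: interarrival2_def zero_ereal_def[symmetric])
next
  case MInf
  then show ?thesis using wait1_nonneg[of n \<omega>] by simp
qed

lemma interarrival2_t: "interarrival2 T \<sigma>1 (- 1 - int l) \<omega> = ereal (t l \<omega>)"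
  using interarrival2_real[of "- 1 - int l" \<omega>] unfolding t_def by auto

lemma s_le_t: "s l \<omega> \<le> t l \<omega>"
  using interarrival2_real[of "- 1 - int l" \<omega>] unfolding t_def by auto

lemma wait2_exceeds: "ereal x < wait2 T \<sigma>1 \<sigma>2 0 \<omega> \<longleftrightarrow> (\<exists>k. x < (\<Sum>i<k. \<xi> i \<omega> - t i \<omega>))"
proof -
  have "wait2 T \<sigma>1 \<sigma>2 0 \<omega> = (SUP k. ereal (\<Sum>i<k. \<xi> i \<omega> - t i \<omega>))"
    unfolding wait2_def stationary_wait_def
      sum_shift_down[of "\<lambda>i. ereal (\<sigma>2 i \<omega>) - interarrival2 T \<sigma>1 i \<omega>"]
    by (simp add: interarrival2_t)
  then show ?thesis by (simp add: less_SUP_iff)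
qed

text \<open>\<open>A l\<close> is the sojourn time of customer \<open>- l\<close> at the first
  station. Departure is arrival plus sojourn, so gaps between departures are gaps between arrivals
  plus differences of sojourn times. In the recursion, \<open>A l\<close> contains
  \<open>max 0 y\<close> and \<open>t l\<close> contains \<open>- min 0 y\<close>, and the two are
  linked by \<open>y = max 0 y + min 0 y\<close>.\<close>

lemma sojourn_telescope:
  assumes fin: "\<And>l. wait1 T \<sigma>1 (- int l) \<omega> \<noteq> \<infinity>"
  defines "A \<equiv> \<lambda>l. real_of_ereal (wait1 T \<sigma>1 (- int l) \<omega>) + s l \<omega>"
  shows "(\<Sum>i<l. t i \<omega>) = A 0 - A l + (\<Sum>i<l. u i \<omega>)"
proof (induction l)
  case (Suc l)
  obtain w where w: "wait1 T \<sigma>1 (- int (Suc l)) \<omega> = ereal w"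
    using fin[of "Suc l"] wait1_nonneg[of "- int (Suc l)" \<omega>] by (cases "wait1 T \<sigma>1 (- int (Suc l)) \<omega>") auto
  define y where "y = w + \<sigma>1 (- int (Suc l)) \<omega> - interarrival T (- int (Suc l)) \<omega>"
  have eq: "- int (Suc l) + 1 = - int l" "- 1 - int l = - int (Suc l)" by simp_all
  have "wait1 T \<sigma>1 (- int l) \<omega> = max 0 (ereal y)"
    using lindley[of "\<lambda>i. \<sigma>1 i \<omega>" "\<lambda>i. interarrival T i \<omega>" "- int (Suc l)"] w
    unfolding wait1_def[symmetric] eq by (simp add: y_def algebra_simps)
  then have A: "A l = max 0 y + s l \<omega>" "A (Suc l) = w + \<sigma>1 (- int (Suc l)) \<omega>"
    by (auto simp: A_def w max_def zero_ereal_def simp del: of_nat_Suc)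
  obtain z where z: "t l \<omega> = - z + s l \<omega>" "ereal z = min 0 (ereal y)"
    using interarrival2_real[of "- int (Suc l)" \<omega>] interarrival2_t[of l \<omega>]
    unfolding eq w y_def by auto
  have "z = min 0 y" using z(2) by (simp add: zero_ereal_def flip: ereal_min)
  then have "t l \<omega> = A l - A (Suc l) + u l \<omega>"
    using z(1) unfolding A eq y_def by (simp add: min_def max_def)
  then show ?case using Suc by simp
qed simp

lemma interarrival2_measurable:
  assumes [measurable]: "\<And>n. \<sigma>1 n \<in> borel_measurable N" "\<And>n. interarrival T n \<in> borel_measurable N"
  shows "interarrival2 T \<sigma>1 n \<in> borel_measurable N"
  unfolding interarrival2_def[abs_def] wait1_def stationary_wait_def by measurable

lemma t_measurable:
  assumes "\<And>n. \<sigma>1 n \<in> borel_measurable N" "\<And>n. interarrival T n \<in> borel_measurable N"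
  shows "t l \<in> borel_measurable N"
  using interarrival2_measurable[OF assms] unfolding t_def[abs_def] by measurable

definition \<G> :: "nat \<Rightarrow> 'a measure" where
  "\<G> l = vimage_algebra (space M) (\<lambda>\<omega>. restrict (\<lambda>p. field p \<omega>) (I - {(2, - 1 - int l)}))
     (PiM (I - {(2, - 1 - int l)}) (\<lambda>_. borel))"

lemma field_\<G>: "p \<in> I \<Longrightarrow> p \<noteq> (2, - 1 - int l) \<Longrightarrow> field p \<in> borel_measurable (\<G> l)"
proof -
  assume p: "p \<in> I" "p \<noteq> (2, - 1 - int l)"
  let ?K = "I - {(2, - 1 - int l)}"
  have "(\<lambda>\<omega>. restrict (\<lambda>p. field p \<omega>) ?K) \<in> measurable (\<G> l) (PiM ?K (\<lambda>_. borel))"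
    unfolding \<G>_def by (rule measurable_vimage_algebra1) (auto simp: space_PiM)
  from measurable_compose[OF this measurable_component_singleton[of p]] p
  show ?thesis by simp
qed

lemma sigma1_\<G>: "\<sigma>1 n \<in> borel_measurable (\<G> l)"
  and interarrival_\<G>: "interarrival T n \<in> borel_measurable (\<G> l)"
  using field_\<G>[of "(Suc 0, n)" l] field_\<G>[of "(0, n)" l] by simp_all

lemma field_restrict_measurable:
  "K \<subseteq> I \<Longrightarrow> (\<lambda>\<omega>. restrict (\<lambda>p. field p \<omega>) K) \<in> measurable M (PiM K (\<lambda>_. borel))"
  using field_indep by (intro measurable_restrict) (auto simp: indep_vars_def)

lemma sets_\<G>: "sets (\<G> l) = {(\<lambda>\<omega>. restrict (\<lambda>p. field p \<omega>) (I - {(2, - 1 - int l)})) -` A \<inter> space M | A.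
     A \<in> sets (PiM (I - {(2, - 1 - int l)}) (\<lambda>_. borel))}"
  unfolding \<G>_def by (rule sets_vimage_algebra2) (auto simp: space_PiM)

lemma sets_\<G>_events: "sets (\<G> l) \<subseteq> events"
  unfolding sets_\<G> by (auto intro!: measurable_sets[OF field_restrict_measurable])

lemma indep_\<G>:
  assumes "A \<in> sets (\<G> l)"
  shows "prob ({\<omega>\<in>space M. y < \<xi> l \<omega>} \<inter> A) = prob {\<omega>\<in>space M. y < \<xi> l \<omega>} * prob A"
proof -
  let ?p = "(2, - 1 - int l) :: nat \<times> int"
  let ?X = "\<lambda>\<omega>. restrict (\<lambda>p. field p \<omega>) {?p}" and ?Y = "\<lambda>\<omega>. restrict (\<lambda>p. field p \<omega>) (I - {?p})"
  obtain C where C: "C \<in> sets (PiM (I - {?p}) (\<lambda>_. borel))" "A = ?Y -` C \<inter> space M"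
    using assms unfolding sets_\<G> by blast
  let ?B = "{h \<in> space (PiM {?p} (\<lambda>_. borel :: real measure)). y < h ?p}"
  have B: "?B \<in> sets (PiM {?p} (\<lambda>_. borel))" by measurable
  have ind: "indep_var (PiM {?p} (\<lambda>_. borel)) ?X (PiM (I - {?p}) (\<lambda>_. borel)) ?Y"
    by (rule indep_var_restrict[OF field_indep]) auto
  have "prob ((\<lambda>\<omega>. (?X \<omega>, ?Y \<omega>)) -` (?B \<times> C) \<inter> space M) = prob (?X -` ?B \<inter> space M) * prob (?Y -` C \<inter> space M)"
    by (rule indep_varD[OF ind B C(1)])
  moreover have "(\<lambda>\<omega>. (?X \<omega>, ?Y \<omega>)) -` (?B \<times> C) \<inter> space M = {\<omega>\<in>space M. y < \<xi> l \<omega>} \<inter> A"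
    by (auto simp: C(2) space_PiM)
  moreover have "?X -` ?B \<inter> space M = {\<omega>\<in>space M. y < \<xi> l \<omega>}"
    by (auto simp: space_PiM)
  ultimately show ?thesis by (simp add: C(2))
qed

text \<open>
  By stationarity the sojourn times \<open>A l\<close> at the first station are bounded in probability, and
  the interarrival times at the second station differ from those at the first by \<open>A l - A (l + 1)\<close>.
\<close>
lemma t_law:
  assumes "b1 < a" "0 < \<epsilon>" "0 < \<delta>"
  shows "\<exists>K\<ge>0. \<forall>l. prob {\<omega>\<in>space M. \<epsilon> * real l + K < \<bar>(\<Sum>i<l. t i \<omega>) - a * real l\<bar>} \<le> \<delta>"
proof -
  interpret U: iid_walk M "\<lambda>l. u l" by (rule u_walk)
  interpret Sv: iid_walk M "\<lambda>l. s l" by (rule s_walk)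
  interpret V: iid_walk M "\<lambda>l \<omega>. r l \<omega> - u l \<omega>" by (rule station1_walk)
  note int_iid = iidD[OF interarrival_iid] and s1_iid = iidD[OF service1_iid]
  note [measurable] = int_iid(5) s1_iid(5)
  note [measurable] = t_measurable[OF s1_iid(5) int_iid(5)]
  \<comment> \<open>Six exceptional events: two for the sum of the interarrival times, and the
    waiting and service times of customers \<open>0\<close> and \<open>- l\<close>.\<close>
  have d: "0 < \<delta> / 6" using assms by simp
  have "expectation (u 0) < a + \<epsilon>" "a - \<epsilon> < expectation (u 0)" using int_iid(4) assms by simp_all
  with d obtain K1 K2 where
    K1: "0 \<le> K1" "prob {\<omega>\<in>space M. \<exists>k. K1 + (a + \<epsilon>) * real k < U.S 0 k \<omega>} < \<delta> / 6" and
    K2: "0 \<le> K2" "prob {\<omega>\<in>space M. \<exists>k. U.S 0 k \<omega> < (a - \<epsilon>) * real k - K2} < \<delta> / 6"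
    using U.drift_above[of "a + \<epsilon>" "\<delta> / 6"] U.drift_below[of "a - \<epsilon>" "\<delta> / 6"] by blast
  have Vneg: "expectation (\<lambda>\<omega>. r 0 \<omega> - u 0 \<omega>) < 0"
    using assms by (simp add: int_iid s1_iid)
  obtain K3 where K3: "0 \<le> K3" "\<And>l. prob {\<omega>\<in>space M. \<exists>k. K3 + 0 * real k < V.S l k \<omega>} < \<delta> / 6"
    using V.drift_above[OF Vneg d] by blast
  have "expectation (s 0) < \<bar>b1\<bar> + 1" using s1_iid(4)[of "- int 0"] by linarith
  then obtain K4 where K4: "0 \<le> K4" "\<And>l. prob {\<omega>\<in>space M. \<exists>k. K4 + (\<bar>b1\<bar> + 1) * real k < Sv.S l k \<omega>} < \<delta> / 6"
    using Sv.drift_above[OF _ d] by blast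
  \<comment> \<open>A single service is a walk of length one, so the drift bound at
    \<open>k = 1\<close> gives a tail bound uniform in \<open>l\<close>.\<close>
  define K5 where "K5 = K4 + \<bar>b1\<bar> + 1"
  have s_tail: "prob {\<omega>\<in>space M. K5 < s l \<omega>} \<le> \<delta> / 6" for l
  proof -
    have "prob {\<omega>\<in>space M. K5 < s l \<omega>} \<le> prob {\<omega>\<in>space M. \<exists>k. K4 + (\<bar>b1\<bar> + 1) * real k < Sv.S l k \<omega>}"
    proof (rule finite_measure_mono)
      show "{\<omega>\<in>space M. K5 < s l \<omega>} \<subseteq> {\<omega>\<in>space M. \<exists>k. K4 + (\<bar>b1\<bar> + 1) * real k < Sv.S l k \<omega>}"
        by (auto simp: K5_def Sv.S_def intro!: exI[of _ "Suc 0"])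
    qed measurable
    then show ?thesis using K4(2)[of l] by linarith
  qed
  have wait_V: "wait1 T \<sigma>1 (- int l) \<omega> = (SUP k. ereal (V.S l k \<omega>))" for l \<omega>
  proof -
    have "- int l - 1 - int i = - 1 - int (l + i)" for i by simp
    then show ?thesis unfolding wait1_def stationary_wait_real V.S_def by (simp only:)
  qed
  have wait_tail: "prob {\<omega>\<in>space M. ereal K3 < wait1 T \<sigma>1 (- int l) \<omega>} \<le> \<delta> / 6" for l
    using K3(2)[of l] by (simp add: wait_V less_SUP_iff)
  \<comment> \<open>The telescoping identity uses \<open>real_of_ereal\<close>, which would turn an
    infinite waiting time into \<open>0\<close>.\<close>
  have finite_wait: "AE \<omega> in M. \<forall>l. wait1 T \<sigma>1 (- int l) \<omega> \<noteq> \<infinity>"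
    unfolding AE_all_countable
  proof
    fix l
    have [measurable]: "wait1 T \<sigma>1 (- int l) \<in> borel_measurable M"
      unfolding wait_V by measurable
    have "prob {\<omega>\<in>space M. wait1 T \<sigma>1 (- int l) \<omega> = \<infinity>} \<le> e" if "0 < e" for e
    proof -
      obtain K where "prob {\<omega>\<in>space M. \<exists>k. K + 0 * real k < V.S l k \<omega>} < e"
        using V.drift_above[OF Vneg \<open>0 < e\<close>] by blast
      moreover have "prob {\<omega>\<in>space M. wait1 T \<sigma>1 (- int l) \<omega> = \<infinity>} \<le> prob {\<omega>\<in>space M. \<exists>k. K + 0 * real k < V.S l k \<omega>}"
      proof (rule finite_measure_mono)
        show "{\<omega>\<in>space M. wait1 T \<sigma>1 (- int l) \<omega> = \<infinity>} \<subseteq> {\<omega>\<in>space M. \<exists>k. K + 0 * real k < V.S l k \<omega>}"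
        proof safe
          fix \<omega> assume "wait1 T \<sigma>1 (- int l) \<omega> = \<infinity>"
          then have "ereal K < wait1 T \<sigma>1 (- int l) \<omega>" by simp
          then show "\<exists>k. K + 0 * real k < V.S l k \<omega>" by (simp add: wait_V less_SUP_iff)
        qed
      qed measurable
      ultimately show ?thesis by linarith
    qed
    then have "prob {\<omega>\<in>space M. wait1 T \<sigma>1 (- int l) \<omega> = \<infinity>} \<le> 0"
      by (rule field_le_epsilon[of _ 0, simplified])
    then have "prob {\<omega>\<in>space M. wait1 T \<sigma>1 (- int l) \<omega> = \<infinity>} = 0"
      by (simp add: antisym)
    then show "AE \<omega> in M. wait1 T \<sigma>1 (- int l) \<omega> \<noteq> \<infinity>"
      by (subst (asm) prob_eq_0) auto
  qed
  have s_AE: "AE \<omega> in M. \<forall>l. 0 \<le> s l \<omega>"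
    unfolding AE_all_countable using s1_iid(2) by blast
  have [measurable]: "wait1 T \<sigma>1 (- int l) \<in> borel_measurable M" for l
    unfolding wait_V by measurable
  define K where "K = K1 + K2 + K3 + K5"
  show ?thesis
  proof (intro exI[of _ K] conjI allI)
    show "0 \<le> K" using K1 K2 K3 K4 by (simp add: K_def K5_def)
    fix l
    let ?E1 = "{\<omega>\<in>space M. \<exists>k. K1 + (a + \<epsilon>) * real k < U.S 0 k \<omega>}"
    let ?E2 = "{\<omega>\<in>space M. \<exists>k. U.S 0 k \<omega> < (a - \<epsilon>) * real k - K2}"
    let ?W = "\<lambda>l. {\<omega>\<in>space M. ereal K3 < wait1 T \<sigma>1 (- int l) \<omega>}"
    let ?Sv = "\<lambda>l. {\<omega>\<in>space M. K5 < s l \<omega>}"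
    have "prob {\<omega>\<in>space M. \<epsilon> * real l + K < \<bar>(\<Sum>i<l. t i \<omega>) - a * real l\<bar>}
        \<le> prob (?E1 \<union> (?E2 \<union> (?W 0 \<union> (?W l \<union> (?Sv 0 \<union> ?Sv l)))))"
    proof (rule finite_measure_mono_AE)
      show "AE \<omega> in M. \<omega> \<in> {\<omega>\<in>space M. \<epsilon> * real l + K < \<bar>(\<Sum>i<l. t i \<omega>) - a * real l\<bar>} \<longrightarrow>
          \<omega> \<in> ?E1 \<union> (?E2 \<union> (?W 0 \<union> (?W l \<union> (?Sv 0 \<union> ?Sv l))))"
        using finite_wait s_AE
      proof eventually_elim
        case (elim \<omega>)
        show ?case
        proof (intro impI, rule ccontr)
          assume big: "\<omega> \<in> {\<omega>\<in>space M. \<epsilon> * real l + K < \<bar>(\<Sum>i<l. t i \<omega>) - a * real l\<bar>}"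
            and no: "\<omega> \<notin> ?E1 \<union> (?E2 \<union> (?W 0 \<union> (?W l \<union> (?Sv 0 \<union> ?Sv l))))"
          have sp: "\<omega> \<in> space M" using big by simp
          have US: "U.S 0 l \<omega> = (\<Sum>i<l. u i \<omega>)" by (simp add: U.S_def)
          have u1: "(\<Sum>i<l. u i \<omega>) \<le> K1 + (a + \<epsilon>) * real l" "(a - \<epsilon>) * real l - K2 \<le> (\<Sum>i<l. u i \<omega>)"
            using no sp unfolding US[symmetric] by (auto simp: not_less)
          define A where "A l = real_of_ereal (wait1 T \<sigma>1 (- int l) \<omega>) + s l \<omega>" for l
          have A: "0 \<le> A i \<and> A i \<le> K3 + K5" if "i = 0 \<or> i = l" for i
          proof -
            have "\<not> ereal K3 < wait1 T \<sigma>1 (- int i) \<omega>" "\<not> K5 < s i \<omega>" using no sp that by auto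
            moreover have "wait1 T \<sigma>1 (- int i) \<omega> \<noteq> \<infinity>" "0 \<le> s i \<omega>" "0 \<le> wait1 T \<sigma>1 (- int i) \<omega>"
              using elim wait1_nonneg by auto
            ultimately show ?thesis
              unfolding A_def by (cases "wait1 T \<sigma>1 (- int i) \<omega>") auto
          qed
          have "(\<Sum>i<l. t i \<omega>) = A 0 - A l + (\<Sum>i<l. u i \<omega>)"
            unfolding A_def by (rule sojourn_telescope) (use elim in blast)
          then have "\<bar>(\<Sum>i<l. t i \<omega>) - a * real l\<bar> \<le> \<epsilon> * real l + K"
            using A[of 0] A[of l] u1 K1(1) K2(1) unfolding K_def
            by (simp add: abs_le_iff distrib_right left_diff_distrib)
          then show False using big by simp
        qed
      qed
    qed measurable
    also have "\<dots> \<le> prob ?E1 + (prob ?E2 + (prob (?W 0) + (prob (?W l) + (prob (?Sv 0) + prob (?Sv l)))))"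
      by (rule order_trans[OF measure_Un_le], measurable, intro add_left_mono)+
         (rule measure_Un_le, measurable)
    also have "\<dots> \<le> \<delta>"
      using K1(2) K2(2) wait_tail[of 0] wait_tail[of l] s_tail[of 0] s_tail[of l] by linarith
    finally show "prob {\<omega>\<in>space M. \<epsilon> * real l + K < \<bar>(\<Sum>i<l. t i \<omega>) - a * real l\<bar>} \<le> \<delta>" .
  qed
qed

lemma second_station:
  assumes "b1 < a" "b2 < b1" "0 < d2" "nonneg_dist_fun F" "finite_mean F"
    and \<sigma>2: "(\<lambda>x. \<P>(\<omega> in M. \<sigma>2 0 \<omega> > x)) \<sim>[at_top] (\<lambda>x. d2 * tail F x)"
    and sub: "subexponential (integrated_tail F)"
  shows "second_station (interval_measure (integrated_tail F)) M (\<lambda>l. \<xi> l) (\<lambda>l. s l) t \<G> a b2 b1 d2"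
proof -
  interpret Xi: iid_walk M "\<lambda>l. \<xi> l" by (rule xi_walk)
  \<comment> \<open>The tail hypothesis concerns customer \<open>0\<close>, whereas the first jump
    considered is that of customer \<open>- 1\<close>.\<close>
  have law0: "prob {\<omega>\<in>space M. y < \<xi> 0 \<omega>} = prob {\<omega>\<in>space M. y < \<sigma>2 0 \<omega>}" for y
  proof -
    have "measure (distr M borel (\<sigma>2 n)) {y<..} = prob {\<omega>\<in>space M. y < \<sigma>2 n \<omega>}" for n
      using iidD(5)[OF service2_iid] by (subst measure_distr) (auto intro!: arg_cong[where f = prob])
    from this[of "- 1 - int 0"] this[of 0] show ?thesis
      by (simp only: iidD(1)[OF service2_iid, of "- 1 - int 0"])
  qed
  note sums = tail_sum_asymp[OF assms(4,5) sub \<sigma>2 assms(3)]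
  show ?thesis
  proof (intro second_station.intro second_station_axioms.intro xi_walk diff_walk s_le_t t_law
      indep_\<G> sets_\<G>_events sigma1_\<G> subexponential_imp_law(1)[OF sub])
    show "expectation (\<xi> 0) = b2" by (rule iidD(4)[OF service2_iid])
    show "expectation (\<lambda>\<omega>. \<xi> 0 \<omega> - s 0 \<omega>) = b2 - b1"
      by (simp add: iidD(3,4)[OF service2_iid] iidD(3,4)[OF service1_iid])
    show "AE \<omega> in M. 0 \<le> s n \<omega>" for n by (rule iidD(2)[OF service1_iid])
    show "space (\<G> l) = space M" for l by (simp add: \<G>_def)
    show "\<xi> i \<in> borel_measurable (\<G> l)" if "i \<noteq> l" for i l
      using field_\<G>[of "(2, - 1 - int i)" l] that by simp
    show "t i \<in> borel_measurable (\<G> l)" for i l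
      by (rule t_measurable[OF sigma1_\<G> interarrival_\<G>])
    show "eventually (\<lambda>x. summable (\<lambda>l. prob {\<omega>\<in>space M. x + \<kappa> * real l < \<xi> 0 \<omega>})) at_top"
      if "0 < \<kappa>" for \<kappa>
      using sums(1)[OF that] by (simp only: law0)
    show "((\<lambda>x. (\<Sum>l. prob {\<omega>\<in>space M. x + \<kappa> * real l < \<xi> 0 \<omega>}) /
        measure (interval_measure (integrated_tail F)) {x<..}) \<longlongrightarrow> d2 / \<kappa>) at_top" if "0 < \<kappa>" for \<kappa>
      using sums(2)[OF that] by (simp only: law0 subexponential_imp_law(2)[OF sub])
  qed (use assms in auto)
qed

end

theorem theorem10:
  fixes M :: "'a measure"
    and T \<sigma>1 \<sigma>2 :: "int \<Rightarrow> 'a \<Rightarrow> real"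
    and F :: "real \<Rightarrow> real"
    and a b1 b2 d2 :: real
  assumes "tandem_queue M T \<sigma>1 \<sigma>2 a b1 b2"
    and "a > b1" and "b1 > b2"
    and "nonneg_dist_fun F" and "finite_mean F"
    and "d2 > 0"
    and "(\<lambda>x. \<P>(\<omega> in M. \<sigma>2 0 \<omega> > x)) \<sim>[at_top] (\<lambda>x. d2 * tail F x)"
    and "subexponential (integrated_tail F)"
  shows "(\<lambda>x::real. \<P>(\<omega> in M. wait2 T \<sigma>1 \<sigma>2 0 \<omega> > ereal x))
           \<sim>[at_top] (\<lambda>x. d2 / (a - b2) * tail (integrated_tail F) x)"
proof -
  interpret Q: tandem_queue M T \<sigma>1 \<sigma>2 a b1 b2 by fact
  interpret Q2: second_station "interval_measure (integrated_tail F)" M "\<lambda>l. \<sigma>2 (- 1 - int l)"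
    "\<lambda>l. \<sigma>1 (- int l)" Q.t Q.\<G> a b2 b1 d2
    by (rule Q.second_station) (use assms in auto)
  have c: "d2 / (a - b2) \<noteq> 0" using assms by simp
  have "((\<lambda>x. (Q.prob (Q2.exceed x) / tail (integrated_tail F) x) / (d2 / (a - b2)))
      \<longlongrightarrow> (d2 / (a - b2)) / (d2 / (a - b2))) at_top"
    using Q2.exceed_asymp unfolding subexponential_imp_law(2)[OF assms(8)]
    by (rule tendsto_divide[OF _ tendsto_const c])
  moreover have "\<P>(\<omega> in M. wait2 T \<sigma>1 \<sigma>2 0 \<omega> > ereal x) = Q.prob (Q2.exceed x)" for x
    unfolding Q2.exceed_def Q2.Z_def Q.wait2_exceeds ..
  ultimately show ?thesis
    using c by (intro asymp_equivI') (simp add: field_simps)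
qed

end
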